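(* Let $\Omega^\bullet_d$ be an exterior algebra over a $\Bbbk$-algebra $A$, let $E$ be a left $A$-module and $n\ge 1$. Assume that $n=1$, or that $n>1$ and the following conditions hold: $\Omega^1_d$ and $\Omega^2_d$ are flat as right $A$-modules, $J^n_dE=A\,j^n_{d,E}(E)$, and the $n$-jet sequence $0\to S^n_dE\to J^n_dE\to J^{n-1}_dE\to 0$ at $E$ is exact. Furthermore, assume that, when $n\ge 3$, the $(n-1)$-jet sequence at $E$ is left exact and, when $n\ge 4$, that $\iota^{n-2}_{d,E}\colon S^{n-2}_dE\to J^{n-2}_dE$ is a monomorphism. Then there is a bijective correspondence between $n$-connections $C^n$ on $E$ and (left) connections $\nabla\colon J^{n-1}_dE\to\Omega^1_d\otimes_AJ^{n-1}_dE$ on $J^{n-1}_dE$ such that (1) $\Omega^1_d(\pi^{n-1,n-2}_{d,E})\circ\nabla=\mathcal S^{n-1,0}_{d,E}$; (2) the curvature $R_\nabla\colon J^{n-1}_dE\to\Omega^2_dJ^{n-1}_dE$ has values in $\Omega^2_dS^{n-1}_dE$. The correspondence maps an $n$-connection $C^n$ to its associated connection $\nabla^{C^n}:=\mathcal S^{n,0}_{d,E}\circ C^n$. The inverse construction maps a connection $\nabla$ on $J^{n-1}_dE$ satisfying (1) and (2) to the $n$-connection $C^n$ determined by $C^n\circ\pi^{n,n-1}_{d,E}=\mathrm{id}_{J^n_dE}-\iota^n_{d,E}\circ\widetilde\nabla^n$, where $\nabla^n\colon E\to S^n_dE$ is the differential operator of order at most $n$ uniquely identified by $$\Omega^1_d(\iota^{n-1}_{d,E})\circ\iota^n_{\wedge,E}\circ\nabla^n=\nabla\circ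 j^{n-1}_{d,E}\colon E\to\Omega^1_dJ^{n-1}_dE,$$ and $\widetilde\nabla^n\colon J^n_dE\to S^n_dE$ is the unique left $A$-linear map with $\widetilde\nabla^n\circ j^n_{d,E}=\nabla^n$ (which is a left splitting of the $n$-jet sequence). For $n=1$ this correspondence is the usual one between connections $\nabla$ on $E$ and right splittings $C^1$ of the $1$-jet sequence, where $C^1\circ\pi^{1,0}_{d,E}=\mathrm{id}-\iota^1_{d,E}\circ\widetilde\nabla$ with $\widetilde\nabla\colon J^1_dE\to\Omega^1_dE$ the unique $A$-linear map such that $\widetilde\nabla\circ j^1_{d,E}=\nabla$.
   Context: **Setting.** $\Bbbk$ is a commutative unital ring, $A$ an associative unital $\Bbbk$-algebra, $\otimes=\otimes_\Bbbk$. An exterior algebra $(\Omega^\bullet_d,\wedge,d)$ over $A$ is a differential graded $\Bbbk$-algebra with $\Omega^0_d=A$, generated by $A$ and $dA$ (each $\Omega^k_d$ is spanned by elements $a_0da_1\wedge\dots\wedge da_k$), where $d$ satisfies the graded Leibniz rule. $\Omega^k_d$ also denotes the functor $E\mapsto\Omega^k_dE=\Omega^k_d\otimes_AE$ on left $A$-modules; for an $A$-linear $f$, $\Omega^k_d(f)=\mathrm{id}\otimes_Af$. Composition of functors is juxtaposition. **1-jets.** For a left $A$-module $E$, $J^1_dE=(A\otimes E)/\{\sum_ia_i\otimes e_i:\sum_ia_ie_i=0,\ \sum_ida_i\otimes_Ae_i=0\}$, with $a[b\otimes e]=[ab\otimes e]$; it is functorial in $E$ via $[a\otimes e]\mapsto[a\otimes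 f(e)]$. Maps: $\pi^{1,0}_{d,E}([a\otimes e])=ae$ ($A$-linear), $j^1_{d,E}(e)=[1\otimes e]$ ($\Bbbk$-linear), $\iota^1_{d,E}\colon\Omega^1_dE\to J^1_dE$, $a\,db\otimes_Ae\mapsto[a\otimes be]-[ab\otimes e]$ ($A$-linear). **Holonomic jets.** Define $\Bbbk$-linear natural maps $D^I_E\colon J^1_dJ^1_dE\to\Omega^1_dE$, $[a\otimes[c\otimes e]]\mapsto a\,dc\otimes_Ae$, and $D^{II}_E\colon J^1_dJ^1_dE\to\Omega^2_dE$, $[a\otimes[c\otimes e]]\mapsto da\wedge dc\otimes_Ae$. Put $J^0_dE=E$, $l^1=\mathrm{id}_{J^1_d}$, and for $n\ge2$ let $l^n_{d,E}\colon J^n_dE\hookrightarrow J^1_dJ^{n-1}_dE$ be the inclusion of the left $A$-submodule of those $x$ with $D^I_{J^{n-2}_dE}(J^1_d(l^{n-1}_{d,E})(x))=0$ and $D^{II}_{J^{n-2}_dE}(J^1_d(l^{n-1}_{d,E})(x))=0$. Jet projections: $\pi^{n,n-1}_{d,E}=\pi^{1,0}_{d,J^{n-1}_dE}\circ l^n_{d,E}$. Prolongations: $j^0=\mathrm{id}$, and $j^n_{d,E}\colon E\to J^n_dE$ is the $\Bbbk$-linear map with $l^n_{d,E}\circ j^n_{d,E}=j^1_{d,J^{n-1}_dE}\circ j^{n-1}_{d,E}$. Convention: $J^{-1}_d=0$. **Symmetric forms.** $S^0_dE=E$, $S^1_dE=\Omega^1_dE$ with $\iota^1_{\wedge,E}=\mathrm{id}$;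 for $n\ge2$, $\iota^n_{\wedge,E}\colon S^n_dE\hookrightarrow\Omega^1_dS^{n-1}_dE$ is the kernel of $\Omega^1_dS^{n-1}_dE\xrightarrow{\Omega^1_d(\iota^{n-1}_{\wedge,E})}\Omega^1_d\Omega^1_dS^{n-2}_dE\xrightarrow{\wedge}\Omega^2_dS^{n-2}_dE$. $\iota^0_{d,E}=\mathrm{id}$, $\iota^1_{d,E}\colon S^1_dE=\Omega^1_dE\to J^1_dE$ is the $A$-linear map $a\,db\otimes_Ae\mapsto[a\otimes be]-[ab\otimes e]$, and $\iota^n_{d,E}\colon S^n_dE\to J^n_dE$ is the unique map with $l^n_{d,E}\circ\iota^n_{d,E}=\iota^1_{d,J^{n-1}_dE}\circ\Omega^1_d(\iota^{n-1}_{d,E})\circ\iota^n_{\wedge,E}$. The $n$-jet sequence at $E$ is $0\to S^n_dE\xrightarrow{\iota^n_{d,E}}J^n_dE\xrightarrow{\pi^{n,n-1}_{d,E}}J^{n-1}_dE\to0$; left exact means exact except possibly at $J^{n-1}_dE$. **Spencer operators.** $\mathcal S^{1,m}_{d,E}\colon\Omega^m_dJ^1_dE\to\Omega^{m+1}_dE$, $\omega\otimes_A[a\otimes e]\mapsto d(\omega a)\otimes_Ae$; $\mathcal S^{n,m}_{d,E}=\mathcal S^{1,m}_{d,J^{n-1}_dE}\circ\Omega^m_d(l^n_{d,E})\colon\Omega^m_dJ^n_dE\to\Omega^{m+1}_dJ^{n-1}_dE$ for $n\ge1$; $\mathcal S^{0,m}=0$ (so for $n=1$ conditions (1), (2) are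 vacuous). **Connections.** An $n$-connection on $E$ is a left $A$-linear map $C^n\colon J^{n-1}_dE\to J^n_dE$ with $\pi^{n,n-1}_{d,E}\circ C^n=\mathrm{id}$. A (left) connection on a left $A$-module $M$ is a $\Bbbk$-linear $\nabla\colon M\to\Omega^1_d\otimes_AM$ with $\nabla(am)=da\otimes_Am+a\nabla m$. Its exterior covariant derivative is $d_\nabla(\omega\otimes_Am)=d\omega\otimes_Am+(-1)^{\deg\omega}\omega\wedge\nabla m$, and its curvature is $R_\nabla=d_\nabla\circ\nabla\colon M\to\Omega^2_dM$. "Has values in $\Omega^2_dS^{n-1}_dE$" means that the image lies in the image of $\Omega^2_d(\iota^{n-1}_{d,E})$. A $\Bbbk$-linear map $\Delta\colon E\to F$ of left $A$-modules is a differential operator of order at most $n$ if there is a left $A$-linear $\widetilde\Delta\colon J^n_dE\to F$ with $\widetilde\Delta\circ j^n_{d,E}=\Delta$. *)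

theory Defs
  imports "HOL-Algebra.Module"
begin

section \<open>Left modules over a not necessarily commutative ring\<close>

text \<open>The locale \<^locale>\<open>module\<close> of HOL-Algebra is restricted to commutative rings; its record type
  is reused here. The fields \<^const>\<open>mult\<close> and \<^const>\<open>one\<close> of a module are never looked at.\<close>

locale left_module = R?: ring A + M?: abelian_group M
  for A (structure) and M (structure) +
  assumes smult_closed: "\<lbrakk>a \<in> carrier A; x \<in> carrier M\<rbrakk> \<Longrightarrow> a \<odot>\<^bsub>M\<^esub> x \<in> carrier M"
    and smult_l_distr: "\<lbrakk>a \<in> carrier A; b \<in> carrier A; x \<in> carrier M\<rbrakk> \<Longrightarrow>
      (a \<oplus>\<^bsub>A\<^esub> b) \<odot>\<^bsub>M\<^esub> x = a \<odot>\<^bsub>M\<^esub> x \<oplus>\<^bsub>M\<^esub> b \<odot>\<^bsub>M\<^esub> x"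
    and smult_r_distr: "\<lbrakk>a \<in> carrier A; x \<in> carrier M; y \<in> carrier M\<rbrakk> \<Longrightarrow>
      a \<odot>\<^bsub>M\<^esub> (x \<oplus>\<^bsub>M\<^esub> y) = a \<odot>\<^bsub>M\<^esub> x \<oplus>\<^bsub>M\<^esub> a \<odot>\<^bsub>M\<^esub> y"
    and smult_assoc: "\<lbrakk>a \<in> carrier A; b \<in> carrier A; x \<in> carrier M\<rbrakk> \<Longrightarrow>
      (a \<otimes>\<^bsub>A\<^esub> b) \<odot>\<^bsub>M\<^esub> x = a \<odot>\<^bsub>M\<^esub> (b \<odot>\<^bsub>M\<^esub> x)"
    and smult_one: "x \<in> carrier M \<Longrightarrow> \<one>\<^bsub>A\<^esub> \<odot>\<^bsub>M\<^esub> x = x"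

text \<open>Maps are taken in \<open>\<rightarrow>\<^sub>E\<close> (with value \<^const>\<open>undefined\<close> off the carrier), so that
  equality of HOL functions is equality of maps.\<close>

definition linear_maps ::
  "('a, 'b) ring_scheme \<Rightarrow> ('a, 'm, 'c) module_scheme \<Rightarrow> ('a, 'n, 'd) module_scheme \<Rightarrow> ('m \<Rightarrow> 'n) set" where
  "linear_maps A M N = {f \<in> carrier M \<rightarrow>\<^sub>E carrier N.
     (\<forall>x \<in> carrier M. \<forall>y \<in> carrier M. f (x \<oplus>\<^bsub>M\<^esub> y) = f x \<oplus>\<^bsub>N\<^esub> f y) \<and>
     (\<forall>a \<in> carrier A. \<forall>x \<in> carrier M. f (a \<odot>\<^bsub>M\<^esub> x) = a \<odot>\<^bsub>N\<^esub> f x)}"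

definition list_sum :: "('m, 'c) ring_scheme \<Rightarrow> ('x \<Rightarrow> 'm) \<Rightarrow> 'x list \<Rightarrow> 'm" where
  "list_sum M f xs = foldr (\<lambda>x s. f x \<oplus>\<^bsub>M\<^esub> s) xs \<zero>\<^bsub>M\<^esub>"


section \<open>A type closed under tensor products and quotients\<close>

text \<open>The modules \<open>J\<^sup>n E\<close> for all \<open>n\<close> have to live in one type. An element of a tensor product is
  represented as \<^term>\<open>Tens xs\<close>, where the formal sum \<open>xs\<close> of pairs is a chosen representative of its
  equivalence class; an element of a quotient module is a chosen representative of its coset.
  So tensor products and quotients of modules with elements in \<open>('w, 'e) elt\<close> again have elements
  in \<open>('w, 'e) elt\<close>. A module with elements in \<open>'e\<close> is transported to this type by
  the injection \<open>Atom\<close>, so nothing is lost by considering only modules in this type.\<close>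

datatype ('w, 'e) elt = Atom 'e | Tens (terms: "('w \<times> ('w, 'e) elt) list")

text \<open>\<open>X\<close> is an additive group with right scalar action \<open>ra\<close> and \<open>M\<close> one with left scalar action \<open>la\<close>
  of the set \<open>R\<close> of scalars. The relation is equality of formal sums in \<open>X \<otimes>\<^sub>R M\<close>.\<close>

inductive tensor_eq ::
  "('w, 'b) ring_scheme \<Rightarrow> 'r set \<Rightarrow> ('w \<Rightarrow> 'r \<Rightarrow> 'w) \<Rightarrow> ('r \<Rightarrow> 'm \<Rightarrow> 'm) \<Rightarrow> ('m, 'c) ring_scheme
     \<Rightarrow> ('w \<times> 'm) list \<Rightarrow> ('w \<times> 'm) list \<Rightarrow> bool"
  for X R ra la M where
  refl: "tensor_eq X R ra la M xs xs"
| sym: "tensor_eq X R ra la M xs ys \<Longrightarrow> tensor_eq X R ra la M ys xs"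
| trans: "tensor_eq X R ra la M xs ys \<Longrightarrow> tensor_eq X R ra la M ys zs \<Longrightarrow> tensor_eq X R ra la M xs zs"
| append: "tensor_eq X R ra la M xs xs' \<Longrightarrow> tensor_eq X R ra la M ys ys' \<Longrightarrow>
    tensor_eq X R ra la M (xs @ ys) (xs' @ ys')"
| comm: "tensor_eq X R ra la M (xs @ ys) (ys @ xs)"
| zero: "m \<in> carrier M \<Longrightarrow> tensor_eq X R ra la M [(\<zero>\<^bsub>X\<^esub>, m)] []"
| add_l: "\<lbrakk>x \<in> carrier X; y \<in> carrier X; m \<in> carrier M\<rbrakk> \<Longrightarrow>
    tensor_eq X R ra la M [(x \<oplus>\<^bsub>X\<^esub> y, m)] [(x, m), (y, m)]"
| add_r: "\<lbrakk>x \<in> carrier X; m \<in> carrier M; m' \<in> carrier M\<rbrakk> \<Longrightarrow>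
    tensor_eq X R ra la M [(x, m \<oplus>\<^bsub>M\<^esub> m')] [(x, m), (x, m')]"
| balanced: "\<lbrakk>x \<in> carrier X; r \<in> R; m \<in> carrier M\<rbrakk> \<Longrightarrow>
    tensor_eq X R ra la M [(ra x r, m)] [(x, la r m)]"

definition tensor_class ::
  "('w, 'b) ring_scheme \<Rightarrow> 'r set \<Rightarrow> ('w \<Rightarrow> 'r \<Rightarrow> 'w) \<Rightarrow> ('r \<Rightarrow> ('w, 'e) elt \<Rightarrow> ('w, 'e) elt)
     \<Rightarrow> (('w, 'e) elt, 'c) ring_scheme \<Rightarrow> ('w \<times> ('w, 'e) elt) list \<Rightarrow> ('w, 'e) elt" where
  "tensor_class X R ra la M xs =
     Tens (SOME ys. set ys \<subseteq> carrier X \<times> carrier M \<and> tensor_eq X R ra la M xs ys)"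

text \<open>\<open>X \<otimes>\<^sub>R M\<close>, with left scalar multiplication through the product of \<open>X\<close>.\<close>

definition tensor ::
  "('w, 'b) ring_scheme \<Rightarrow> 'r set \<Rightarrow> ('w \<Rightarrow> 'r \<Rightarrow> 'w) \<Rightarrow> ('r \<Rightarrow> ('w, 'e) elt \<Rightarrow> ('w, 'e) elt)
     \<Rightarrow> (('w, 'e) elt, 'c) ring_scheme \<Rightarrow> ('w, ('w, 'e) elt) module" where
  "tensor X R ra la M = (let cl = tensor_class X R ra la M in
     \<lparr>carrier = cl ` {xs. set xs \<subseteq> carrier X \<times> carrier M},
      monoid.mult = undefined, one = undefined,
      zero = cl [],
      add = (\<lambda>s t. cl (terms s @ terms t)),
      smult = (\<lambda>a t. cl (map (\<lambda>(x, m). (a \<otimes>\<^bsub>X\<^esub> x, m)) (terms t)))\<rparr>)"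

text \<open>The additive map with values in \<open>P\<close> sending \<open>x \<otimes> m\<close> to \<open>f x m\<close> (also used for maps out of a quotient
  of a tensor product). It is evaluated on the chosen representative, hence meaningful
  when \<open>f\<close> respects the relations, as is the case in all uses below.\<close>

definition lift :: "('p, 'c) ring_scheme \<Rightarrow> ('w \<Rightarrow> ('w, 'e) elt \<Rightarrow> 'p) \<Rightarrow> ('w, 'e) elt \<Rightarrow> 'p" where
  "lift P f t = list_sum P (\<lambda>(x, m). f x m) (terms t)"

definition coset_rep :: "('m, 'c) ring_scheme \<Rightarrow> 'm set \<Rightarrow> 'm \<Rightarrow> 'm" where
  "coset_rep M N x = (SOME y. y \<in> carrier M \<and> x \<ominus>\<^bsub>M\<^esub> y \<in> N)"

definition quotient_module :: "('a, 'm) module \<Rightarrow> 'm set \<Rightarrow> ('a, 'm) module" where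
  "quotient_module M N =
     \<lparr>carrier = coset_rep M N ` carrier M,
      monoid.mult = undefined, one = undefined,
      zero = coset_rep M N \<zero>\<^bsub>M\<^esub>,
      add = (\<lambda>x y. coset_rep M N (x \<oplus>\<^bsub>M\<^esub> y)),
      smult = (\<lambda>a x. coset_rep M N (a \<odot>\<^bsub>M\<^esub> x))\<rparr>"


section \<open>Exterior algebras\<close>

text \<open>A differential graded algebra is given as an internally graded algebra. The algebra \<open>A\<close> is its
  degree \<open>0\<close> part.\<close>

record ('k, 'w) dg_algebra = "('k, 'w) module" +
  scalars :: "'k ring"
  grade :: "nat \<Rightarrow> 'w set"
  diff :: "'w \<Rightarrow> 'w"

definition forms :: "('k, 'w) dg_algebra \<Rightarrow> nat \<Rightarrow> ('k, 'w) dg_algebra" where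
  "forms \<Omega> k = \<Omega>\<lparr>carrier := grade \<Omega> k\<rparr>"

abbreviation coeffs :: "('k, 'w) dg_algebra \<Rightarrow> ('k, 'w) dg_algebra" where
  "coeffs \<Omega> \<equiv> forms \<Omega> 0"

locale exterior_algebra =
  fixes \<Omega> :: "('k, 'w) dg_algebra" (structure)
  assumes scalars_cring: "cring (scalars \<Omega>)"
    and is_ring: "ring \<Omega>"
    and is_module: "module (scalars \<Omega>) \<Omega>"
    and smult_mult_l: "\<lbrakk>c \<in> carrier (scalars \<Omega>); x \<in> carrier \<Omega>; y \<in> carrier \<Omega>\<rbrakk> \<Longrightarrow>
      (c \<odot> x) \<otimes> y = c \<odot> (x \<otimes> y)"
    and smult_mult_r: "\<lbrakk>c \<in> carrier (scalars \<Omega>); x \<in> carrier \<Omega>; y \<in> carrier \<Omega>\<rbrakk> \<Longrightarrow>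
      x \<otimes> (c \<odot> y) = c \<odot> (x \<otimes> y)"
    and grade_submodule: "submodule (grade \<Omega> k) (scalars \<Omega>) \<Omega>"
    and grade_sum: "x \<in> carrier \<Omega> \<Longrightarrow> \<exists>n f. (\<forall>k. f k \<in> grade \<Omega> k) \<and> x = finsum \<Omega> f {..n::nat}"
    and grade_direct: "\<lbrakk>\<And>k. f k \<in> grade \<Omega> k; finsum \<Omega> f {..n::nat} = \<zero>; k \<le> n\<rbrakk> \<Longrightarrow> f k = \<zero>"
    and one_grade: "\<one> \<in> grade \<Omega> 0"
    and mult_grade: "\<lbrakk>x \<in> grade \<Omega> k; y \<in> grade \<Omega> l\<rbrakk> \<Longrightarrow> x \<otimes> y \<in> grade \<Omega> (k + l)"
    and diff_closed: "x \<in> carrier \<Omega> \<Longrightarrow> diff \<Omega> x \<in> carrier \<Omega>"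
    and diff_add: "\<lbrakk>x \<in> carrier \<Omega>; y \<in> carrier \<Omega>\<rbrakk> \<Longrightarrow> diff \<Omega> (x \<oplus> y) = diff \<Omega> x \<oplus> diff \<Omega> y"
    and diff_smult: "\<lbrakk>c \<in> carrier (scalars \<Omega>); x \<in> carrier \<Omega>\<rbrakk> \<Longrightarrow> diff \<Omega> (c \<odot> x) = c \<odot> diff \<Omega> x"
    and diff_grade: "x \<in> grade \<Omega> k \<Longrightarrow> diff \<Omega> x \<in> grade \<Omega> (Suc k)"
    and diff_diff: "x \<in> carrier \<Omega> \<Longrightarrow> diff \<Omega> (diff \<Omega> x) = \<zero>"
    and leibniz: "\<lbrakk>x \<in> grade \<Omega> k; y \<in> carrier \<Omega>\<rbrakk> \<Longrightarrow>
      diff \<Omega> (x \<otimes> y) = diff \<Omega> x \<otimes> y \<oplus> ((\<ominus> \<one>) [^] k) \<otimes> (x \<otimes> diff \<Omega> y)"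
    and generated: "x \<in> grade \<Omega> k \<Longrightarrow>
      \<exists>ts. (\<forall>(a, bs) \<in> set ts. a \<in> grade \<Omega> 0 \<and> set bs \<subseteq> grade \<Omega> 0 \<and> length bs = k) \<and>
        x = list_sum \<Omega> (\<lambda>(a, bs). a \<otimes> foldr (\<lambda>b w. diff \<Omega> b \<otimes> w) bs \<one>) ts"

type_synonym ('w, 'e) emodule = "('w, ('w, 'e) elt) module"

text \<open>The scalar ring acts on an \<open>A\<close>-module through \<open>c \<mapsto> c 1\<^sub>A\<close>.\<close>

definition scal :: "('k, 'w) dg_algebra \<Rightarrow> ('w, 'm) module \<Rightarrow> 'k \<Rightarrow> 'm \<Rightarrow> 'm" where
  "scal \<Omega> M c x = (c \<odot>\<^bsub>\<Omega>\<^esub> \<one>\<^bsub>\<Omega>\<^esub>) \<odot>\<^bsub>M\<^esub> x"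

definition scalar_linear_maps ::
  "('k, 'w) dg_algebra \<Rightarrow> ('w, 'm) module \<Rightarrow> ('w, 'n) module \<Rightarrow> ('m \<Rightarrow> 'n) set" where
  "scalar_linear_maps \<Omega> M N = {f \<in> carrier M \<rightarrow>\<^sub>E carrier N.
     (\<forall>x \<in> carrier M. \<forall>y \<in> carrier M. f (x \<oplus>\<^bsub>M\<^esub> y) = f x \<oplus>\<^bsub>N\<^esub> f y) \<and>
     (\<forall>c \<in> carrier (scalars \<Omega>). \<forall>x \<in> carrier M. f (scal \<Omega> M c x) = scal \<Omega> N c (f x))}"

text \<open>The functor \<open>\<Omega>\<^sup>k = \<Omega>\<^sup>k \<otimes>\<^sub>A _\<close>.\<close>

definition Om :: "('k, 'w) dg_algebra \<Rightarrow> nat \<Rightarrow> ('w, 'e) emodule \<Rightarrow> ('w, 'e) emodule" where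
  "Om \<Omega> k M = tensor (forms \<Omega> k) (carrier (coeffs \<Omega>)) (mult \<Omega>) (smult M) M"

definition om :: "('k, 'w) dg_algebra \<Rightarrow> nat \<Rightarrow> ('w, 'e) emodule \<Rightarrow> 'w \<Rightarrow> ('w, 'e) elt \<Rightarrow> ('w, 'e) elt" where
  "om \<Omega> k M w m = tensor_class (forms \<Omega> k) (carrier (coeffs \<Omega>)) (mult \<Omega>) (smult M) M [(w, m)]"

definition Om_map ::
  "('k, 'w) dg_algebra \<Rightarrow> nat \<Rightarrow> ('w, 'e) emodule \<Rightarrow> (('w, 'e) elt \<Rightarrow> ('w, 'e) elt) \<Rightarrow> ('w, 'e) elt \<Rightarrow> ('w, 'e) elt" where
  "Om_map \<Omega> k N f = lift (Om \<Omega> k N) (\<lambda>w m. om \<Omega> k N w (f m))"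

text \<open>\<open>wedge \<Omega> k l M w\<close> is \<open>\<Omega>\<^sup>l M \<rightarrow> \<Omega>\<^sup>k\<^sup>+\<^sup>l M, v \<otimes> m \<mapsto> (w \<and> v) \<otimes> m\<close>, for \<open>w\<close> of degree \<open>k\<close>.\<close>

definition wedge ::
  "('k, 'w) dg_algebra \<Rightarrow> nat \<Rightarrow> nat \<Rightarrow> ('w, 'e) emodule \<Rightarrow> 'w \<Rightarrow> ('w, 'e) elt \<Rightarrow> ('w, 'e) elt" where
  "wedge \<Omega> k l M w = lift (Om \<Omega> (k + l) M) (\<lambda>v m. om \<Omega> (k + l) M (w \<otimes>\<^bsub>\<Omega>\<^esub> v) m)"

text \<open>Flatness of the right \<open>A\<close>-module \<open>\<Omega>\<^sup>k\<close>. The modules tested are those with elements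
  in \<open>('w, 'e) elt\<close>; as \<open>'w\<close> embeds in this type, all left ideals of \<open>A\<close> occur among them up to isomorphism,
  so that this does not depend on \<open>'e\<close>.\<close>

definition flat_forms :: "('k, 'w) dg_algebra \<Rightarrow> nat \<Rightarrow> 'e itself \<Rightarrow> bool" where
  "flat_forms \<Omega> k _ \<longleftrightarrow> (\<forall>(M :: ('w, 'e) emodule) (N :: ('w, 'e) emodule) f.
     left_module (coeffs \<Omega>) M \<and> left_module (coeffs \<Omega>) N \<and>
     f \<in> linear_maps (coeffs \<Omega>) M N \<and> inj_on f (carrier M) \<longrightarrow>
     inj_on (Om_map \<Omega> k N f) (carrier (Om \<Omega> k M)))"


section \<open>1-jets\<close>

definition AE :: "('k, 'w) dg_algebra \<Rightarrow> ('w, 'e) emodule \<Rightarrow> ('w, 'e) emodule" where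
  "AE \<Omega> E = tensor (coeffs \<Omega>) (carrier (scalars \<Omega>)) (\<lambda>a c. c \<odot>\<^bsub>\<Omega>\<^esub> a) (scal \<Omega> E) E"

definition ae :: "('k, 'w) dg_algebra \<Rightarrow> ('w, 'e) emodule \<Rightarrow> ('w \<times> ('w, 'e) elt) list \<Rightarrow> ('w, 'e) elt" where
  "ae \<Omega> E = tensor_class (coeffs \<Omega>) (carrier (scalars \<Omega>)) (\<lambda>a c. c \<odot>\<^bsub>\<Omega>\<^esub> a) (scal \<Omega> E) E"

definition jet1_relations :: "('k, 'w) dg_algebra \<Rightarrow> ('w, 'e) emodule \<Rightarrow> ('w, 'e) elt set" where
  "jet1_relations \<Omega> E = ae \<Omega> E ` {xs. set xs \<subseteq> carrier (coeffs \<Omega>) \<times> carrier E \<and>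
     list_sum E (\<lambda>(a, e). a \<odot>\<^bsub>E\<^esub> e) xs = \<zero>\<^bsub>E\<^esub> \<and>
     list_sum (Om \<Omega> 1 E) (\<lambda>(a, e). om \<Omega> 1 E (diff \<Omega> a) e) xs = \<zero>\<^bsub>Om \<Omega> 1 E\<^esub>}"

definition J1 :: "('k, 'w) dg_algebra \<Rightarrow> ('w, 'e) emodule \<Rightarrow> ('w, 'e) emodule" where
  "J1 \<Omega> E = quotient_module (AE \<Omega> E) (jet1_relations \<Omega> E)"

text \<open>The class \<open>[a \<otimes> e]\<close>.\<close>

definition jet1_class :: "('k, 'w) dg_algebra \<Rightarrow> ('w, 'e) emodule \<Rightarrow> 'w \<Rightarrow> ('w, 'e) elt \<Rightarrow> ('w, 'e) elt" where
  "jet1_class \<Omega> E a e = coset_rep (AE \<Omega> E) (jet1_relations \<Omega> E) (ae \<Omega> E [(a, e)])"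

definition J1_map ::
  "('k, 'w) dg_algebra \<Rightarrow> ('w, 'e) emodule \<Rightarrow> (('w, 'e) elt \<Rightarrow> ('w, 'e) elt) \<Rightarrow> ('w, 'e) elt \<Rightarrow> ('w, 'e) elt" where
  "J1_map \<Omega> F f = lift (J1 \<Omega> F) (\<lambda>a e. jet1_class \<Omega> F a (f e))"

definition proj1 :: "('w, 'e) emodule \<Rightarrow> ('w, 'e) elt \<Rightarrow> ('w, 'e) elt" where
  "proj1 E = lift E (\<lambda>a e. a \<odot>\<^bsub>E\<^esub> e)"

definition prol1 :: "('k, 'w) dg_algebra \<Rightarrow> ('w, 'e) emodule \<Rightarrow> ('w, 'e) elt \<Rightarrow> ('w, 'e) elt" where
  "prol1 \<Omega> E e = jet1_class \<Omega> E \<one>\<^bsub>\<Omega>\<^esub> e"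

text \<open>\<open>\<iota>\<^sup>1\<close> is given by its values on the generators \<open>a db \<otimes> e\<close>.\<close>

definition iota1 :: "('k, 'w) dg_algebra \<Rightarrow> ('w, 'e) emodule \<Rightarrow> ('w, 'e) elt \<Rightarrow> ('w, 'e) elt" where
  "iota1 \<Omega> E = (THE f. f \<in> linear_maps (coeffs \<Omega>) (Om \<Omega> 1 E) (J1 \<Omega> E) \<and>
     (\<forall>a \<in> carrier (coeffs \<Omega>). \<forall>b \<in> carrier (coeffs \<Omega>). \<forall>e \<in> carrier E.
        f (om \<Omega> 1 E (a \<otimes>\<^bsub>\<Omega>\<^esub> diff \<Omega> b) e) =
        jet1_class \<Omega> E a (b \<odot>\<^bsub>E\<^esub> e) \<ominus>\<^bsub>J1 \<Omega> E\<^esub> jet1_class \<Omega> E (a \<otimes>\<^bsub>\<Omega>\<^esub> b) e))"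


section \<open>Holonomic jets\<close>

definition D_I :: "('k, 'w) dg_algebra \<Rightarrow> ('w, 'e) emodule \<Rightarrow> ('w, 'e) elt \<Rightarrow> ('w, 'e) elt" where
  "D_I \<Omega> E = lift (Om \<Omega> 1 E) (\<lambda>a. lift (Om \<Omega> 1 E) (\<lambda>c e. om \<Omega> 1 E (a \<otimes>\<^bsub>\<Omega>\<^esub> diff \<Omega> c) e))"

definition D_II :: "('k, 'w) dg_algebra \<Rightarrow> ('w, 'e) emodule \<Rightarrow> ('w, 'e) elt \<Rightarrow> ('w, 'e) elt" where
  "D_II \<Omega> E = lift (Om \<Omega> 2 E) (\<lambda>a. lift (Om \<Omega> 2 E) (\<lambda>c e. om \<Omega> 2 E (diff \<Omega> a \<otimes>\<^bsub>\<Omega>\<^esub> diff \<Omega> c) e))"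

text \<open>\<open>l\<^sup>n : J\<^sup>n E \<rightarrow> J\<^sup>1 J\<^sup>n\<^sup>-\<^sup>1 E\<close> for \<open>n \<ge> 1\<close>. As \<open>J\<^sup>n E\<close> is realised as a subset of \<open>J\<^sup>1 J\<^sup>n\<^sup>-\<^sup>1 E\<close>, it does not
  change the element. The same applies to the inclusion \<open>sym_incl\<close> of \<open>S\<^sup>n E\<close> in \<open>\<Omega>\<^sup>1 S\<^sup>n\<^sup>-\<^sup>1 E\<close>.\<close>

definition jet_incl :: "nat \<Rightarrow> ('w, 'e) emodule \<Rightarrow> ('w, 'e) elt \<Rightarrow> ('w, 'e) elt" where
  "jet_incl n E x = x"

fun Jet :: "('k, 'w) dg_algebra \<Rightarrow> nat \<Rightarrow> ('w, 'e) emodule \<Rightarrow> ('w, 'e) emodule" where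
  "Jet \<Omega> 0 E = E"
| "Jet \<Omega> (Suc 0) E = J1 \<Omega> E"
| "Jet \<Omega> (Suc (Suc n)) E = (J1 \<Omega> (Jet \<Omega> (Suc n) E))
     \<lparr>carrier := {x \<in> carrier (J1 \<Omega> (Jet \<Omega> (Suc n) E)).
        D_I \<Omega> (Jet \<Omega> n E) (J1_map \<Omega> (J1 \<Omega> (Jet \<Omega> n E)) (jet_incl (Suc n) E) x) = \<zero>\<^bsub>Om \<Omega> 1 (Jet \<Omega> n E)\<^esub> \<and>
        D_II \<Omega> (Jet \<Omega> n E) (J1_map \<Omega> (J1 \<Omega> (Jet \<Omega> n E)) (jet_incl (Suc n) E) x) = \<zero>\<^bsub>Om \<Omega> 2 (Jet \<Omega> n E)\<^esub>}\<rparr>"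

text \<open>\<open>\<pi>\<^sup>n\<^sup>,\<^sup>n\<^sup>-\<^sup>1\<close> for \<open>n \<ge> 1\<close>.\<close>

definition jet_proj :: "('k, 'w) dg_algebra \<Rightarrow> nat \<Rightarrow> ('w, 'e) emodule \<Rightarrow> ('w, 'e) elt \<Rightarrow> ('w, 'e) elt" where
  "jet_proj \<Omega> n E x = proj1 (Jet \<Omega> (n - 1) E) (jet_incl n E x)"

text \<open>The defining equation \<open>l\<^sup>n \<circ> j\<^sup>n = j\<^sup>1 \<circ> j\<^sup>n\<^sup>-\<^sup>1\<close>, in which \<open>l\<^sup>n\<close> leaves elements unchanged.\<close>

primrec prol :: "('k, 'w) dg_algebra \<Rightarrow> nat \<Rightarrow> ('w, 'e) emodule \<Rightarrow> ('w, 'e) elt \<Rightarrow> ('w, 'e) elt" where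
  "prol \<Omega> 0 E e = e"
| "prol \<Omega> (Suc n) E e = prol1 \<Omega> (Jet \<Omega> n E) (prol \<Omega> n E e)"

text \<open>\<open>J\<^sup>n E = A j\<^sup>n(E)\<close>.\<close>

definition jets_generated :: "('k, 'w) dg_algebra \<Rightarrow> nat \<Rightarrow> ('w, 'e) emodule \<Rightarrow> bool" where
  "jets_generated \<Omega> n E \<longleftrightarrow> carrier (Jet \<Omega> n E) =
     list_sum (Jet \<Omega> n E) (\<lambda>(a, e). a \<odot>\<^bsub>Jet \<Omega> n E\<^esub> prol \<Omega> n E e) `
       {xs. set xs \<subseteq> carrier (coeffs \<Omega>) \<times> carrier E}"

definition diff_ops ::
  "('k, 'w) dg_algebra \<Rightarrow> nat \<Rightarrow> ('w, 'e) emodule \<Rightarrow> ('w, 'e) emodule \<Rightarrow> (('w, 'e) elt \<Rightarrow> ('w, 'e) elt) set" where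
  "diff_ops \<Omega> n E F = {\<Delta> \<in> scalar_linear_maps \<Omega> E F.
     \<exists>T \<in> linear_maps (coeffs \<Omega>) (Jet \<Omega> n E) F. \<forall>e \<in> carrier E. T (prol \<Omega> n E e) = \<Delta> e}"


section \<open>Symmetric forms and the jet sequence\<close>

definition sym_incl :: "nat \<Rightarrow> ('w, 'e) emodule \<Rightarrow> ('w, 'e) elt \<Rightarrow> ('w, 'e) elt" where
  "sym_incl n E x = x"

fun Sym :: "('k, 'w) dg_algebra \<Rightarrow> nat \<Rightarrow> ('w, 'e) emodule \<Rightarrow> ('w, 'e) emodule" where
  "Sym \<Omega> 0 E = E"
| "Sym \<Omega> (Suc 0) E = Om \<Omega> 1 E"
| "Sym \<Omega> (Suc (Suc n)) E = (Om \<Omega> 1 (Sym \<Omega> (Suc n) E))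
     \<lparr>carrier := {x \<in> carrier (Om \<Omega> 1 (Sym \<Omega> (Suc n) E)).
        lift (Om \<Omega> (1 + 1) (Sym \<Omega> n E)) (wedge \<Omega> 1 1 (Sym \<Omega> n E))
          (Om_map \<Omega> 1 (Om \<Omega> 1 (Sym \<Omega> n E)) (sym_incl (Suc n) E) x) = \<zero>\<^bsub>Om \<Omega> (1 + 1) (Sym \<Omega> n E)\<^esub>}\<rparr>"

fun iota :: "('k, 'w) dg_algebra \<Rightarrow> nat \<Rightarrow> ('w, 'e) emodule \<Rightarrow> ('w, 'e) elt \<Rightarrow> ('w, 'e) elt" where
  "iota \<Omega> 0 E x = x"
| "iota \<Omega> (Suc 0) E x = iota1 \<Omega> E x"
| "iota \<Omega> (Suc (Suc n)) E x = iota1 \<Omega> (Jet \<Omega> (Suc n) E)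
     (Om_map \<Omega> 1 (Jet \<Omega> (Suc n) E) (iota \<Omega> (Suc n) E) (sym_incl (Suc (Suc n)) E x))"

definition jet_seq_left_exact :: "('k, 'w) dg_algebra \<Rightarrow> nat \<Rightarrow> ('w, 'e) emodule \<Rightarrow> bool" where
  "jet_seq_left_exact \<Omega> n E \<longleftrightarrow>
     inj_on (iota \<Omega> n E) (carrier (Sym \<Omega> n E)) \<and>
     iota \<Omega> n E ` carrier (Sym \<Omega> n E) =
       {x \<in> carrier (Jet \<Omega> n E). jet_proj \<Omega> n E x = \<zero>\<^bsub>Jet \<Omega> (n - 1) E\<^esub>}"

definition jet_seq_exact :: "('k, 'w) dg_algebra \<Rightarrow> nat \<Rightarrow> ('w, 'e) emodule \<Rightarrow> bool" where
  "jet_seq_exact \<Omega> n E \<longleftrightarrow> jet_seq_left_exact \<Omega> n E \<and>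
     jet_proj \<Omega> n E ` carrier (Jet \<Omega> n E) = carrier (Jet \<Omega> (n - 1) E)"


section \<open>Spencer operators, connections and n-connections\<close>

definition spencer1 :: "('k, 'w) dg_algebra \<Rightarrow> nat \<Rightarrow> ('w, 'e) emodule \<Rightarrow> ('w, 'e) elt \<Rightarrow> ('w, 'e) elt" where
  "spencer1 \<Omega> m E = lift (Om \<Omega> (Suc m) E)
     (\<lambda>w. lift (Om \<Omega> (Suc m) E) (\<lambda>a e. om \<Omega> (Suc m) E (diff \<Omega> (w \<otimes>\<^bsub>\<Omega>\<^esub> a)) e))"

text \<open>\<open>\<S>\<^sup>n\<^sup>,\<^sup>m : \<Omega>\<^sup>m J\<^sup>n E \<rightarrow> \<Omega>\<^sup>m\<^sup>+\<^sup>1 J\<^sup>n\<^sup>-\<^sup>1 E\<close> for \<open>n \<ge> 1\<close>.\<close>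

definition spencer ::
  "('k, 'w) dg_algebra \<Rightarrow> nat \<Rightarrow> nat \<Rightarrow> ('w, 'e) emodule \<Rightarrow> ('w, 'e) elt \<Rightarrow> ('w, 'e) elt" where
  "spencer \<Omega> n m E x = spencer1 \<Omega> m (Jet \<Omega> (n - 1) E)
     (Om_map \<Omega> m (J1 \<Omega> (Jet \<Omega> (n - 1) E)) (jet_incl n E) x)"

text \<open>\<open>\<S>\<^sup>n\<^sup>,\<^sup>0\<close> on \<open>J\<^sup>n E\<close>, with the identification \<open>J\<^sup>n E = A \<otimes>\<^sub>A J\<^sup>n E, x \<mapsto> 1 \<otimes> x\<close>.\<close>

definition spencer0 :: "('k, 'w) dg_algebra \<Rightarrow> nat \<Rightarrow> ('w, 'e) emodule \<Rightarrow> ('w, 'e) elt \<Rightarrow> ('w, 'e) elt" where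
  "spencer0 \<Omega> n E x = spencer \<Omega> n 0 E (om \<Omega> 0 (Jet \<Omega> n E) \<one>\<^bsub>\<Omega>\<^esub> x)"

definition n_connections ::
  "('k, 'w) dg_algebra \<Rightarrow> nat \<Rightarrow> ('w, 'e) emodule \<Rightarrow> (('w, 'e) elt \<Rightarrow> ('w, 'e) elt) set" where
  "n_connections \<Omega> n E = {C \<in> linear_maps (coeffs \<Omega>) (Jet \<Omega> (n - 1) E) (Jet \<Omega> n E).
     \<forall>x \<in> carrier (Jet \<Omega> (n - 1) E). jet_proj \<Omega> n E (C x) = x}"

definition connections ::
  "('k, 'w) dg_algebra \<Rightarrow> ('w, 'e) emodule \<Rightarrow> (('w, 'e) elt \<Rightarrow> ('w, 'e) elt) set" where
  "connections \<Omega> M = {nab \<in> scalar_linear_maps \<Omega> M (Om \<Omega> 1 M).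
     \<forall>a \<in> carrier (coeffs \<Omega>). \<forall>m \<in> carrier M.
       nab (a \<odot>\<^bsub>M\<^esub> m) = om \<Omega> 1 M (diff \<Omega> a) m \<oplus>\<^bsub>Om \<Omega> 1 M\<^esub> a \<odot>\<^bsub>Om \<Omega> 1 M\<^esub> nab m}"

text \<open>The exterior covariant derivative on \<open>\<Omega>\<^sup>k M\<close>.\<close>

definition ext_cov_deriv ::
  "('k, 'w) dg_algebra \<Rightarrow> nat \<Rightarrow> ('w, 'e) emodule \<Rightarrow> (('w, 'e) elt \<Rightarrow> ('w, 'e) elt) \<Rightarrow> ('w, 'e) elt \<Rightarrow> ('w, 'e) elt" where
  "ext_cov_deriv \<Omega> k M nab = lift (Om \<Omega> (k + 1) M) (\<lambda>w m. om \<Omega> (k + 1) M (diff \<Omega> w) m \<oplus>\<^bsub>Om \<Omega> (k + 1) M\<^esub>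
     ((\<ominus>\<^bsub>\<Omega>\<^esub> \<one>\<^bsub>\<Omega>\<^esub>) [^]\<^bsub>\<Omega>\<^esub> k) \<odot>\<^bsub>Om \<Omega> (k + 1) M\<^esub> wedge \<Omega> k 1 M w (nab m))"

definition curvature ::
  "('k, 'w) dg_algebra \<Rightarrow> ('w, 'e) emodule \<Rightarrow> (('w, 'e) elt \<Rightarrow> ('w, 'e) elt) \<Rightarrow> ('w, 'e) elt \<Rightarrow> ('w, 'e) elt" where
  "curvature \<Omega> M nab x = ext_cov_deriv \<Omega> 1 M nab (nab x)"

text \<open>The connections on \<open>J\<^sup>n\<^sup>-\<^sup>1 E\<close> satisfying (1) and (2). For \<open>n = 1\<close>, (1) is an equation between maps into
  \<open>\<Omega>\<^sup>1 J\<^sup>-\<^sup>1 E = 0\<close>, whence the guard.\<close>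

definition jet_connections ::
  "('k, 'w) dg_algebra \<Rightarrow> nat \<Rightarrow> ('w, 'e) emodule \<Rightarrow> (('w, 'e) elt \<Rightarrow> ('w, 'e) elt) set" where
  "jet_connections \<Omega> n E = {nab \<in> connections \<Omega> (Jet \<Omega> (n - 1) E).
     (n \<ge> 2 \<longrightarrow> (\<forall>x \<in> carrier (Jet \<Omega> (n - 1) E).
        Om_map \<Omega> 1 (Jet \<Omega> (n - 2) E) (jet_proj \<Omega> (n - 1) E) (nab x) = spencer0 \<Omega> (n - 1) E x)) \<and>
     (\<forall>x \<in> carrier (Jet \<Omega> (n - 1) E). curvature \<Omega> (Jet \<Omega> (n - 1) E) nab x \<in>
        Om_map \<Omega> 2 (Jet \<Omega> (n - 1) E) (iota \<Omega> (n - 1) E) ` carrier (Om \<Omega> 2 (Sym \<Omega> (n - 1) E)))}"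

definition assoc_connection ::
  "('k, 'w) dg_algebra \<Rightarrow> nat \<Rightarrow> ('w, 'e) emodule \<Rightarrow> (('w, 'e) elt \<Rightarrow> ('w, 'e) elt) \<Rightarrow> ('w, 'e) elt \<Rightarrow> ('w, 'e) elt" where
  "assoc_connection \<Omega> n E C = restrict (\<lambda>x. spencer0 \<Omega> n E (C x)) (carrier (Jet \<Omega> (n - 1) E))"

end

theory Submission
  imports Defs
begin

text \<open>A 1-jet \<open>x \<in> J\<^sup>1 M\<close> is the same as the pair \<open>(\<pi> x, \<sigma> x) \<in> M \<times> \<Omega>\<^sup>1 M\<close>, where \<open>\<sigma> [a \<otimes> e] = da \<otimes> e\<close>; so a linear
  right inverse of \<open>\<pi>\<close> is a map \<open>x \<mapsto> (x, \<nabla> x)\<close> with \<open>\<nabla>\<close> a connection. For \<open>M = J\<^sup>n\<^sup>-\<^sup>1 E\<close>, let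
  \<open>\<K> (w \<otimes> y) = w \<and> \<sigma> y - dw \<otimes> \<pi> y\<close> on \<open>\<Omega>\<^sup>1 J\<^sup>n\<^sup>-\<^sup>1 E\<close>. The pair \<open>(x, \<nabla> x)\<close> lies in \<open>J\<^sup>n E\<close> iff \<open>\<Omega>\<^sup>1(\<pi>)(\<nabla> x) = \<sigma> x\<close>, which is
  condition (1), and \<open>\<K> (\<nabla> x) = 0\<close>. Under (1), \<open>\<Omega>\<^sup>2(\<pi>)(R x) = - \<K> (\<nabla> x)\<close> for the curvature \<open>R\<close>, and as \<open>\<Omega>\<^sup>2\<close>
  is flat, the kernel of \<open>\<Omega>\<^sup>2(\<pi>)\<close> is the image of \<open>\<Omega>\<^sup>2(\<iota>)\<close>; so the second condition is (2). Since
  \<open>\<iota>\<^sup>n t = (0, - \<Omega>\<^sup>1(\<iota>\<^sup>n\<^sup>-\<^sup>1) t)\<close> and \<open>j\<^sup>n e = (j\<^sup>n\<^sup>-\<^sup>1 e, 0)\<close>, the splitting \<open>x \<mapsto> (\<iota>\<^sup>n)\<^sup>-\<^sup>1 (x - C (\<pi> x))\<close> belonging to \<open>C\<close>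
  maps \<open>j\<^sup>n e\<close> to the element of \<open>S\<^sup>n E\<close> given by \<open>\<nabla> (j\<^sup>n\<^sup>-\<^sup>1 e)\<close>.\<close>

section \<open>Additive maps and list sums\<close>

text \<open>\<open>\<K>\<close> is \<open>cov\<close> below. It is set up for every
  \<open>derivation\<close> \<open>(\<pi>, \<sigma>)\<close>, because one formula then serves as the
  operator \<open>D_II\<close> on iterated jets and as minus the exterior covariant derivative of a
  connection, and naturality in the target links the two. The summand with \<open>dw\<close> is
  forced: \<open>\<sigma>\<close> obeys a Leibniz rule, so \<open>w \<and> \<sigma> y\<close> alone
  is not balanced over \<open>A\<close>, and \<open>d(wa) = dw a - w da\<close> supplies the missing
  term. Still \<open>\<K>\<close> is not linear: \<open>\<K> (a t)\<close> differs from
  \<open>a \<K> t\<close> by \<open>da \<and> \<Omega>\<^sup>1(\<pi>) t\<close>. The first condition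
  on \<open>J\<^sup>n\<close> cancels this defect, so that the second one cuts out a submodule in
  its presence.

  Elements of tensor products and quotients are arbitrary representatives; identities are therefore
  mostly checked between additive maps on pure tensors, or between the two components of a 1-jet.

  That \<open>\<nabla> (j\<^sup>n\<^sup>-\<^sup>1 e)\<close> comes from a symmetric form is not
  derived from (1) and (2) directly. The connection is first written as that of some
  \<open>C\<close>; then \<open>x - C (\<pi> x)\<close> lies in the kernel of the jet projection,
  and exactness at order \<open>n\<close> delivers the form.\<close>

definition additive :: "('m, 'c) ring_scheme \<Rightarrow> ('n, 'd) ring_scheme \<Rightarrow> ('m \<Rightarrow> 'n) \<Rightarrow> bool" where
  "additive M N f \<longleftrightarrow> (\<forall>x \<in> carrier M. f x \<in> carrier N) \<and>
     (\<forall>x \<in> carrier M. \<forall>y \<in> carrier M. f (x \<oplus>\<^bsub>M\<^esub> y) = f x \<oplus>\<^bsub>N\<^esub> f y)"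

lemma additiveI:
  assumes "\<And>x. x \<in> carrier M \<Longrightarrow> f x \<in> carrier N"
    and "\<And>x y. x \<in> carrier M \<Longrightarrow> y \<in> carrier M \<Longrightarrow> f (x \<oplus>\<^bsub>M\<^esub> y) = f x \<oplus>\<^bsub>N\<^esub> f y"
  shows "additive M N f"
  using assms by (simp add: additive_def)

lemma additive_closed: "additive M N f \<Longrightarrow> x \<in> carrier M \<Longrightarrow> f x \<in> carrier N"
  by (simp add: additive_def)

lemma additive_add:
  "additive M N f \<Longrightarrow> x \<in> carrier M \<Longrightarrow> y \<in> carrier M \<Longrightarrow> f (x \<oplus>\<^bsub>M\<^esub> y) = f x \<oplus>\<^bsub>N\<^esub> f y"
  by (simp add: additive_def)

lemma additive_zero:
  assumes "abelian_group M" "abelian_group N" "additive M N f"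
  shows "f \<zero>\<^bsub>M\<^esub> = \<zero>\<^bsub>N\<^esub>"
proof -
  interpret M: abelian_group M by fact
  interpret N: abelian_group N by fact
  have c: "f \<zero>\<^bsub>M\<^esub> \<in> carrier N" using assms(3) by (simp add: additive_def)
  have "f \<zero>\<^bsub>M\<^esub> \<oplus>\<^bsub>N\<^esub> f \<zero>\<^bsub>M\<^esub> = f \<zero>\<^bsub>M\<^esub>"
    using additive_add[OF assms(3), of "\<zero>\<^bsub>M\<^esub>" "\<zero>\<^bsub>M\<^esub>"] by simp
  then show ?thesis using c by (metis N.add.r_cancel_one')
qed

lemma additive_inv:
  assumes "abelian_group M" "abelian_group N" "additive M N f" "x \<in> carrier M"
  shows "f (\<ominus>\<^bsub>M\<^esub> x) = \<ominus>\<^bsub>N\<^esub> f x"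
proof -
  interpret M: abelian_group M by fact
  interpret N: abelian_group N by fact
  have "f (\<ominus>\<^bsub>M\<^esub> x) \<oplus>\<^bsub>N\<^esub> f x = \<zero>\<^bsub>N\<^esub>"
    using additive_add[OF assms(3), of "\<ominus>\<^bsub>M\<^esub> x" x] additive_zero[OF assms(1-3)] assms(4)
    by (simp add: M.l_neg)
  then show ?thesis
    using assms by (simp add: N.minus_equality additive_closed)
qed

lemma additive_minus:
  assumes "abelian_group M" "abelian_group N" "additive M N f" "x \<in> carrier M" "y \<in> carrier M"
  shows "f (x \<ominus>\<^bsub>M\<^esub> y) = f x \<ominus>\<^bsub>N\<^esub> f y"
  using assms abelian_group.a_inv_closed[OF assms(1)]
  by (simp add: a_minus_def additive_add additive_inv)

lemma additive_comp:
  "additive M N f \<Longrightarrow> additive N P g \<Longrightarrow> additive M P (\<lambda>x. g (f x))"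
  by (simp add: additive_def)

lemma additive_sum:
  assumes "abelian_group N" "additive M N f" "additive M N g"
  shows "additive M N (\<lambda>x. f x \<oplus>\<^bsub>N\<^esub> g x)"
proof -
  interpret N: abelian_group N by fact
  show ?thesis using assms(2,3) by (auto simp: additive_def N.a_ac)
qed

lemma additive_uminus:
  assumes "abelian_group N" "additive M N f"
  shows "additive M N (\<lambda>x. \<ominus>\<^bsub>N\<^esub> f x)"
proof -
  interpret N: abelian_group N by fact
  show ?thesis using assms(2) by (auto simp: additive_def N.minus_add)
qed

lemma additive_diff:
  assumes "abelian_group N" "additive M N f" "additive M N g"
  shows "additive M N (\<lambda>x. f x \<ominus>\<^bsub>N\<^esub> g x)"
  unfolding a_minus_def by (intro additive_sum additive_uminus assms)

lemma list_sum_Nil [simp]: "list_sum M f [] = \<zero>\<^bsub>M\<^esub>"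
  by (simp add: list_sum_def)

lemma list_sum_Cons [simp]: "list_sum M f (x # xs) = f x \<oplus>\<^bsub>M\<^esub> list_sum M f xs"
  by (simp add: list_sum_def)

lemma list_sum_map: "list_sum M f (map g xs) = list_sum M (\<lambda>x. f (g x)) xs"
  by (induction xs) auto

lemma list_sum_cong: "(\<And>x. x \<in> set xs \<Longrightarrow> f x = g x) \<Longrightarrow> list_sum M f xs = list_sum M g xs"
  by (induction xs) auto

lemma list_sum_closed:
  assumes "abelian_group M" "\<And>x. x \<in> set xs \<Longrightarrow> f x \<in> carrier M"
  shows "list_sum M f xs \<in> carrier M"
proof -
  interpret abelian_group M by fact
  show ?thesis using assms(2) by (induction xs) auto
qed

lemma list_sum_append:
  assumes "abelian_group M" "\<And>x. x \<in> set xs \<union> set ys \<Longrightarrow> f x \<in> carrier M"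
  shows "list_sum M f (xs @ ys) = list_sum M f xs \<oplus>\<^bsub>M\<^esub> list_sum M f ys"
proof -
  interpret abelian_group M by fact
  show ?thesis using assms(2)
  proof (induction xs)
    case Nil
    then show ?case by (simp add: list_sum_closed[OF assms(1)])
  next
    case (Cons x xs)
    then show ?case by (simp add: list_sum_closed[OF assms(1)] a_assoc)
  qed
qed

lemma additive_list_sum:
  assumes "abelian_group M" "abelian_group N" "additive M N h"
    and "\<And>x. x \<in> set xs \<Longrightarrow> f x \<in> carrier M"
  shows "h (list_sum M f xs) = list_sum N (\<lambda>x. h (f x)) xs"
  using assms(4)
proof (induction xs)
  case Nil
  then show ?case by (simp add: additive_zero[OF assms(1-3)])
next
  case (Cons x xs)
  then show ?case
    by (simp add: list_sum_closed[OF assms(1)] additive_add[OF assms(3)])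
qed

lemma list_sum_add:
  assumes "abelian_group M" "\<And>x. x \<in> set xs \<Longrightarrow> f x \<in> carrier M"
    "\<And>x. x \<in> set xs \<Longrightarrow> g x \<in> carrier M"
  shows "list_sum M (\<lambda>x. f x \<oplus>\<^bsub>M\<^esub> g x) xs = list_sum M f xs \<oplus>\<^bsub>M\<^esub> list_sum M g xs"
proof -
  interpret abelian_group M by fact
  show ?thesis using assms(2,3)
    by (induction xs) (auto simp: list_sum_closed[OF assms(1)] a_ac)
qed

section \<open>Tensor products\<close>

text \<open>These are the maps for which \<open>lift\<close> is well defined. There is no clause for
  zero: \<open>f \<zero> m = \<zero>\<close> follows from additivity in the first argument.\<close>

definition balanced_map where
  "balanced_map X R ra la M P f \<longleftrightarrow>
     (\<forall>x \<in> carrier X. \<forall>m \<in> carrier M. f x m \<in> carrier P) \<and>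
     (\<forall>x \<in> carrier X. \<forall>y \<in> carrier X. \<forall>m \<in> carrier M. f (x \<oplus>\<^bsub>X\<^esub> y) m = f x m \<oplus>\<^bsub>P\<^esub> f y m) \<and>
     (\<forall>x \<in> carrier X. \<forall>m \<in> carrier M. \<forall>m' \<in> carrier M. f x (m \<oplus>\<^bsub>M\<^esub> m') = f x m \<oplus>\<^bsub>P\<^esub> f x m') \<and>
     (\<forall>x \<in> carrier X. \<forall>r \<in> R. \<forall>m \<in> carrier M. f (ra x r) m = f x (la r m))"

lemma balanced_mapI:
  assumes "\<And>x m. x \<in> carrier X \<Longrightarrow> m \<in> carrier M \<Longrightarrow> f x m \<in> carrier P"
    and "\<And>x y m. x \<in> carrier X \<Longrightarrow> y \<in> carrier X \<Longrightarrow> m \<in> carrier M \<Longrightarrow> f (x \<oplus>\<^bsub>X\<^esub> y) m = f x m \<oplus>\<^bsub>P\<^esub> f y m"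
    and "\<And>x m m'. x \<in> carrier X \<Longrightarrow> m \<in> carrier M \<Longrightarrow> m' \<in> carrier M \<Longrightarrow> f x (m \<oplus>\<^bsub>M\<^esub> m') = f x m \<oplus>\<^bsub>P\<^esub> f x m'"
    and "\<And>x r m. x \<in> carrier X \<Longrightarrow> r \<in> R \<Longrightarrow> m \<in> carrier M \<Longrightarrow> f (ra x r) m = f x (la r m)"
  shows "balanced_map X R ra la M P f"
  using assms by (simp add: balanced_map_def)

lemma lift_cong:
  assumes "\<And>x m. (x, m) \<in> set (terms t) \<Longrightarrow> f x m = g x m"
  shows "lift P f t = lift P g t"
  unfolding lift_def by (rule list_sum_cong) (use assms in auto)

text \<open>Pushes an additive map into the sum over the stored representative. Together with
  \<open>lift_cong\<close> this evaluates maps out of the quotient \<open>jet1 E\<close> too, where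
  the universal property of a tensor product is not at hand.\<close>

lemma additive_of_lift:
  assumes "abelian_group P" "abelian_group Q" "additive P Q h"
    and "\<And>x m. (x, m) \<in> set (terms t) \<Longrightarrow> f x m \<in> carrier P"
  shows "h (lift P f t) = lift Q (\<lambda>x m. h (f x m)) t"
  unfolding lift_def
  by (subst additive_list_sum[OF assms(1-3)]) (use assms(4) in \<open>auto simp: case_prod_unfold\<close>)

lemma lift_closed:
  assumes "abelian_group P" "\<And>x m. (x, m) \<in> set (terms t) \<Longrightarrow> f x m \<in> carrier P"
  shows "lift P f t \<in> carrier P"
  unfolding lift_def by (rule list_sum_closed[OF assms(1)]) (use assms(2) in auto)

lemma lift_add:
  assumes "abelian_group P" "\<And>x m. (x, m) \<in> set (terms t) \<Longrightarrow> f x m \<in> carrier P"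
    "\<And>x m. (x, m) \<in> set (terms t) \<Longrightarrow> g x m \<in> carrier P"
  shows "lift P (\<lambda>x m. f x m \<oplus>\<^bsub>P\<^esub> g x m) t = lift P f t \<oplus>\<^bsub>P\<^esub> lift P g t"
  unfolding lift_def using list_sum_add[OF assms(1), of "terms t" "\<lambda>(x, m). f x m" "\<lambda>(x, m). g x m"] assms(2,3)
  by (simp add: case_prod_unfold)

text \<open>Instantiated twice: with \<open>A\<close> as scalars for forms with values in a module,
  and with the ground ring for \<open>AE\<close>. Closure under the two actions is what makes
  well-formedness of lists an invariant of \<open>teq\<close>.\<close>

locale tensor_product = X: abelian_group X + M: abelian_group M
  for X :: "('w, 'b) ring_scheme" and M :: "(('w, 'e) elt, 'c) ring_scheme" +
  fixes R :: "'r set" and ra :: "'w \<Rightarrow> 'r \<Rightarrow> 'w" and la :: "'r \<Rightarrow> ('w, 'e) elt \<Rightarrow> ('w, 'e) elt"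
  assumes ra_closed: "x \<in> carrier X \<Longrightarrow> r \<in> R \<Longrightarrow> ra x r \<in> carrier X"
    and la_closed: "m \<in> carrier M \<Longrightarrow> r \<in> R \<Longrightarrow> la r m \<in> carrier M"
begin

abbreviation "teq \<equiv> tensor_eq X R ra la M"
abbreviation "cl \<equiv> tensor_class X R ra la M"
abbreviation "T \<equiv> tensor X R ra la M"
abbreviation "wfl xs \<equiv> set xs \<subseteq> carrier X \<times> carrier M"
abbreviation "tens x m \<equiv> cl [(x, m)]"

text \<open>The relation is defined on arbitrary lists, for instance by \<open>refl\<close> and
  \<open>comm\<close>. This invariant keeps every derivation that starts inside the carriers there,
  including the middle list of \<open>trans\<close>.\<close>

lemma teq_wf: "teq xs ys \<Longrightarrow> wfl xs \<longleftrightarrow> wfl ys"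
  by (induction rule: tensor_eq.induct) (auto simp: ra_closed la_closed)

lemma cl_rep:
  assumes "wfl xs"
  obtains ys where "cl xs = Tens ys" "wfl ys" "teq xs ys"
proof -
  have "wfl (SOME ys. wfl ys \<and> teq xs ys) \<and> teq xs (SOME ys. wfl ys \<and> teq xs ys)"
    by (rule someI[of _ xs]) (use assms tensor_eq.refl in auto)
  then show ?thesis using that by (auto simp: tensor_class_def)
qed

text \<open>Equivalent lists yield the same predicate under \<open>SOME\<close>, hence literally the
  same representative; this is how classes can be compared by HOL equality.\<close>

lemma cl_eqI: "teq xs ys \<Longrightarrow> cl xs = cl ys"
proof -
  assume a: "teq xs ys"
  then have "(\<lambda>zs. wfl zs \<and> teq xs zs) = (\<lambda>zs. wfl zs \<and> teq ys zs)"
    by (meson tensor_eq.sym tensor_eq.trans)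
  then show ?thesis by (simp add: tensor_class_def)
qed

lemma cl_eq_iff:
  assumes "wfl xs" "wfl ys"
  shows "cl xs = cl ys \<longleftrightarrow> teq xs ys"
proof
  assume a: "cl xs = cl ys"
  obtain xs' where x: "cl xs = Tens xs'" "teq xs xs'" by (rule cl_rep[OF assms(1)])
  obtain ys' where y: "cl ys = Tens ys'" "teq ys ys'" by (rule cl_rep[OF assms(2)])
  show "teq xs ys" using a x y by (metis elt.inject(2) tensor_eq.sym tensor_eq.trans)
qed (rule cl_eqI)

lemma terms_cl: "wfl xs \<Longrightarrow> wfl (terms (cl xs)) \<and> teq xs (terms (cl xs))"
  by (erule cl_rep) simp

lemma carrier_T: "carrier T = cl ` {xs. wfl xs}"
  by (simp add: tensor_def Let_def)

lemma zero_T: "\<zero>\<^bsub>T\<^esub> = cl []"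
  by (simp add: tensor_def Let_def)

lemma add_T: "s \<oplus>\<^bsub>T\<^esub> t = cl (terms s @ terms t)"
  by (simp add: tensor_def Let_def)

lemma smult_T: "a \<odot>\<^bsub>T\<^esub> t = cl (map (\<lambda>(x, m). (a \<otimes>\<^bsub>X\<^esub> x, m)) (terms t))"
  by (simp add: tensor_def Let_def)

lemma cl_closed: "wfl xs \<Longrightarrow> cl xs \<in> carrier T"
  by (auto simp: carrier_T)

lemma terms_wf: "t \<in> carrier T \<Longrightarrow> wfl (terms t)"
  using terms_cl by (auto simp: carrier_T)

lemma cl_terms: "t \<in> carrier T \<Longrightarrow> cl (terms t) = t"
  by (auto simp: carrier_T) (metis terms_cl cl_eqI)

lemma cl_append: "wfl xs \<Longrightarrow> wfl ys \<Longrightarrow> cl (xs @ ys) = cl xs \<oplus>\<^bsub>T\<^esub> cl ys"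
  unfolding add_T by (rule cl_eqI) (intro tensor_eq.append; simp add: terms_cl)

lemma teq_neg: "wfl xs \<Longrightarrow> teq (map (\<lambda>(x, m). (\<ominus>\<^bsub>X\<^esub> x, m)) xs @ xs) []"
proof (induction xs)
  case Nil
  show ?case by (simp add: tensor_eq.refl)
next
  case (Cons p xs)
  obtain x m where p: "p = (x, m)" by force
  have c: "x \<in> carrier X" "m \<in> carrier M" using Cons.prems p by auto
  let ?n = "map (\<lambda>(x, m). (\<ominus>\<^bsub>X\<^esub> x, m)) xs"
  have 1: "teq ([(\<ominus>\<^bsub>X\<^esub> x, m)] @ [(x, m)]) []"
    using tensor_eq.add_l[of "\<ominus>\<^bsub>X\<^esub> x" X x m M R ra la] tensor_eq.zero[of m M X R ra la] c
    by (auto simp: X.l_neg intro: tensor_eq.trans tensor_eq.sym)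
  \<comment> \<open>The new pair has to be moved next to its negative, past the negated tail; only
    then does the case of one entry apply.\<close>
  have "teq (?n @ [(x, m)]) ([(x, m)] @ ?n)" by (rule tensor_eq.comm)
  then have "teq ((?n @ [(x, m)]) @ xs) (([(x, m)] @ ?n) @ xs)"
    by (rule tensor_eq.append[OF _ tensor_eq.refl])
  then have 2: "teq ([(\<ominus>\<^bsub>X\<^esub> x, m)] @ ((?n @ [(x, m)]) @ xs)) ([(\<ominus>\<^bsub>X\<^esub> x, m)] @ (([(x, m)] @ ?n) @ xs))"
    by (rule tensor_eq.append[OF tensor_eq.refl])
  have "teq (([(\<ominus>\<^bsub>X\<^esub> x, m)] @ [(x, m)]) @ (?n @ xs)) ([] @ [])"
    using 1 Cons by (intro tensor_eq.append) auto
  with 2 show ?case by (auto simp: p intro: tensor_eq.trans)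
qed

lemma abelian_group_T: "abelian_group T"
proof (rule abelian_groupI)
  fix x y z assume xyz: "x \<in> carrier T" "y \<in> carrier T" "z \<in> carrier T"
  have w: "wfl (terms x)" "wfl (terms y)" "wfl (terms z)" using xyz by (simp_all add: terms_wf)
  have "x \<oplus>\<^bsub>T\<^esub> y \<oplus>\<^bsub>T\<^esub> z = cl ((terms x @ terms y) @ terms z)"
    using w xyz by (subst cl_append) (auto simp: cl_terms add_T)
  also have "\<dots> = cl (terms x @ (terms y @ terms z))" by simp
  also have "\<dots> = x \<oplus>\<^bsub>T\<^esub> (y \<oplus>\<^bsub>T\<^esub> z)"
    using w xyz by (subst cl_append) (auto simp: cl_terms add_T)
  finally show "x \<oplus>\<^bsub>T\<^esub> y \<oplus>\<^bsub>T\<^esub> z = x \<oplus>\<^bsub>T\<^esub> (y \<oplus>\<^bsub>T\<^esub> z)" .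
next
  fix x y assume xy: "x \<in> carrier T" "y \<in> carrier T"
  show "x \<oplus>\<^bsub>T\<^esub> y \<in> carrier T" using xy by (auto simp: add_T intro!: cl_closed dest!: terms_wf)
  show "x \<oplus>\<^bsub>T\<^esub> y = y \<oplus>\<^bsub>T\<^esub> x" by (auto simp: add_T intro!: cl_eqI tensor_eq.comm)
next
  fix x assume x: "x \<in> carrier T"
  show "\<zero>\<^bsub>T\<^esub> \<oplus>\<^bsub>T\<^esub> x = x" using x cl_append[of "[]" "terms x"] by (simp add: zero_T terms_wf cl_terms)
  let ?n = "map (\<lambda>(x, m). (\<ominus>\<^bsub>X\<^esub> x, m)) (terms x)"
  have n: "wfl ?n" using terms_wf[OF x] by auto
  have "cl ?n \<oplus>\<^bsub>T\<^esub> x = cl (?n @ terms x)"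
    using cl_append[OF n terms_wf[OF x]] by (simp add: cl_terms x)
  also have "\<dots> = \<zero>\<^bsub>T\<^esub>" unfolding zero_T by (rule cl_eqI) (rule teq_neg[OF terms_wf[OF x]])
  finally show "\<exists>y\<in>carrier T. y \<oplus>\<^bsub>T\<^esub> x = \<zero>\<^bsub>T\<^esub>" using cl_closed[OF n] by auto
next
  show "\<zero>\<^bsub>T\<^esub> \<in> carrier T" by (simp add: zero_T cl_closed)
qed

lemma cl_list_sum: "wfl xs \<Longrightarrow> cl xs = list_sum T (\<lambda>(x, m). tens x m) xs"
proof (induction xs)
  case Nil
  show ?case by (simp add: zero_T)
next
  case (Cons p xs)
  obtain x m where p: "p = (x, m)" by force
  show ?case using Cons cl_append[of "[(x, m)]" xs] by (simp add: p)
qed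

lemma tens_closed: "x \<in> carrier X \<Longrightarrow> m \<in> carrier M \<Longrightarrow> tens x m \<in> carrier T"
  by (simp add: cl_closed)

lemma tens_add_l:
  "x \<in> carrier X \<Longrightarrow> y \<in> carrier X \<Longrightarrow> m \<in> carrier M \<Longrightarrow> tens (x \<oplus>\<^bsub>X\<^esub> y) m = tens x m \<oplus>\<^bsub>T\<^esub> tens y m"
  using cl_append[of "[(x, m)]" "[(y, m)]"] cl_eqI[OF tensor_eq.add_l] by simp

lemma tens_add_r:
  "x \<in> carrier X \<Longrightarrow> m \<in> carrier M \<Longrightarrow> m' \<in> carrier M \<Longrightarrow> tens x (m \<oplus>\<^bsub>M\<^esub> m') = tens x m \<oplus>\<^bsub>T\<^esub> tens x m'"
  using cl_append[of "[(x, m)]" "[(x, m')]"] cl_eqI[OF tensor_eq.add_r] by simp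

lemma tens_balanced:
  "x \<in> carrier X \<Longrightarrow> r \<in> R \<Longrightarrow> m \<in> carrier M \<Longrightarrow> tens (ra x r) m = tens x (la r m)"
  by (rule cl_eqI[OF tensor_eq.balanced])

lemma tensor_induct [consumes 1, case_names zero tens add]:
  assumes "t \<in> carrier T" "Q \<zero>\<^bsub>T\<^esub>" "\<And>x m. x \<in> carrier X \<Longrightarrow> m \<in> carrier M \<Longrightarrow> Q (tens x m)"
    and add: "\<And>s t. s \<in> carrier T \<Longrightarrow> t \<in> carrier T \<Longrightarrow> Q s \<Longrightarrow> Q t \<Longrightarrow> Q (s \<oplus>\<^bsub>T\<^esub> t)"
  shows "Q t"
proof -
  have "Q (cl xs)" if "wfl xs" for xs
    using that
  proof (induction xs)
    case Nil
    show ?case using assms(2) by (simp add: zero_T)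
  next
    case (Cons p xs)
    obtain x m where p: "p = (x, m)" by force
    show ?case using Cons cl_append[of "[(x, m)]" xs] assms(3)[of x m] add[of "tens x m" "cl xs"]
      by (simp add: p cl_closed)
  qed
  then show ?thesis using assms(1) by (auto simp: carrier_T)
qed

lemma additive_ext:
  assumes "abelian_group P" "additive T P f" "additive T P g" "t \<in> carrier T"
    and "\<And>x m. x \<in> carrier X \<Longrightarrow> m \<in> carrier M \<Longrightarrow> f (tens x m) = g (tens x m)"
  shows "f t = g t"
  using assms(4)
proof (induction rule: tensor_induct)
  case zero
  show ?case using additive_zero[OF abelian_group_T assms(1,2)] additive_zero[OF abelian_group_T assms(1,3)]
    by simp
next
  case (tens x m)
  then show ?case by (rule assms(5))
next
  case (add s t)
  then show ?case using assms(2,3) by (simp add: additive_add)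
qed

lemma list_sum_teq:
  assumes P: "abelian_group P" and b: "balanced_map X R ra la M P f" and "teq xs ys" "wfl xs"
  shows "list_sum P (\<lambda>(x, m). f x m) xs = list_sum P (\<lambda>(x, m). f x m) ys"
  using assms(3,4)
proof (induction rule: tensor_eq.induct)
  interpret P: abelian_group P by fact
  have c: "f x m \<in> carrier P" if "x \<in> carrier X" "m \<in> carrier M" for x m
    using b that by (simp add: balanced_map_def)
  have c': "list_sum P (\<lambda>(x, m). f x m) xs \<in> carrier P" if "wfl xs" for xs
    by (rule list_sum_closed[OF P]) (use that c in auto)
  {
    case (sym xs ys)
    then show ?case using teq_wf by auto
  next
    case (trans xs ys zs)
    then show ?case using teq_wf by auto
  next
    case (append xs xs' ys ys')
    then have w: "wfl xs" "wfl ys" "wfl xs'" "wfl ys'" using teq_wf by auto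
    show ?case using append w
      by (subst (1 2) list_sum_append[OF P]) (auto intro: c)
  next
    case (comm xs ys)
    then have w: "wfl xs" "wfl ys" by auto
    show ?case using w c'[OF w(1)] c'[OF w(2)]
      by (subst (1 2) list_sum_append[OF P]) (auto intro: c P.a_comm)
  next
    case (zero m)
    \<comment> \<open>Additivity at \<open>\<zero> + \<zero>\<close> makes
      \<open>f \<zero> m\<close> idempotent, hence zero.\<close>
    have "f (\<zero>\<^bsub>X\<^esub> \<oplus>\<^bsub>X\<^esub> \<zero>\<^bsub>X\<^esub>) m = f \<zero>\<^bsub>X\<^esub> m \<oplus>\<^bsub>P\<^esub> f \<zero>\<^bsub>X\<^esub> m"
      using b zero by (auto simp: balanced_map_def simp del: X.r_zero X.l_zero)
    then have "f \<zero>\<^bsub>X\<^esub> m = \<zero>\<^bsub>P\<^esub>" using c[of "\<zero>\<^bsub>X\<^esub>" m] zero(1) by (simp add: P.add.r_cancel_one')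
    then show ?case using zero by simp
  next
    case (add_l x y m)
    then show ?case using b c by (simp add: balanced_map_def P.a_assoc)
  next
    case (add_r x m m')
    then show ?case using b c by (simp add: balanced_map_def P.a_assoc)
  next
    case (balanced x r m)
    then show ?case using b by (simp add: balanced_map_def)
  }
qed simp

lemma lift_cl:
  assumes "abelian_group P" "balanced_map X R ra la M P f" "wfl xs"
  shows "lift P f (cl xs) = list_sum P (\<lambda>(x, m). f x m) xs"
  unfolding lift_def using list_sum_teq[OF assms(1,2)] terms_cl[OF assms(3)] assms(3) by auto

lemma lift_tens:
  assumes "abelian_group P" "balanced_map X R ra la M P f" "x \<in> carrier X" "m \<in> carrier M"
  shows "lift P f (tens x m) = f x m"
proof -
  interpret P: abelian_group P by fact
  have "f x m \<in> carrier P" using assms by (simp add: balanced_map_def)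
  then show ?thesis using assms by (simp add: lift_cl)
qed

lemma additive_lift:
  assumes P: "abelian_group P" and b: "balanced_map X R ra la M P f"
  shows "additive T P (lift P f)"
proof (rule additiveI)
  have c: "f x m \<in> carrier P" if "x \<in> carrier X" "m \<in> carrier M" for x m
    using b that by (simp add: balanced_map_def)
  fix s assume s: "s \<in> carrier T"
  show "lift P f s \<in> carrier P" unfolding lift_def
    by (rule list_sum_closed[OF P]) (use terms_wf[OF s] c in auto)
  fix t assume t: "t \<in> carrier T"
  show "lift P f (s \<oplus>\<^bsub>T\<^esub> t) = lift P f s \<oplus>\<^bsub>P\<^esub> lift P f t"
    using terms_wf[OF s] terms_wf[OF t]
    by (subst add_T, subst lift_cl[OF P b]; (subst list_sum_append[OF P])?) (auto simp: lift_def c)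
qed

text \<open>The scalar action is defined through representatives. Written as a \<open>lift\<close>
  it falls under the universal property, from which additivity and the module laws follow.\<close>

lemma smult_T_lift:
  assumes "\<And>x. x \<in> carrier X \<Longrightarrow> a \<otimes>\<^bsub>X\<^esub> x \<in> carrier X" "t \<in> carrier T"
  shows "a \<odot>\<^bsub>T\<^esub> t = lift T (\<lambda>x m. tens (a \<otimes>\<^bsub>X\<^esub> x) m) t"
  unfolding smult_T lift_def using assms(1) terms_wf[OF assms(2)]
  by (subst cl_list_sum) (auto simp: list_sum_map case_prod_unfold)

end

text \<open>Right exactness. A section \<open>\<sigma>\<close> of \<open>f\<close> transports the derivation of a relation in \<open>X \<otimes> N\<close> to one
  in \<open>X \<otimes> M\<close>; each step holds there up to an element \<open>x \<otimes> k\<close> with \<open>k\<close> in the kernel of \<open>f\<close>.\<close>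

lemma tensor_kernel:
  fixes X :: "('w, 'b) ring_scheme" and M N :: "(('w, 'e) elt, 'c) ring_scheme"
  assumes TM: "tensor_product X M R ra la" and TN: "tensor_product X N R ra la'"
    and f: "additive M N f" and surj: "f ` carrier M = carrier N"
    and f_la: "\<And>r m. r \<in> R \<Longrightarrow> m \<in> carrier M \<Longrightarrow> f (la r m) = la' r (f m)"
    and H: "\<zero>\<^bsub>tensor X R ra la M\<^esub> \<in> H"
      "\<And>s t. s \<in> H \<Longrightarrow> t \<in> H \<Longrightarrow> s \<ominus>\<^bsub>tensor X R ra la M\<^esub> t \<in> H"
      "H \<subseteq> carrier (tensor X R ra la M)"
    and ker: "\<And>x k. x \<in> carrier X \<Longrightarrow> k \<in> carrier M \<Longrightarrow> f k = \<zero>\<^bsub>N\<^esub> \<Longrightarrow>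
      tensor_class X R ra la M [(x, k)] \<in> H"
    and xs: "set xs \<subseteq> carrier X \<times> carrier M"
    and eq: "tensor_eq X R ra la' N (map (\<lambda>(x, m). (x, f m)) xs) []"
  shows "tensor_class X R ra la M xs \<in> H"
proof -
  interpret TM: tensor_product X M R ra la by fact
  interpret TN: tensor_product X N R ra la' by fact
  interpret T: abelian_group TM.T by (rule TM.abelian_group_T)
  \<comment> \<open>A section of sets only, in general neither additive nor compatible with the
    scalars.\<close>
  define \<sigma> where "\<sigma> = inv_into (carrier M) f"
  have \<sigma>: "\<sigma> y \<in> carrier M" "f (\<sigma> y) = y" if "y \<in> carrier N" for y
    using that surj by (auto simp: \<sigma>_def inv_into_into f_inv_into_f)
  have H_uminus: "\<ominus>\<^bsub>TM.T\<^esub> t \<in> H" if "t \<in> H" for t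
    using H(1) H(2)[OF H(1) that] that H(3) by (auto simp: a_minus_def)
  have H_add: "s \<oplus>\<^bsub>TM.T\<^esub> t \<in> H" if "s \<in> H" "t \<in> H" for s t
    using H(2)[OF that(1) H_uminus[OF that(2)]] that H(3) by (auto simp: a_minus_def)
  \<comment> \<open>Two preimages of one element differ by an element of the kernel, so their
    tensors with \<open>x\<close> agree modulo \<open>H\<close>.\<close>
  have tens_diff: "TM.tens x m \<ominus>\<^bsub>TM.T\<^esub> TM.tens x m' \<in> H"
    if "x \<in> carrier X" "m \<in> carrier M" "m' \<in> carrier M" "f m = f m'" for x m m'
  proof -
    have k: "f (m \<ominus>\<^bsub>M\<^esub> m') = \<zero>\<^bsub>N\<^esub>"
      using additive_minus[OF TM.M.abelian_group_axioms TN.M.abelian_group_axioms f that(2,3)] that(3,4)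
        additive_closed[OF f that(3)] by (simp add: TN.M.r_neg a_minus_def)
    have "additive M TM.T (TM.tens x)"
      using that(1) by (intro additiveI TM.tens_closed TM.tens_add_r)
    then have "TM.tens x m \<ominus>\<^bsub>TM.T\<^esub> TM.tens x m' = TM.tens x (m \<ominus>\<^bsub>M\<^esub> m')"
      using additive_minus[OF TM.M.abelian_group_axioms TM.abelian_group_T _ that(2,3)] by metis
    then show ?thesis using ker[OF that(1) _ k] that by simp
  qed
  let ?s = "map (\<lambda>(x, y). (x, \<sigma> y))"
  have w: "TM.wfl (?s us)" if "TN.wfl us" for us using that \<sigma> by auto
  have c: "TM.cl (?s us) \<in> carrier TM.T" if "TN.wfl us" for us
    by (rule TM.cl_closed[OF w[OF that]])
  \<comment> \<open>The list map \<open>?s\<close> respects the relation of \<open>N\<close> modulo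
    \<open>H\<close>. It can fail to do so exactly in the cases \<open>add_r\<close> and
    \<open>balanced\<close>, where two preimages of one element appear and \<open>tens_diff\<close>
    compensates.\<close>
  have main: "TM.cl (?s us) \<ominus>\<^bsub>TM.T\<^esub> TM.cl (?s vs) \<in> H" if "TN.teq us vs" "TN.wfl us" for us vs
    using that
  proof (induction rule: tensor_eq.induct)
    case (refl us)
    then show ?case using H(1) c by (simp add: a_minus_def T.r_neg)
  next
    case (sym us vs)
    then have ww: "TN.wfl us" "TN.wfl vs" using TN.teq_wf by auto
    have "TM.cl (?s vs) \<ominus>\<^bsub>TM.T\<^esub> TM.cl (?s us) = \<ominus>\<^bsub>TM.T\<^esub> (TM.cl (?s us) \<ominus>\<^bsub>TM.T\<^esub> TM.cl (?s vs))"
      using c[OF ww(1)] c[OF ww(2)] by (simp add: a_minus_def T.minus_add T.a_comm)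
    then show ?case using H_uminus sym.IH[OF ww(1)] by simp
  next
    case (trans us vs zs)
    then have ww: "TN.wfl us" "TN.wfl vs" "TN.wfl zs" using TN.teq_wf by auto
    have "TM.cl (?s us) \<ominus>\<^bsub>TM.T\<^esub> TM.cl (?s zs) =
      (TM.cl (?s us) \<ominus>\<^bsub>TM.T\<^esub> TM.cl (?s vs)) \<oplus>\<^bsub>TM.T\<^esub> (TM.cl (?s vs) \<ominus>\<^bsub>TM.T\<^esub> TM.cl (?s zs))"
      using c[OF ww(1)] c[OF ww(2)] c[OF ww(3)]
      by (simp add: a_minus_def T.a_assoc T.r_neg1)
    then show ?case using H_add trans.IH(1)[OF ww(1)] trans.IH(2)[OF ww(2)] by simp
  next
    case (append us us' vs vs')
    then have ww: "TN.wfl us" "TN.wfl vs" "TN.wfl us'" "TN.wfl vs'" using TN.teq_wf by auto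
    have "TM.cl (?s (us @ vs)) \<ominus>\<^bsub>TM.T\<^esub> TM.cl (?s (us' @ vs')) =
      (TM.cl (?s us) \<ominus>\<^bsub>TM.T\<^esub> TM.cl (?s us')) \<oplus>\<^bsub>TM.T\<^esub> (TM.cl (?s vs) \<ominus>\<^bsub>TM.T\<^esub> TM.cl (?s vs'))"
      using c[OF ww(1)] c[OF ww(2)] c[OF ww(3)] c[OF ww(4)] TM.cl_append[OF w[OF ww(1)] w[OF ww(2)]]
        TM.cl_append[OF w[OF ww(3)] w[OF ww(4)]]
      by (simp add: a_minus_def T.minus_add T.a_ac)
    then show ?case using H_add append.IH(1)[OF ww(1)] append.IH(2)[OF ww(2)] by simp
  next
    case (comm us vs)
    have "TM.cl (?s (us @ vs)) = TM.cl (?s (vs @ us))"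
      by (simp, rule TM.cl_eqI, rule tensor_eq.comm)
    then show ?case using H(1) c[of "vs @ us"] comm by (simp add: a_minus_def T.r_neg)
  next
    case (zero m)
    have "TM.cl [(\<zero>\<^bsub>X\<^esub>, \<sigma> m)] = TM.cl []"
      using \<sigma>[OF zero(1)] by (intro TM.cl_eqI tensor_eq.zero)
    then show ?case using H(1) by (simp add: TM.zero_T a_minus_def T.r_neg flip: TM.zero_T)
  next
    case (add_l x y m)
    have "TM.cl [(x \<oplus>\<^bsub>X\<^esub> y, \<sigma> m)] = TM.cl [(x, \<sigma> m), (y, \<sigma> m)]"
      using add_l \<sigma> by (intro TM.cl_eqI tensor_eq.add_l) auto
    then show ?case using H(1) c[of "[(x, m), (y, m)]"] add_l by (simp add: a_minus_def T.r_neg)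
  next
    case (add_r x m m')
    have s: "\<sigma> m \<in> carrier M" "\<sigma> m' \<in> carrier M" "\<sigma> (m \<oplus>\<^bsub>N\<^esub> m') \<in> carrier M" using \<sigma> add_r by auto
    have "TM.cl [(x, \<sigma> m), (x, \<sigma> m')] = TM.tens x (\<sigma> m \<oplus>\<^bsub>M\<^esub> \<sigma> m')"
      using TM.cl_append[of "[(x, \<sigma> m)]" "[(x, \<sigma> m')]"] s add_r(1) by (simp add: TM.tens_add_r)
    moreover have "TM.tens x (\<sigma> (m \<oplus>\<^bsub>N\<^esub> m')) \<ominus>\<^bsub>TM.T\<^esub> TM.tens x (\<sigma> m \<oplus>\<^bsub>M\<^esub> \<sigma> m') \<in> H"
      using s add_r \<sigma> additive_add[OF f] by (intro tens_diff) auto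
    ultimately show ?case by simp
  next
    case (balanced x r m)
    have s: "\<sigma> m \<in> carrier M" "\<sigma> (la' r m) \<in> carrier M" "f (\<sigma> (la' r m)) = la' r m" "f (\<sigma> m) = m"
      using \<sigma> balanced TN.la_closed by auto
    have "TM.tens (ra x r) (\<sigma> m) = TM.tens x (la r (\<sigma> m))"
      using TM.tens_balanced balanced s by simp
    moreover have "TM.tens x (la r (\<sigma> m)) \<ominus>\<^bsub>TM.T\<^esub> TM.tens x (\<sigma> (la' r m)) \<in> H"
      using s balanced f_la TM.la_closed by (intro tens_diff) auto
    ultimately show ?case by simp
  qed
  \<comment> \<open>Here \<open>xs\<close> is compared with its image under \<open>f\<close>
    followed by \<open>\<sigma>\<close>; entrywise \<open>m\<close> and
    \<open>\<sigma> (f m)\<close> are two preimages of \<open>f m\<close>.\<close>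
  have "TM.cl xs \<ominus>\<^bsub>TM.T\<^esub> TM.cl (?s (map (\<lambda>(x, m). (x, f m)) xs)) \<in> H"
    using xs
  proof (induction xs)
    case Nil
    then show ?case using H(1) by (simp add: TM.zero_T a_minus_def T.r_neg flip: TM.zero_T)
  next
    case (Cons p xs)
    obtain x m where p: "p = (x, m)" by force
    have xm: "x \<in> carrier X" "m \<in> carrier M" "f m \<in> carrier N" "TM.wfl xs"
      using Cons.prems p additive_closed[OF f] by auto
    let ?u = "?s (map (\<lambda>(x, m). (x, f m)) xs)"
    have u: "TM.wfl ?u" using xm(4) additive_closed[OF f] by (intro w) auto
    have s: "\<sigma> (f m) \<in> carrier M" "f (\<sigma> (f m)) = f m" using \<sigma> xm by auto
    have 1: "TM.tens x m \<ominus>\<^bsub>TM.T\<^esub> TM.tens x (\<sigma> (f m)) \<in> H" using xm s by (intro tens_diff) auto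
    have "TM.cl (p # xs) \<ominus>\<^bsub>TM.T\<^esub> TM.cl ((x, \<sigma> (f m)) # ?u) =
      (TM.tens x m \<ominus>\<^bsub>TM.T\<^esub> TM.tens x (\<sigma> (f m))) \<oplus>\<^bsub>TM.T\<^esub> (TM.cl xs \<ominus>\<^bsub>TM.T\<^esub> TM.cl ?u)"
      using TM.cl_append[of "[(x, m)]" xs] TM.cl_append[of "[(x, \<sigma> (f m))]" ?u] xm s u
        TM.cl_closed[OF xm(4)] TM.cl_closed[OF u] TM.tens_closed[OF xm(1,2)] TM.tens_closed[OF xm(1) s(1)]
      by (simp add: p a_minus_def T.minus_add T.a_ac)
    then show ?case using H_add[OF 1 Cons.IH[OF xm(4)]] by (simp add: p)
  qed
  moreover have "TM.cl (?s (map (\<lambda>(x, m). (x, f m)) xs)) \<in> H"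
  proof -
    have wf: "TN.wfl (map (\<lambda>(x, m). (x, f m)) xs)" using xs additive_closed[OF f] by auto
    \<comment> \<open>The case of \<open>main\<close> whose right-hand list is empty:
      \<open>?s\<close> leaves it empty, and its class is zero.\<close>
    have "TM.cl (?s (map (\<lambda>(x, m). (x, f m)) xs)) \<ominus>\<^bsub>TM.T\<^esub> \<zero>\<^bsub>TM.T\<^esub> \<in> H"
      using main[OF eq wf] by (simp add: TM.zero_T)
    moreover have "\<ominus>\<^bsub>TM.T\<^esub> \<zero>\<^bsub>TM.T\<^esub> = \<zero>\<^bsub>TM.T\<^esub>"
      by (rule T.minus_equality) simp_all
    ultimately show ?thesis using c[OF wf] by (simp add: a_minus_def)
  qed
  ultimately have "(TM.cl xs \<ominus>\<^bsub>TM.T\<^esub> TM.cl (?s (map (\<lambda>(x, m). (x, f m)) xs))) \<oplus>\<^bsub>TM.T\<^esub>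
      TM.cl (?s (map (\<lambda>(x, m). (x, f m)) xs)) \<in> H" by (rule H_add)
  moreover have "TM.cl (?s (map (\<lambda>(x, m). (x, f m)) xs)) \<in> carrier TM.T"
    using xs additive_closed[OF f] by (intro c) auto
  ultimately show ?thesis using TM.cl_closed[OF xs] by (simp add: a_minus_def T.a_assoc T.l_neg)
qed

section \<open>Forms with values in a module\<close>

text \<open>Degree one is written \<open>1\<close> in \<open>Om \<Omega> 1\<close> and
  \<open>grade \<Omega> 1\<close>; the simplifier must not turn it into
  \<open>Suc 0\<close>.\<close>

declare One_nat_def [simp del]

text \<open>The notion of \<open>linear_maps\<close> without extensionality, so that compositions
  given by lambda terms qualify without \<open>restrict\<close>. The link is
  \<open>linear_maps_iff\<close>.\<close>

definition linear_map ::
  "('a, 'b) ring_scheme \<Rightarrow> ('a, 'm, 'c) module_scheme \<Rightarrow> ('a, 'n, 'd) module_scheme \<Rightarrow> ('m \<Rightarrow> 'n) \<Rightarrow> bool" where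
  "linear_map A M N f \<longleftrightarrow> additive M N f \<and>
     (\<forall>a \<in> carrier A. \<forall>x \<in> carrier M. f (a \<odot>\<^bsub>M\<^esub> x) = a \<odot>\<^bsub>N\<^esub> f x)"

lemma linear_map_additive: "linear_map A M N f \<Longrightarrow> additive M N f"
  by (simp add: linear_map_def)

lemma linear_map_closed: "linear_map A M N f \<Longrightarrow> x \<in> carrier M \<Longrightarrow> f x \<in> carrier N"
  by (simp add: linear_map_def additive_def)

lemma linear_map_smult:
  "linear_map A M N f \<Longrightarrow> a \<in> carrier A \<Longrightarrow> x \<in> carrier M \<Longrightarrow> f (a \<odot>\<^bsub>M\<^esub> x) = a \<odot>\<^bsub>N\<^esub> f x"
  by (simp add: linear_map_def)

lemma linear_map_comp:
  "linear_map A M N f \<Longrightarrow> linear_map A N P g \<Longrightarrow> linear_map A M P (\<lambda>x. g (f x))"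
  unfolding linear_map_def using additive_comp[of M N f P g] by (auto simp: additive_def)

lemma linear_maps_iff: "f \<in> linear_maps A M N \<longleftrightarrow> linear_map A M N f \<and> f \<in> extensional (carrier M)"
  by (auto simp: linear_maps_def linear_map_def additive_def PiE_iff)

lemma linear_map_restrict:
  assumes "left_module A M"
  shows "linear_map A M N (restrict f (carrier M)) \<longleftrightarrow> linear_map A M N f"
proof -
  interpret left_module A M by fact
  show ?thesis by (auto simp: linear_map_def additive_def smult_closed)
qed

lemma left_module_group: "left_module A M \<Longrightarrow> abelian_group M"
  by (simp add: left_module_def)

lemma additive_smult:
  assumes "left_module A M" "a \<in> carrier A"
  shows "additive M M (\<lambda>x. a \<odot>\<^bsub>M\<^esub> x)"
proof -
  interpret left_module A M by fact
  show ?thesis using assms(2) by (intro additiveI smult_closed smult_r_distr)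
qed

lemma left_moduleI:
  assumes "ring A" "abelian_group M"
    "\<And>a x. \<lbrakk>a \<in> carrier A; x \<in> carrier M\<rbrakk> \<Longrightarrow> a \<odot>\<^bsub>M\<^esub> x \<in> carrier M"
    "\<And>a b x. \<lbrakk>a \<in> carrier A; b \<in> carrier A; x \<in> carrier M\<rbrakk> \<Longrightarrow>
      (a \<oplus>\<^bsub>A\<^esub> b) \<odot>\<^bsub>M\<^esub> x = a \<odot>\<^bsub>M\<^esub> x \<oplus>\<^bsub>M\<^esub> b \<odot>\<^bsub>M\<^esub> x"
    "\<And>a x y. \<lbrakk>a \<in> carrier A; x \<in> carrier M; y \<in> carrier M\<rbrakk> \<Longrightarrow>
      a \<odot>\<^bsub>M\<^esub> (x \<oplus>\<^bsub>M\<^esub> y) = a \<odot>\<^bsub>M\<^esub> x \<oplus>\<^bsub>M\<^esub> a \<odot>\<^bsub>M\<^esub> y"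
    "\<And>a b x. \<lbrakk>a \<in> carrier A; b \<in> carrier A; x \<in> carrier M\<rbrakk> \<Longrightarrow>
      (a \<otimes>\<^bsub>A\<^esub> b) \<odot>\<^bsub>M\<^esub> x = a \<odot>\<^bsub>M\<^esub> (b \<odot>\<^bsub>M\<^esub> x)"
    "\<And>x. x \<in> carrier M \<Longrightarrow> \<one>\<^bsub>A\<^esub> \<odot>\<^bsub>M\<^esub> x = x"
  shows "left_module A M"
  by (intro left_module.intro left_module_axioms.intro assms)

text \<open>Negatives are obtained by acting with \<open>-1\<close>. Applied to holonomic jets, to
  symmetric forms and to the image of a linear map.\<close>

lemma left_module_submodule:
  fixes M :: "('a, 'm) module"
  assumes "left_module A M" "S \<subseteq> carrier M" "\<zero>\<^bsub>M\<^esub> \<in> S"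
    and "\<And>x y. x \<in> S \<Longrightarrow> y \<in> S \<Longrightarrow> x \<oplus>\<^bsub>M\<^esub> y \<in> S"
    and smult: "\<And>a x. a \<in> carrier A \<Longrightarrow> x \<in> S \<Longrightarrow> a \<odot>\<^bsub>M\<^esub> x \<in> S"
  shows "left_module A (M\<lparr>carrier := S\<rparr>)"
proof -
  interpret left_module A M by fact
  have neg: "\<exists>y \<in> S. y \<oplus>\<^bsub>M\<^esub> x = \<zero>\<^bsub>M\<^esub>" if x: "x \<in> S" for x
  proof
    have xM: "x \<in> carrier M" using x assms(2) by auto
    show "(\<ominus>\<^bsub>A\<^esub> \<one>\<^bsub>A\<^esub>) \<odot>\<^bsub>M\<^esub> x \<in> S" using smult x by simp
    have "(\<ominus>\<^bsub>A\<^esub> \<one>\<^bsub>A\<^esub>) \<odot>\<^bsub>M\<^esub> x \<oplus>\<^bsub>M\<^esub> x = (\<ominus>\<^bsub>A\<^esub> \<one>\<^bsub>A\<^esub> \<oplus>\<^bsub>A\<^esub> \<one>\<^bsub>A\<^esub>) \<odot>\<^bsub>M\<^esub> x"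
      using xM smult_l_distr[of "\<ominus>\<^bsub>A\<^esub> \<one>\<^bsub>A\<^esub>" "\<one>\<^bsub>A\<^esub>" x] smult_one[OF xM] by simp
    also have "\<dots> = \<zero>\<^bsub>M\<^esub>"
    proof -
      have "additive A M (\<lambda>a. a \<odot>\<^bsub>M\<^esub> x)"
        using xM by (intro additiveI smult_closed smult_l_distr)
      from additive_zero[OF R.abelian_group_axioms M.abelian_group_axioms this]
      show ?thesis by (simp add: R.l_neg)
    qed
    finally show "(\<ominus>\<^bsub>A\<^esub> \<one>\<^bsub>A\<^esub>) \<odot>\<^bsub>M\<^esub> x \<oplus>\<^bsub>M\<^esub> x = \<zero>\<^bsub>M\<^esub>" .
  qed
  have sub: "x \<in> S \<Longrightarrow> x \<in> carrier M" for x using assms(2) by auto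
  show ?thesis
    by (intro left_moduleI abelian_groupI)
      (use neg in \<open>auto simp: sub assms(3-) smult_l_distr smult_r_distr smult_assoc smult_one M.a_ac R.ring_axioms\<close>)
qed

context exterior_algebra
begin

sublocale dga: ring \<Omega> by (rule is_ring)

abbreviation lmod :: "('w, 'e) emodule \<Rightarrow> bool" where
  "lmod M \<equiv> left_module (coeffs \<Omega>) M"

abbreviation "gr \<equiv> grade \<Omega>"
abbreviation lin :: "('w, 'e) emodule \<Rightarrow> ('w, 'e) emodule \<Rightarrow> (('w, 'e) elt \<Rightarrow> ('w, 'e) elt) \<Rightarrow> bool"
  where "lin \<equiv> linear_map (coeffs \<Omega>)"
abbreviation Om1 :: "('w, 'e) emodule \<Rightarrow> ('w, 'e) emodule" where "Om1 \<equiv> Om \<Omega> 1"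
abbreviation Om2 :: "('w, 'e) emodule \<Rightarrow> ('w, 'e) emodule" where "Om2 \<equiv> Om \<Omega> 2"
abbreviation om1 :: "('w, 'e) emodule \<Rightarrow> _" where "om1 \<equiv> om \<Omega> 1"
abbreviation om2 :: "('w, 'e) emodule \<Rightarrow> _" where "om2 \<equiv> om \<Omega> 2"
abbreviation Om1_map :: "('w, 'e) emodule \<Rightarrow> _" where "Om1_map \<equiv> Om_map \<Omega> 1"
abbreviation Om2_map :: "('w, 'e) emodule \<Rightarrow> _" where "Om2_map \<equiv> Om_map \<Omega> 2"
abbreviation wedge1 :: "('w, 'e) emodule \<Rightarrow> _" where "wedge1 \<equiv> wedge \<Omega> 1 1"
abbreviation jet1 :: "('w, 'e) emodule \<Rightarrow> ('w, 'e) emodule" where "jet1 \<equiv> J1 \<Omega>"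
abbreviation jets :: "nat \<Rightarrow> ('w, 'e) emodule \<Rightarrow> ('w, 'e) emodule" where "jets \<equiv> Jet \<Omega>"
abbreviation syms :: "nat \<Rightarrow> ('w, 'e) emodule \<Rightarrow> ('w, 'e) emodule" where "syms \<equiv> Sym \<Omega>"
abbreviation "der \<equiv> diff \<Omega>"

text \<open>Collected mainly to be switched off in \<open>simp\<close> calls: unfolding the
  recursions replaces \<open>jets (Suc (Suc n)) E\<close> by an updated record to which the module
  lemmas no longer apply.\<close>

lemmas jet_rec_simps = Jet.simps Sym.simps iota.simps prol.simps

section \<open>Homogeneous elements and the Leibniz rule in degrees 0 and 1\<close>

lemma forms_simps [simp]:
  "carrier (forms \<Omega> k) = gr k" "\<zero>\<^bsub>forms \<Omega> k\<^esub> = \<zero>\<^bsub>\<Omega>\<^esub>" "\<one>\<^bsub>forms \<Omega> k\<^esub> = \<one>\<^bsub>\<Omega>\<^esub>"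
  "x \<oplus>\<^bsub>forms \<Omega> k\<^esub> y = x \<oplus>\<^bsub>\<Omega>\<^esub> y" "x \<otimes>\<^bsub>forms \<Omega> k\<^esub> y = x \<otimes>\<^bsub>\<Omega>\<^esub> y"
  by (simp_all add: forms_def)

lemma grade_carrier: "x \<in> gr k \<Longrightarrow> x \<in> carrier \<Omega>"
  using subgroup.mem_carrier[OF submodule.axioms(1)[OF grade_submodule[of k]]] by simp

lemma grade_add: "x \<in> gr k \<Longrightarrow> y \<in> gr k \<Longrightarrow> x \<oplus> y \<in> gr k"
  using subgroup.m_closed[OF submodule.axioms(1)[OF grade_submodule[of k]]] by simp

lemma grade_zero: "\<zero> \<in> gr k"
  using subgroup.one_closed[OF submodule.axioms(1)[OF grade_submodule[of k]]] by simp

lemma grade_uminus: "x \<in> gr k \<Longrightarrow> \<ominus> x \<in> gr k"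
  using subgroup.m_inv_closed[OF submodule.axioms(1)[OF grade_submodule[of k]]] by (simp add: a_inv_def)

lemma grade_smult: "c \<in> carrier (scalars \<Omega>) \<Longrightarrow> x \<in> gr k \<Longrightarrow> c \<odot> x \<in> gr k"
  using submodule.smult_closed[OF grade_submodule[of k]] by simp

lemma mult_grade_0_l: "a \<in> gr 0 \<Longrightarrow> x \<in> gr k \<Longrightarrow> a \<otimes> x \<in> gr k"
  using mult_grade[of a 0 x k] by simp

lemma mult_grade_0_r: "x \<in> gr k \<Longrightarrow> a \<in> gr 0 \<Longrightarrow> x \<otimes> a \<in> gr k"
  using mult_grade[of x k a 0] by simp

lemma diff_grade_0: "a \<in> gr 0 \<Longrightarrow> der a \<in> gr 1"
  using diff_grade[of a 0] by (simp add: One_nat_def)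

lemma diff_grade_1: "a \<in> gr 1 \<Longrightarrow> der a \<in> gr 2"
  using diff_grade[of a 1] by (simp add: numeral_2_eq_2 One_nat_def)

lemma mult_grade_1_1: "x \<in> gr 1 \<Longrightarrow> y \<in> gr 1 \<Longrightarrow> x \<otimes> y \<in> gr 2"
  using mult_grade[of x 1 y 1] by simp

lemmas grade_intros = grade_add grade_zero grade_uminus mult_grade_0_l mult_grade_0_r diff_grade_0
  diff_grade_1 mult_grade_1_1 one_grade

lemma leibniz_0:
  assumes "a \<in> gr 0" "y \<in> carrier \<Omega>"
  shows "der (a \<otimes> y) = der a \<otimes> y \<oplus> a \<otimes> der y"
  using leibniz[OF assms] assms grade_carrier diff_closed by simp

lemma leibniz_1:
  assumes "x \<in> gr 1" "y \<in> carrier \<Omega>"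
  shows "der (x \<otimes> y) = der x \<otimes> y \<ominus> x \<otimes> der y"
  using leibniz[OF assms] assms grade_carrier[of x 1] diff_closed
  by (simp add: a_minus_def dga.l_minus numeral_nat One_nat_def)

lemma forms_group: "abelian_group (forms \<Omega> k)"
proof (rule abelian_groupI)
  fix x assume x: "x \<in> carrier (forms \<Omega> k)"
  then show "\<exists>y\<in>carrier (forms \<Omega> k). y \<oplus>\<^bsub>forms \<Omega> k\<^esub> x = \<zero>\<^bsub>forms \<Omega> k\<^esub>"
    by (intro bexI[of _ "\<ominus> x"]) (auto simp: grade_uminus dga.l_neg grade_carrier)
qed (auto simp: grade_add grade_zero grade_carrier dga.a_ac)

lemma ring_coeffs: "ring (coeffs \<Omega>)"
  by (rule ringI[OF forms_group monoidI])
    (auto simp: grade_intros dga.m_assoc dga.l_distr dga.r_distr grade_carrier[of _ 0])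

section \<open>Forms with values in a module, as a left module over the coefficients\<close>

lemma Om_tensor:
  assumes "lmod M"
  shows "tensor_product (forms \<Omega> k) M (carrier (coeffs \<Omega>)) (mult \<Omega>) (smult M)"
proof -
  interpret left_module "coeffs \<Omega>" M by fact
  show ?thesis
    by (intro tensor_product.intro tensor_product_axioms.intro forms_group M.abelian_group_axioms)
      (auto simp: mult_grade_0_r smult_closed)
qed

lemma Om_group: "lmod M \<Longrightarrow> abelian_group (Om \<Omega> k M)"
  unfolding Om_def by (rule tensor_product.abelian_group_T[OF Om_tensor])

lemma om_closed:
  "lmod M \<Longrightarrow> w \<in> gr k \<Longrightarrow> m \<in> carrier M \<Longrightarrow> om \<Omega> k M w m \<in> carrier (Om \<Omega> k M)"
  unfolding Om_def om_def by (rule tensor_product.tens_closed[OF Om_tensor]) simp_all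

lemma om_add_l:
  "lmod M \<Longrightarrow> w \<in> gr k \<Longrightarrow> v \<in> gr k \<Longrightarrow> m \<in> carrier M \<Longrightarrow>
    om \<Omega> k M (w \<oplus> v) m = om \<Omega> k M w m \<oplus>\<^bsub>Om \<Omega> k M\<^esub> om \<Omega> k M v m"
  unfolding Om_def om_def using tensor_product.tens_add_l[OF Om_tensor, of M w k v m] by simp

lemma om_add_r:
  "lmod M \<Longrightarrow> w \<in> gr k \<Longrightarrow> m \<in> carrier M \<Longrightarrow> m' \<in> carrier M \<Longrightarrow>
    om \<Omega> k M w (m \<oplus>\<^bsub>M\<^esub> m') = om \<Omega> k M w m \<oplus>\<^bsub>Om \<Omega> k M\<^esub> om \<Omega> k M w m'"
  unfolding Om_def om_def using tensor_product.tens_add_r[OF Om_tensor, of M w k m m'] by simp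

lemma om_balanced:
  "lmod M \<Longrightarrow> w \<in> gr k \<Longrightarrow> a \<in> gr 0 \<Longrightarrow> m \<in> carrier M \<Longrightarrow>
    om \<Omega> k M (w \<otimes> a) m = om \<Omega> k M w (a \<odot>\<^bsub>M\<^esub> m)"
  unfolding om_def using tensor_product.tens_balanced[OF Om_tensor, of M w k a m] by simp

abbreviation Om_balanced_map where
  "Om_balanced_map k M P f \<equiv> balanced_map (forms \<Omega> k) (carrier (coeffs \<Omega>)) (mult \<Omega>) (smult M) M P f"

lemma Om_balanced_mapI:
  assumes "\<And>x m. x \<in> gr k \<Longrightarrow> m \<in> carrier M \<Longrightarrow> f x m \<in> carrier P"
    and "\<And>x y m. x \<in> gr k \<Longrightarrow> y \<in> gr k \<Longrightarrow> m \<in> carrier M \<Longrightarrow> f (x \<oplus> y) m = f x m \<oplus>\<^bsub>P\<^esub> f y m"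
    and "\<And>x m m'. x \<in> gr k \<Longrightarrow> m \<in> carrier M \<Longrightarrow> m' \<in> carrier M \<Longrightarrow> f x (m \<oplus>\<^bsub>M\<^esub> m') = f x m \<oplus>\<^bsub>P\<^esub> f x m'"
    and "\<And>x r m. x \<in> gr k \<Longrightarrow> r \<in> gr 0 \<Longrightarrow> m \<in> carrier M \<Longrightarrow> f (x \<otimes> r) m = f x (r \<odot>\<^bsub>M\<^esub> m)"
  shows "Om_balanced_map k M P f"
  by (rule balanced_mapI) (use assms in auto)

lemma Om_terms:
  "lmod M \<Longrightarrow> t \<in> carrier (Om \<Omega> k M) \<Longrightarrow> (w, m) \<in> set (terms t) \<Longrightarrow> w \<in> gr k \<and> m \<in> carrier M"
  unfolding Om_def using tensor_product.terms_wf[OF Om_tensor, of M t k] by auto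

lemma Om_lift_additive:
  "lmod M \<Longrightarrow> abelian_group P \<Longrightarrow> Om_balanced_map k M P f \<Longrightarrow> additive (Om \<Omega> k M) P (lift P f)"
  unfolding Om_def by (rule tensor_product.additive_lift[OF Om_tensor])

lemma Om_lift_om:
  "lmod M \<Longrightarrow> abelian_group P \<Longrightarrow> Om_balanced_map k M P f \<Longrightarrow> w \<in> gr k \<Longrightarrow> m \<in> carrier M \<Longrightarrow>
    lift P f (om \<Omega> k M w m) = f w m"
  unfolding om_def by (rule tensor_product.lift_tens[OF Om_tensor]) simp_all

lemma Om_ext:
  assumes "lmod M" "abelian_group P" "additive (Om \<Omega> k M) P f" "additive (Om \<Omega> k M) P g"
    "\<And>w m. w \<in> gr k \<Longrightarrow> m \<in> carrier M \<Longrightarrow> f (om \<Omega> k M w m) = g (om \<Omega> k M w m)"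
    "t \<in> carrier (Om \<Omega> k M)"
  shows "f t = g t"
  using tensor_product.additive_ext[OF Om_tensor[OF assms(1)], of P k f g t] assms
  by (simp add: Om_def om_def)

lemma Om_induct [consumes 2, case_names zero om add]:
  assumes "lmod M" "t \<in> carrier (Om \<Omega> k M)" "Q \<zero>\<^bsub>Om \<Omega> k M\<^esub>"
    "\<And>w m. w \<in> gr k \<Longrightarrow> m \<in> carrier M \<Longrightarrow> Q (om \<Omega> k M w m)"
    "\<And>s t. s \<in> carrier (Om \<Omega> k M) \<Longrightarrow> t \<in> carrier (Om \<Omega> k M) \<Longrightarrow> Q s \<Longrightarrow> Q t \<Longrightarrow> Q (s \<oplus>\<^bsub>Om \<Omega> k M\<^esub> t)"
  shows "Q t"
  using tensor_product.tensor_induct[OF Om_tensor[OF assms(1)], of t k Q] assms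
  by (simp add: Om_def om_def)

lemma additive_om_l:
  "lmod M \<Longrightarrow> m \<in> carrier M \<Longrightarrow> additive (forms \<Omega> k) (Om \<Omega> k M) (\<lambda>w. om \<Omega> k M w m)"
  by (rule additiveI) (simp_all add: om_closed om_add_l)

lemma additive_om_r:
  "lmod M \<Longrightarrow> w \<in> gr k \<Longrightarrow> additive M (Om \<Omega> k M) (\<lambda>m. om \<Omega> k M w m)"
  by (rule additiveI) (simp_all add: om_closed om_add_r)

lemma om_zero_l: "lmod M \<Longrightarrow> m \<in> carrier M \<Longrightarrow> om \<Omega> k M \<zero> m = \<zero>\<^bsub>Om \<Omega> k M\<^esub>"
  using additive_zero[OF forms_group Om_group additive_om_l] by simp

lemma om_zero_r: "lmod M \<Longrightarrow> w \<in> gr k \<Longrightarrow> om \<Omega> k M w \<zero>\<^bsub>M\<^esub> = \<zero>\<^bsub>Om \<Omega> k M\<^esub>"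
  by (rule additive_zero[OF left_module_group Om_group additive_om_r])

lemma smult_om_balanced:
  assumes M: "lmod M" and a: "a \<in> gr 0"
  shows "Om_balanced_map k M (Om \<Omega> k M) (\<lambda>x m. om \<Omega> k M (a \<otimes> x) m)"
  using a by (intro Om_balanced_mapI)
    (auto simp: om_closed[OF M] om_add_l[OF M] om_add_r[OF M] om_balanced[OF M] grade_intros
      dga.r_distr grade_carrier simp flip: dga.m_assoc)

lemma smult_Om_lift:
  assumes "lmod M" "a \<in> gr 0" "t \<in> carrier (Om \<Omega> k M)"
  shows "a \<odot>\<^bsub>Om \<Omega> k M\<^esub> t = lift (Om \<Omega> k M) (\<lambda>x m. om \<Omega> k M (a \<otimes> x) m) t"
  using tensor_product.smult_T_lift[OF Om_tensor[OF assms(1)], of k a t] assms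
  by (simp add: Om_def om_def mult_grade_0_l)

lemma smult_om:
  assumes "lmod M" "a \<in> gr 0" "w \<in> gr k" "m \<in> carrier M"
  shows "a \<odot>\<^bsub>Om \<Omega> k M\<^esub> om \<Omega> k M w m = om \<Omega> k M (a \<otimes> w) m"
  using assms by (simp add: smult_Om_lift om_closed Om_lift_om[OF assms(1) _ smult_om_balanced] Om_group)

lemma additive_smult_Om:
  assumes "lmod M" "a \<in> gr 0"
  shows "additive (Om \<Omega> k M) (Om \<Omega> k M) (\<lambda>t. a \<odot>\<^bsub>Om \<Omega> k M\<^esub> t)"
  using Om_lift_additive[OF assms(1) Om_group[OF assms(1)] smult_om_balanced[OF assms], of k]
    smult_Om_lift[OF assms] abelian_groupE(1)[OF Om_group[OF assms(1), of k]]
  by (simp add: additive_def)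

lemma Om_module:
  assumes M: "lmod M"
  shows "lmod (Om \<Omega> k M)"
proof -
  note G = Om_group[OF M, of k]
  note s = additive_smult_Om[OF M, where k = k]
  show ?thesis
  proof (rule left_moduleI[OF ring_coeffs G]; (unfold forms_simps)?)
    fix a b t
    assume a: "a \<in> gr 0" and b: "b \<in> gr 0" and t: "t \<in> carrier (Om \<Omega> k M)"
    note ab = grade_carrier[OF a] grade_carrier[OF b]
    show "(a \<oplus> b) \<odot>\<^bsub>Om \<Omega> k M\<^esub> t = a \<odot>\<^bsub>Om \<Omega> k M\<^esub> t \<oplus>\<^bsub>Om \<Omega> k M\<^esub> b \<odot>\<^bsub>Om \<Omega> k M\<^esub> t"
      by (rule Om_ext[OF M G s additive_sum[OF G s s] _ t])
        (use a b in \<open>auto simp: grade_intros smult_om[OF M] om_add_l[OF M] dga.l_distr grade_carrier\<close>)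
    show "(a \<otimes> b) \<odot>\<^bsub>Om \<Omega> k M\<^esub> t = a \<odot>\<^bsub>Om \<Omega> k M\<^esub> (b \<odot>\<^bsub>Om \<Omega> k M\<^esub> t)"
      by (rule Om_ext[OF M G s additive_comp[OF s s] _ t])
        (use a b in \<open>auto simp: grade_intros smult_om[OF M] dga.m_assoc grade_carrier\<close>)
  next
    fix t assume t: "t \<in> carrier (Om \<Omega> k M)"
    show "\<one> \<odot>\<^bsub>Om \<Omega> k M\<^esub> t = t"
      by (rule Om_ext[OF M G s _ _ t])
        (auto simp: additive_def one_grade smult_om[OF M] grade_carrier abelian_groupE(1)[OF G])
  qed (use s in \<open>auto simp: additive_def\<close>)
qed

lemma om_minus_l:
  assumes "lmod M" "m \<in> carrier M" "w \<in> gr k" "v \<in> gr k"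
  shows "om \<Omega> k M (w \<ominus> v) m = om \<Omega> k M w m \<ominus>\<^bsub>Om \<Omega> k M\<^esub> om \<Omega> k M v m"
proof -
  interpret F: abelian_group "forms \<Omega> k" by (rule forms_group)
  \<comment> \<open>The inverse in a record is described through its carrier, so the negative in
    \<open>forms \<Omega> k\<close> has to be identified with the one in
    \<open>\<Omega>\<close>.\<close>
  have "\<ominus>\<^bsub>forms \<Omega> k\<^esub> v = \<ominus> v"
    using assms(4) by (intro F.minus_equality) (auto simp: grade_uminus grade_carrier dga.l_neg)
  moreover have "om \<Omega> k M (w \<ominus>\<^bsub>forms \<Omega> k\<^esub> v) m = om \<Omega> k M w m \<ominus>\<^bsub>Om \<Omega> k M\<^esub> om \<Omega> k M v m"
    using assms by (intro additive_minus[OF forms_group Om_group additive_om_l]) simp_all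
  ultimately show ?thesis by (simp add: a_minus_def)
qed

text \<open>In degree one the words provided by \<open>generated\<close> have a list
  \<open>bs\<close> of length one and reduce to \<open>a \<otimes> der b\<close>.\<close>

lemma grade_1_induct [consumes 1, case_names zero gen add]:
  assumes w: "w \<in> gr 1" and zero: "Q \<zero>"
    and gen: "\<And>a b. a \<in> gr 0 \<Longrightarrow> b \<in> gr 0 \<Longrightarrow> Q (a \<otimes> der b)"
    and add: "\<And>v w. v \<in> gr 1 \<Longrightarrow> w \<in> gr 1 \<Longrightarrow> Q v \<Longrightarrow> Q w \<Longrightarrow> Q (v \<oplus> w)"
  shows "Q w"
proof -
  let ?f = "\<lambda>(a, bs). a \<otimes> foldr (\<lambda>b w. der b \<otimes> w) bs \<one>"
  obtain ts where ts: "\<forall>(a, bs) \<in> set ts. a \<in> gr 0 \<and> set bs \<subseteq> gr 0 \<and> length bs = 1"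
    and w_eq: "w = list_sum \<Omega> ?f ts"
    using generated[OF w] by auto
  have "list_sum \<Omega> ?f ts \<in> gr 1 \<and> Q (list_sum \<Omega> ?f ts)"
    using ts
  proof (induction ts)
    case Nil
    then show ?case by (simp add: zero grade_zero)
  next
    case (Cons p ts)
    obtain a bs where p: "p = (a, bs)" by force
    have "length bs = 1" "a \<in> gr 0" "set bs \<subseteq> gr 0" using Cons.prems p by auto
    then obtain b where b: "bs = [b]" "b \<in> gr 0" "a \<in> gr 0"
      by (cases bs) auto
    have "?f p = a \<otimes> der b" using b by (simp add: p grade_carrier diff_closed)
    moreover have "a \<otimes> der b \<in> gr 1" using b by (simp add: grade_intros)
    ultimately show ?case using Cons gen[OF b(3,2)] by (simp add: add grade_add)
  qed
  then show ?thesis by (simp add: w_eq)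
qed

text \<open>The form of induction behind the uniqueness of \<open>iota1\<close> and the surjectivity
  in \<open>ex_jet1\<close>, both of which are governed by the generators
  \<open>a db \<otimes> m\<close>.\<close>

lemma Om1_induct [consumes 2, case_names zero gen add]:
  assumes M: "lmod M" and t: "t \<in> carrier (Om1 M)" and zero: "Q \<zero>\<^bsub>Om1 M\<^esub>"
    and gen: "\<And>a b m. a \<in> gr 0 \<Longrightarrow> b \<in> gr 0 \<Longrightarrow> m \<in> carrier M \<Longrightarrow>
      Q (om1 M (a \<otimes> der b) m)"
    and add: "\<And>s t. s \<in> carrier (Om1 M) \<Longrightarrow> t \<in> carrier (Om1 M) \<Longrightarrow> Q s \<Longrightarrow> Q t \<Longrightarrow>
      Q (s \<oplus>\<^bsub>Om1 M\<^esub> t)"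
  shows "Q t"
  using M t
proof (induction rule: Om_induct)
  case (om w m)
  from om(1) show ?case
    by (induction rule: grade_1_induct)
      (use om(2) in \<open>auto simp: om_zero_l[OF M] om_add_l[OF M] zero gen intro!: add om_closed[OF M]\<close>)
qed (use zero add in auto)

lemma Om1_ext:
  assumes M: "lmod M" and P: "abelian_group P"
    and f: "additive (Om1 M) P f" and g: "additive (Om1 M) P g"
    and eq: "\<And>a b m. a \<in> gr 0 \<Longrightarrow> b \<in> gr 0 \<Longrightarrow> m \<in> carrier M \<Longrightarrow>
      f (om1 M (a \<otimes> der b) m) = g (om1 M (a \<otimes> der b) m)"
    and t: "t \<in> carrier (Om1 M)"
  shows "f t = g t"
  using M t
  by (induction rule: Om1_induct)
    (simp_all add: eq additive_add[OF f] additive_add[OF g]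
      additive_zero[OF Om_group[OF M] P f] additive_zero[OF Om_group[OF M] P g])


subsection \<open>Functoriality\<close>

lemma Om_map_balanced:
  assumes M: "lmod M" and N: "lmod N" and f: "lin M N f"
  shows "Om_balanced_map k M (Om \<Omega> k N) (\<lambda>w m. om \<Omega> k N w (f m))"
  by (rule Om_balanced_mapI)
    (auto simp: om_closed[OF N] om_add_l[OF N] om_add_r[OF N] om_balanced[OF N] linear_map_closed[OF f]
      additive_add[OF linear_map_additive[OF f]] linear_map_smult[OF f])

lemma Om_map_om:
  assumes "lmod M" "lmod N" "lin M N f" "w \<in> gr k" "m \<in> carrier M"
  shows "Om_map \<Omega> k N f (om \<Omega> k M w m) = om \<Omega> k N w (f m)"
  unfolding Om_map_def by (rule Om_lift_om[OF assms(1) Om_group[OF assms(2)] Om_map_balanced[OF assms(1-3)] assms(4,5)])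

lemma Om_map_additive:
  assumes "lmod M" "lmod N" "lin M N f"
  shows "additive (Om \<Omega> k M) (Om \<Omega> k N) (Om_map \<Omega> k N f)"
  unfolding Om_map_def by (rule Om_lift_additive[OF assms(1) Om_group[OF assms(2)] Om_map_balanced[OF assms]])

lemma Om_map_linear:
  assumes M: "lmod M" and N: "lmod N" and f: "lin M N f"
  shows "lin (Om \<Omega> k M) (Om \<Omega> k N) (Om_map \<Omega> k N f)"
  unfolding linear_map_def
proof (intro conjI ballI)
  note F = Om_map_additive[OF assms, of k]
  show "additive (Om \<Omega> k M) (Om \<Omega> k N) (Om_map \<Omega> k N f)" by (rule F)
  fix a t assume a: "a \<in> carrier (coeffs \<Omega>)" and t: "t \<in> carrier (Om \<Omega> k M)"
  then have a: "a \<in> gr 0" by simp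
  show "Om_map \<Omega> k N f (a \<odot>\<^bsub>Om \<Omega> k M\<^esub> t) = a \<odot>\<^bsub>Om \<Omega> k N\<^esub> Om_map \<Omega> k N f t"
    by (rule Om_ext[OF M Om_group[OF N] additive_comp[OF additive_smult_Om[OF M a] F]
          additive_comp[OF F additive_smult_Om[OF N a]] _ t])
      (simp add: smult_om[OF M] smult_om[OF N] a Om_map_om[OF assms] grade_intros linear_map_closed[OF f])
qed

lemma Om_map_cong:
  assumes "lmod M" "t \<in> carrier (Om \<Omega> k M)" "\<And>m. m \<in> carrier M \<Longrightarrow> f m = g m"
  shows "Om_map \<Omega> k N f t = Om_map \<Omega> k N g t"
  unfolding Om_map_def by (rule lift_cong) (use Om_terms[OF assms(1,2)] assms(3) in auto)

lemma Om_map_comp: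
  assumes "lmod M" "lmod N" "lmod P" "lin M N f" "lin N P g"
    "t \<in> carrier (Om \<Omega> k M)"
  shows "Om_map \<Omega> k P g (Om_map \<Omega> k N f t) = Om_map \<Omega> k P (\<lambda>x. g (f x)) t"
  by (rule Om_ext[OF assms(1) Om_group[OF assms(3)] additive_comp[OF Om_map_additive[OF assms(1,2,4)]
        Om_map_additive[OF assms(2,3,5)]] Om_map_additive[OF assms(1,3) linear_map_comp[OF assms(4,5)]] _ assms(6)])
    (simp add: Om_map_om[OF assms(1,2,4)] Om_map_om[OF assms(2,3,5)]
      Om_map_om[OF assms(1,3) linear_map_comp[OF assms(4,5)]] linear_map_closed[OF assms(4)])

lemma Om_map_id:
  assumes "lmod M" "t \<in> carrier (Om \<Omega> k M)" "\<And>m. m \<in> carrier M \<Longrightarrow> f m = m"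
  shows "Om_map \<Omega> k M f t = t"
proof -
  interpret left_module "coeffs \<Omega>" M by fact
  have f: "lin M M f"
    using assms(3) by (auto simp: linear_map_def additive_def simp del: forms_simps intro: smult_closed)
  show ?thesis
    by (rule Om_ext[OF assms(1) Om_group[OF assms(1)] Om_map_additive[OF assms(1,1) f] _ _ assms(2)])
      (auto simp: Om_map_om[OF assms(1,1) f] assms(3) additive_def abelian_groupE(1)[OF Om_group[OF assms(1)]])
qed

lemma Om_map_zero:
  assumes M: "lmod M" and N: "lmod N" and t: "t \<in> carrier (Om \<Omega> k M)" and f: "\<And>m. m \<in> carrier M \<Longrightarrow> f m = \<zero>\<^bsub>N\<^esub>"
  shows "Om_map \<Omega> k N f t = \<zero>\<^bsub>Om \<Omega> k N\<^esub>"
proof -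
  interpret abelian_group "Om \<Omega> k N" by (rule Om_group[OF N])
  have "lift (Om \<Omega> k N) (\<lambda>w m. om \<Omega> k N w (f m)) t = lift (Om \<Omega> k N) (\<lambda>w m. \<zero>\<^bsub>Om \<Omega> k N\<^esub>) t"
    by (rule lift_cong) (use Om_terms[OF M t] f om_zero_r[OF N] in auto)
  moreover have "list_sum (Om \<Omega> k N) (\<lambda>(w, m). \<zero>\<^bsub>Om \<Omega> k N\<^esub>) ts = \<zero>\<^bsub>Om \<Omega> k N\<^esub>" for ts :: "('w \<times> ('w, 'e) elt) list"
    by (induction ts) auto
  ultimately show ?thesis by (simp add: Om_map_def lift_def)
qed

section \<open>Wedge product with a fixed form\<close>

lemma wedge_balanced:
  assumes M: "lmod M" and w: "w \<in> gr k"
  shows "Om_balanced_map l M (Om \<Omega> (k + l) M) (\<lambda>v m. om \<Omega> (k + l) M (w \<otimes> v) m)"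
  by (rule Om_balanced_mapI)
    (use w in \<open>auto simp: om_closed[OF M] om_add_l[OF M] om_add_r[OF M] mult_grade dga.r_distr grade_carrier
      om_balanced[OF M, symmetric] dga.m_assoc\<close>)

lemma wedge_om:
  assumes "lmod M" "w \<in> gr k" "v \<in> gr l" "m \<in> carrier M"
  shows "wedge \<Omega> k l M w (om \<Omega> l M v m) = om \<Omega> (k + l) M (w \<otimes> v) m"
  unfolding wedge_def by (rule Om_lift_om[OF assms(1) Om_group[OF assms(1)] wedge_balanced[OF assms(1,2)] assms(3,4)])

lemma wedge_additive:
  assumes "lmod M" "w \<in> gr k"
  shows "additive (Om \<Omega> l M) (Om \<Omega> (k + l) M) (wedge \<Omega> k l M w)"
  unfolding wedge_def by (rule Om_lift_additive[OF assms(1) Om_group[OF assms(1)] wedge_balanced[OF assms]])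

lemmas wedge_closed = additive_closed[OF wedge_additive]
lemmas wedge_add_r = additive_add[OF wedge_additive]

lemma wedge_add_l:
  assumes M: "lmod M" and w: "w \<in> gr k" "w' \<in> gr k" and t: "t \<in> carrier (Om \<Omega> l M)"
  shows "wedge \<Omega> k l M (w \<oplus> w') t = wedge \<Omega> k l M w t \<oplus>\<^bsub>Om \<Omega> (k + l) M\<^esub> wedge \<Omega> k l M w' t"
  by (rule Om_ext[OF M Om_group[OF M] wedge_additive[OF M grade_add[OF w]]
        additive_sum[OF Om_group[OF M] wedge_additive[OF M w(1)] wedge_additive[OF M w(2)]] _ t])
    (use w in \<open>simp add: wedge_om[OF M] grade_add mult_grade om_add_l[OF M] dga.l_distr grade_carrier\<close>)

lemma wedge_smult_r:
  assumes M: "lmod M" and w: "w \<in> gr k" and a: "a \<in> gr 0" and t: "t \<in> carrier (Om \<Omega> l M)"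
  shows "wedge \<Omega> k l M w (a \<odot>\<^bsub>Om \<Omega> l M\<^esub> t) = wedge \<Omega> k l M (w \<otimes> a) t"
  by (rule Om_ext[OF M Om_group[OF M] additive_comp[OF additive_smult_Om[OF M a] wedge_additive[OF M w]]
        wedge_additive[OF M mult_grade_0_r[OF w a]] _ t])
    (use w a in \<open>simp add: smult_om[OF M] wedge_om[OF M] grade_intros dga.m_assoc grade_carrier\<close>)

lemma wedge_smult_l:
  assumes M: "lmod M" and w: "w \<in> gr k" and a: "a \<in> gr 0" and t: "t \<in> carrier (Om \<Omega> l M)"
  shows "wedge \<Omega> k l M (a \<otimes> w) t = a \<odot>\<^bsub>Om \<Omega> (k + l) M\<^esub> wedge \<Omega> k l M w t"
  by (rule Om_ext[OF M Om_group[OF M] wedge_additive[OF M mult_grade_0_l[OF a w]]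
        additive_comp[OF wedge_additive[OF M w] additive_smult_Om[OF M a]] _ t])
    (use w a in \<open>simp add: smult_om[OF M] wedge_om[OF M] grade_intros mult_grade dga.m_assoc grade_carrier\<close>)

lemma Om_map_wedge:
  assumes M: "lmod M" and N: "lmod N" and f: "lin M N f"
    and w: "w \<in> gr k" and t: "t \<in> carrier (Om \<Omega> l M)"
  shows "Om_map \<Omega> (k + l) N f (wedge \<Omega> k l M w t) = wedge \<Omega> k l N w (Om_map \<Omega> l N f t)"
  by (rule Om_ext[OF M Om_group[OF N] additive_comp[OF wedge_additive[OF M w] Om_map_additive[OF M N f]]
        additive_comp[OF Om_map_additive[OF M N f] wedge_additive[OF N w]] _ t])
    (use w in \<open>simp add: wedge_om[OF M] wedge_om[OF N] Om_map_om[OF M N f] mult_grade linear_map_closed[OF f]\<close>)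


section \<open>1-jets\<close>

text \<open>The map \<open>[a \<otimes> e] \<mapsto> da \<otimes> e\<close>. Together with \<open>\<pi>\<^sup>1\<^sup>,\<^sup>0\<close> it identifies \<open>J\<^sup>1 E\<close> with \<open>E \<times> \<Omega>\<^sup>1 E\<close>, where \<open>A\<close>
  acts by \<open>a (e, w) = (a e, da \<otimes> e + a w)\<close>.\<close>

definition jet1_form :: "('w, 'e) emodule \<Rightarrow> ('w, 'e) elt \<Rightarrow> ('w, 'e) elt" where
  "jet1_form E = lift (Om1 E) (\<lambda>a e. om1 E (der a) e)"

lemma diff_one: "der \<one> = \<zero>"
proof -
  have "der \<one> \<oplus> der \<one> = der \<one>"
    using leibniz_0[OF one_grade, of \<one>] diff_closed[of \<one>] by simp
  then show ?thesis using diff_closed[of \<one>] by (metis dga.add.r_cancel_one' dga.one_closed)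
qed

lemma smult_one_grade: "c \<in> carrier (scalars \<Omega>) \<Longrightarrow> c \<odot> \<one> \<in> gr 0"
  by (simp add: grade_smult one_grade)

lemma smult_eq_mult_one:
  "c \<in> carrier (scalars \<Omega>) \<Longrightarrow> x \<in> carrier \<Omega> \<Longrightarrow> c \<odot> x = x \<otimes> (c \<odot> \<one>)"
  by (simp add: smult_mult_r)

text \<open>Scalars of the ground ring are constants for \<open>der\<close>. Hence a Leibniz rule
  over \<open>A\<close> already contains linearity over the ground ring, which is used for
  connections and for prolongations.\<close>

lemma diff_smult_one: "c \<in> carrier (scalars \<Omega>) \<Longrightarrow> der (c \<odot> \<one>) = \<zero>"
  using diff_smult[of c \<one>] smult_eq_mult_one[of c \<zero>] smult_one_grade[of c] by (simp add: diff_one grade_carrier)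

text \<open>Since \<open>forms_simps\<close> rewrites the carrier and the operations of
  \<open>coeffs \<Omega>\<close>, the module axioms are restated here in the shape that goals have
  after simplification.\<close>

lemma lmod_smult: "lmod M \<Longrightarrow> a \<in> gr 0 \<Longrightarrow> m \<in> carrier M \<Longrightarrow> a \<odot>\<^bsub>M\<^esub> m \<in> carrier M"
  using left_module.smult_closed[of "coeffs \<Omega>" M] by simp

lemma lmod_smult_l_distr:
  "lmod M \<Longrightarrow> a \<in> gr 0 \<Longrightarrow> b \<in> gr 0 \<Longrightarrow> m \<in> carrier M \<Longrightarrow>
    (a \<oplus> b) \<odot>\<^bsub>M\<^esub> m = a \<odot>\<^bsub>M\<^esub> m \<oplus>\<^bsub>M\<^esub> b \<odot>\<^bsub>M\<^esub> m"
  using left_module.smult_l_distr[of "coeffs \<Omega>" M] by simp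

lemma lmod_smult_r_distr:
  "lmod M \<Longrightarrow> a \<in> gr 0 \<Longrightarrow> m \<in> carrier M \<Longrightarrow> m' \<in> carrier M \<Longrightarrow>
    a \<odot>\<^bsub>M\<^esub> (m \<oplus>\<^bsub>M\<^esub> m') = a \<odot>\<^bsub>M\<^esub> m \<oplus>\<^bsub>M\<^esub> a \<odot>\<^bsub>M\<^esub> m'"
  using left_module.smult_r_distr[of "coeffs \<Omega>" M] by simp

lemma lmod_smult_assoc:
  "lmod M \<Longrightarrow> a \<in> gr 0 \<Longrightarrow> b \<in> gr 0 \<Longrightarrow> m \<in> carrier M \<Longrightarrow>
    (a \<otimes> b) \<odot>\<^bsub>M\<^esub> m = a \<odot>\<^bsub>M\<^esub> (b \<odot>\<^bsub>M\<^esub> m)"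
  using left_module.smult_assoc[of "coeffs \<Omega>" M] by simp

lemma lmod_smult_one: "lmod M \<Longrightarrow> m \<in> carrier M \<Longrightarrow> \<one> \<odot>\<^bsub>M\<^esub> m = m"
  using left_module.smult_one[of "coeffs \<Omega>" M] by simp

lemma lmod_add_closed: "lmod M \<Longrightarrow> x \<in> carrier M \<Longrightarrow> y \<in> carrier M \<Longrightarrow> x \<oplus>\<^bsub>M\<^esub> y \<in> carrier M"
  by (rule abelian_groupE(1)[OF left_module_group])

lemma lmod_zero_closed: "lmod M \<Longrightarrow> \<zero>\<^bsub>M\<^esub> \<in> carrier M"
  by (rule abelian_groupE(2)[OF left_module_group])

lemmas lmod_intros = lmod_smult lmod_add_closed lmod_zero_closed

section \<open>The tensor product of the coefficients with a module over the ground ring\<close>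

lemma AE_tensor:
  assumes "lmod E"
  shows "tensor_product (coeffs \<Omega>) E (carrier (scalars \<Omega>)) (\<lambda>a c. c \<odot> a) (scal \<Omega> E)"
  by (intro tensor_product.intro tensor_product_axioms.intro forms_group left_module_group[OF assms])
    (simp_all add: grade_smult scal_def lmod_smult[OF assms] one_grade)

lemma AE_group: "lmod E \<Longrightarrow> abelian_group (AE \<Omega> E)"
  unfolding AE_def by (rule tensor_product.abelian_group_T[OF AE_tensor])

lemma proj1_balanced:
  assumes "lmod E"
  shows "balanced_map (coeffs \<Omega>) (carrier (scalars \<Omega>)) (\<lambda>a c. c \<odot> a) (scal \<Omega> E) E E (\<lambda>a e. a \<odot>\<^bsub>E\<^esub> e)"
  by (rule balanced_mapI)
    (auto simp: lmod_smult[OF assms] lmod_smult_l_distr[OF assms] lmod_smult_r_distr[OF assms]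
      lmod_smult_assoc[OF assms, symmetric] scal_def smult_one_grade smult_mult_r grade_carrier)

text \<open>Works because \<open>der\<close> commutes with the ground ring: a scalar
  \<open>c\<close> passes through \<open>der (c \<odot> a)\<close> and is then moved across the
  tensor product over \<open>A\<close>.\<close>

lemma jet1_form_balanced:
  assumes "lmod E"
  shows "balanced_map (coeffs \<Omega>) (carrier (scalars \<Omega>)) (\<lambda>a c. c \<odot> a) (scal \<Omega> E) E (Om1 E)
    (\<lambda>a e. om1 E (der a) e)"
  by (rule balanced_mapI)
    (auto simp: om_closed[OF assms] om_add_l[OF assms] om_add_r[OF assms] om_balanced[OF assms, symmetric]
      scal_def smult_one_grade smult_mult_r grade_carrier grade_intros diff_add diff_smult diff_closed)

lemma proj1_additive_AE: "lmod E \<Longrightarrow> additive (AE \<Omega> E) E (proj1 E)"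
  unfolding AE_def proj1_def
  by (rule tensor_product.additive_lift[OF AE_tensor left_module_group proj1_balanced])

lemma jet1_form_additive_AE: "lmod E \<Longrightarrow> additive (AE \<Omega> E) (Om1 E) (jet1_form E)"
  unfolding AE_def jet1_form_def
  by (rule tensor_product.additive_lift[OF AE_tensor Om_group jet1_form_balanced])

lemma ae_closed:
  "lmod E \<Longrightarrow> a \<in> gr 0 \<Longrightarrow> e \<in> carrier E \<Longrightarrow> ae \<Omega> E [(a, e)] \<in> carrier (AE \<Omega> E)"
  unfolding AE_def ae_def by (rule tensor_product.tens_closed[OF AE_tensor]) simp_all

lemma proj1_ae:
  "lmod E \<Longrightarrow> set xs \<subseteq> gr 0 \<times> carrier E \<Longrightarrow> proj1 E (ae \<Omega> E xs) = list_sum E (\<lambda>(a, e). a \<odot>\<^bsub>E\<^esub> e) xs"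
  unfolding ae_def proj1_def
  by (rule tensor_product.lift_cl[OF AE_tensor left_module_group proj1_balanced]) simp_all

lemma jet1_form_ae:
  "lmod E \<Longrightarrow> set xs \<subseteq> gr 0 \<times> carrier E \<Longrightarrow>
    jet1_form E (ae \<Omega> E xs) = list_sum (Om1 E) (\<lambda>(a, e). om1 E (der a) e) xs"
  unfolding ae_def jet1_form_def
  by (rule tensor_product.lift_cl[OF AE_tensor Om_group jet1_form_balanced]) simp_all

lemma proj1_ae_single:
  assumes "lmod E" "a \<in> gr 0" "e \<in> carrier E"
  shows "proj1 E (ae \<Omega> E [(a, e)]) = a \<odot>\<^bsub>E\<^esub> e"
proof -
  interpret abelian_group E by (rule left_module_group[OF assms(1)])
  show ?thesis using assms by (simp add: proj1_ae lmod_smult)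
qed

lemma jet1_form_ae_single:
  assumes "lmod E" "a \<in> gr 0" "e \<in> carrier E"
  shows "jet1_form E (ae \<Omega> E [(a, e)]) = om1 E (der a) e"
proof -
  interpret abelian_group "Om1 E" by (rule Om_group[OF assms(1)])
  show ?thesis using assms by (simp add: jet1_form_ae om_closed diff_grade_0)
qed

lemma AE_terms:
  "lmod E \<Longrightarrow> t \<in> carrier (AE \<Omega> E) \<Longrightarrow> (a, e) \<in> set (terms t) \<Longrightarrow> a \<in> gr 0 \<and> e \<in> carrier E"
  unfolding AE_def using tensor_product.terms_wf[OF AE_tensor, of E t] by auto

text \<open>The two conditions on a formal sum are the vanishing of \<open>proj1\<close> and of
  \<open>jet1_form\<close>. The quotient is thus by their joint kernel, which makes the two maps
  jointly injective on it.\<close>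

lemma jet1_relations_eq:
  assumes "lmod E"
  shows "jet1_relations \<Omega> E =
    {x \<in> carrier (AE \<Omega> E). proj1 E x = \<zero>\<^bsub>E\<^esub> \<and> jet1_form E x = \<zero>\<^bsub>Om1 E\<^esub>}"
proof -
  have "carrier (AE \<Omega> E) = ae \<Omega> E ` {xs. set xs \<subseteq> gr 0 \<times> carrier E}"
    unfolding AE_def ae_def tensor_product.carrier_T[OF AE_tensor[OF assms]] by simp
  then show ?thesis
    using proj1_ae[OF assms] jet1_form_ae[OF assms] by (auto simp: jet1_relations_def)
qed

lemma jet1_rep_iff:
  assumes E: "lmod E" and x: "x \<in> carrier (AE \<Omega> E)" and y: "y \<in> carrier (AE \<Omega> E)"
  shows "x \<ominus>\<^bsub>AE \<Omega> E\<^esub> y \<in> jet1_relations \<Omega> E \<longleftrightarrow>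
    proj1 E x = proj1 E y \<and> jet1_form E x = jet1_form E y"
proof -
  interpret T: abelian_group "AE \<Omega> E" by (rule AE_group[OF E])
  interpret E: abelian_group E by (rule left_module_group[OF E])
  interpret O: abelian_group "Om1 E" by (rule Om_group[OF E])
  note p = proj1_additive_AE[OF E] and s = jet1_form_additive_AE[OF E]
  have *: "u \<ominus>\<^bsub>G\<^esub> v = \<zero>\<^bsub>G\<^esub> \<longleftrightarrow> u = v" if "abelian_group G" "u \<in> carrier G" "v \<in> carrier G"
    for G :: "('w, ('w, 'e) elt) module" and u v
  proof -
    interpret G: abelian_group G by fact
    show ?thesis using that
      by (metis G.a_inv_closed G.minus_equality G.minus_minus G.r_neg a_minus_def)
  qed
  show ?thesis
    using additive_minus[OF T.abelian_group_axioms E.abelian_group_axioms p x y]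
      additive_minus[OF T.abelian_group_axioms O.abelian_group_axioms s x y]
      additive_closed[OF p] additive_closed[OF s] x y
      *[OF E.abelian_group_axioms] *[OF O.abelian_group_axioms]
    by (auto simp: jet1_relations_eq[OF E] a_minus_def)
qed

abbreviation "jet1_rep E \<equiv> coset_rep (AE \<Omega> E) (jet1_relations \<Omega> E)"

text \<open>An element of \<open>jet1 E\<close> is literally an element of
  \<open>AE \<Omega> E\<close>, namely the chosen one in its coset. So both maps can be applied to
  it as it stands, and the choice does not affect their values.\<close>

lemma jet1_rep:
  assumes E: "lmod E" and x: "x \<in> carrier (AE \<Omega> E)"
  shows "jet1_rep E x \<in> carrier (AE \<Omega> E)" "proj1 E (jet1_rep E x) = proj1 E x"
    "jet1_form E (jet1_rep E x) = jet1_form E x"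
proof -
  have "jet1_rep E x \<in> carrier (AE \<Omega> E) \<and> x \<ominus>\<^bsub>AE \<Omega> E\<^esub> jet1_rep E x \<in> jet1_relations \<Omega> E"
    unfolding coset_rep_def by (rule someI[of _ x]) (simp add: x jet1_rep_iff[OF E])
  then show "jet1_rep E x \<in> carrier (AE \<Omega> E)" "proj1 E (jet1_rep E x) = proj1 E x"
    "jet1_form E (jet1_rep E x) = jet1_form E x"
    using jet1_rep_iff[OF E x] by auto
qed

lemma jet1_rep_cong:
  assumes "lmod E" "x \<in> carrier (AE \<Omega> E)" "y \<in> carrier (AE \<Omega> E)"
    "proj1 E x = proj1 E y" "jet1_form E x = jet1_form E y"
  shows "jet1_rep E x = jet1_rep E y"
  unfolding coset_rep_def
  by (rule arg_cong[where f = Eps]) (use assms jet1_rep_iff[OF assms(1)] in \<open>auto simp: fun_eq_iff\<close>)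

lemma J1_simps:
  "carrier (jet1 E) = jet1_rep E ` carrier (AE \<Omega> E)" "\<zero>\<^bsub>jet1 E\<^esub> = jet1_rep E \<zero>\<^bsub>AE \<Omega> E\<^esub>"
  "x \<oplus>\<^bsub>jet1 E\<^esub> y = jet1_rep E (x \<oplus>\<^bsub>AE \<Omega> E\<^esub> y)" "a \<odot>\<^bsub>jet1 E\<^esub> x = jet1_rep E (a \<odot>\<^bsub>AE \<Omega> E\<^esub> x)"
  by (simp_all add: J1_def quotient_module_def)

lemma J1_carrier_AE: "lmod E \<Longrightarrow> x \<in> carrier (jet1 E) \<Longrightarrow> x \<in> carrier (AE \<Omega> E)"
  using jet1_rep(1) by (auto simp: J1_simps)

text \<open>The injectivity half of the description by pairs. Module laws of \<open>jet1 E\<close>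
  and linearity of maps into it are verified by comparing two components through this rule.\<close>

lemma J1_eqI:
  assumes "lmod E" "x \<in> carrier (jet1 E)" "y \<in> carrier (jet1 E)"
    "proj1 E x = proj1 E y" "jet1_form E x = jet1_form E y"
  shows "x = y"
proof -
  obtain x' y' where "x' \<in> carrier (AE \<Omega> E)" "x = jet1_rep E x'" "y' \<in> carrier (AE \<Omega> E)" "y = jet1_rep E y'"
    using assms(2,3) by (auto simp: J1_simps)
  then show ?thesis
    using assms(4,5) jet1_rep[OF assms(1)] by (metis jet1_rep_cong[OF assms(1)])
qed

lemma J1_eq_iff:
  "lmod E \<Longrightarrow> x \<in> carrier (jet1 E) \<Longrightarrow> y \<in> carrier (jet1 E) \<Longrightarrow>
    x = y \<longleftrightarrow> proj1 E x = proj1 E y \<and> jet1_form E x = jet1_form E y"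
  using J1_eqI by blast

lemma proj1_closed: "lmod E \<Longrightarrow> x \<in> carrier (jet1 E) \<Longrightarrow> proj1 E x \<in> carrier E"
  using additive_closed[OF proj1_additive_AE] J1_carrier_AE by blast

lemma jet1_form_closed: "lmod E \<Longrightarrow> x \<in> carrier (jet1 E) \<Longrightarrow> jet1_form E x \<in> carrier (Om1 E)"
  using additive_closed[OF jet1_form_additive_AE] J1_carrier_AE by blast

lemma J1_add:
  assumes E: "lmod E" and "x \<in> carrier (jet1 E)" "y \<in> carrier (jet1 E)"
  shows "x \<oplus>\<^bsub>jet1 E\<^esub> y \<in> carrier (jet1 E)"
    "proj1 E (x \<oplus>\<^bsub>jet1 E\<^esub> y) = proj1 E x \<oplus>\<^bsub>E\<^esub> proj1 E y"
    "jet1_form E (x \<oplus>\<^bsub>jet1 E\<^esub> y) = jet1_form E x \<oplus>\<^bsub>Om1 E\<^esub> jet1_form E y"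
proof -
  have xy: "x \<in> carrier (AE \<Omega> E)" "y \<in> carrier (AE \<Omega> E)" using assms J1_carrier_AE by auto
  then have c: "x \<oplus>\<^bsub>AE \<Omega> E\<^esub> y \<in> carrier (AE \<Omega> E)" using abelian_groupE(1)[OF AE_group[OF E]] by blast
  show "x \<oplus>\<^bsub>jet1 E\<^esub> y \<in> carrier (jet1 E)"
    "proj1 E (x \<oplus>\<^bsub>jet1 E\<^esub> y) = proj1 E x \<oplus>\<^bsub>E\<^esub> proj1 E y"
    "jet1_form E (x \<oplus>\<^bsub>jet1 E\<^esub> y) = jet1_form E x \<oplus>\<^bsub>Om1 E\<^esub> jet1_form E y"
    unfolding J1_simps(3)
    using c xy by (auto simp: J1_simps(1) jet1_rep[OF E] additive_add[OF proj1_additive_AE[OF E]]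
      additive_add[OF jet1_form_additive_AE[OF E]])
qed

lemma J1_zero:
  assumes E: "lmod E"
  shows "\<zero>\<^bsub>jet1 E\<^esub> \<in> carrier (jet1 E)" "proj1 E \<zero>\<^bsub>jet1 E\<^esub> = \<zero>\<^bsub>E\<^esub>"
    "jet1_form E \<zero>\<^bsub>jet1 E\<^esub> = \<zero>\<^bsub>Om1 E\<^esub>"
  using jet1_rep[OF E, of "\<zero>\<^bsub>AE \<Omega> E\<^esub>"] abelian_groupE(2)[OF AE_group[OF E]]
    additive_zero[OF AE_group[OF E] left_module_group[OF E] proj1_additive_AE[OF E]]
    additive_zero[OF AE_group[OF E] Om_group[OF E] jet1_form_additive_AE[OF E]]
  by (simp_all add: J1_simps)

text \<open>The rule \<open>d(ab) = da b + a db\<close> summed over a representative; the terms with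
  \<open>da\<close> collect into \<open>proj1\<close>. This is the source of the twisted action on
  the second component, and it also evaluates the Spencer operator in
  \<open>spencer0_eq\<close>.\<close>

lemma lift_diff_mult:
  assumes E: "lmod E" and a: "a \<in> gr 0" and x: "x \<in> carrier (AE \<Omega> E)"
  shows "lift (Om1 E) (\<lambda>b e. om1 E (der (a \<otimes> b)) e) x =
    om1 E (der a) (proj1 E x) \<oplus>\<^bsub>Om1 E\<^esub> a \<odot>\<^bsub>Om1 E\<^esub> jet1_form E x"
proof -
  note G = left_module_group[OF E] and O = Om_group[OF E]
  have "lift (Om1 E) (\<lambda>b e. om1 E (der (a \<otimes> b)) e) x =
    lift (Om1 E) (\<lambda>b e. om1 E (der a) (b \<odot>\<^bsub>E\<^esub> e) \<oplus>\<^bsub>Om1 E\<^esub> a \<odot>\<^bsub>Om1 E\<^esub> om1 E (der b) e) x"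
  proof (rule lift_cong)
    fix b e assume "(b, e) \<in> set (terms x)"
    then have be: "b \<in> gr 0" "e \<in> carrier E" using AE_terms[OF E x] by auto
    show "om1 E (der (a \<otimes> b)) e =
      om1 E (der a) (b \<odot>\<^bsub>E\<^esub> e) \<oplus>\<^bsub>Om1 E\<^esub> a \<odot>\<^bsub>Om1 E\<^esub> om1 E (der b) e"
      using a be
      by (simp add: smult_om[OF E] om_balanced[OF E, symmetric] leibniz_0 grade_intros
          grade_carrier[of b 0] om_add_l[OF E])
  qed
  also have "\<dots> = lift (Om1 E) (\<lambda>b e. om1 E (der a) (b \<odot>\<^bsub>E\<^esub> e)) x \<oplus>\<^bsub>Om1 E\<^esub>
      lift (Om1 E) (\<lambda>b e. a \<odot>\<^bsub>Om1 E\<^esub> om1 E (der b) e) x"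
    using AE_terms[OF E x] a
    by (intro lift_add[OF O]) (auto simp: om_closed[OF E] grade_intros lmod_smult[OF E] lmod_smult[OF Om_module[OF E]])
  also have "lift (Om1 E) (\<lambda>b e. om1 E (der a) (b \<odot>\<^bsub>E\<^esub> e)) x = om1 E (der a) (proj1 E x)"
    unfolding proj1_def
    by (rule additive_of_lift[OF G O additive_om_r[OF E], symmetric])
      (use AE_terms[OF E x] a in \<open>auto simp: lmod_smult[OF E] grade_intros\<close>)
  also have "lift (Om1 E) (\<lambda>b e. a \<odot>\<^bsub>Om1 E\<^esub> om1 E (der b) e) x = a \<odot>\<^bsub>Om1 E\<^esub> jet1_form E x"
    unfolding jet1_form_def
    by (rule additive_of_lift[OF O O additive_smult_Om[OF E a], symmetric])
      (use AE_terms[OF E x] in \<open>auto simp: om_closed[OF E] grade_intros\<close>)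
  finally show ?thesis .
qed

lemma J1_smult:
  assumes E: "lmod E" and a: "a \<in> gr 0" and x: "x \<in> carrier (jet1 E)"
  shows "a \<odot>\<^bsub>jet1 E\<^esub> x \<in> carrier (jet1 E)"
    "proj1 E (a \<odot>\<^bsub>jet1 E\<^esub> x) = a \<odot>\<^bsub>E\<^esub> proj1 E x"
    "jet1_form E (a \<odot>\<^bsub>jet1 E\<^esub> x) = om1 E (der a) (proj1 E x) \<oplus>\<^bsub>Om1 E\<^esub> a \<odot>\<^bsub>Om1 E\<^esub> jet1_form E x"
proof -
  note T = AE_group[OF E] and G = left_module_group[OF E] and O = Om_group[OF E]
  have x: "x \<in> carrier (AE \<Omega> E)" using x J1_carrier_AE[OF E] by auto
  have ae: "ae \<Omega> E [(a \<otimes> b, e)] \<in> carrier (AE \<Omega> E)" if "(b, e) \<in> set (terms x)" for b e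
    using AE_terms[OF E x that] a by (intro ae_closed[OF E]) (auto simp: grade_intros)
  have sm: "a \<odot>\<^bsub>AE \<Omega> E\<^esub> x = lift (AE \<Omega> E) (\<lambda>b e. ae \<Omega> E [(a \<otimes> b, e)]) x"
    using tensor_product.smult_T_lift[OF AE_tensor[OF E], of a x] x a by (simp add: AE_def ae_def grade_intros)
  have c: "a \<odot>\<^bsub>AE \<Omega> E\<^esub> x \<in> carrier (AE \<Omega> E)"
    unfolding sm by (rule lift_closed[OF T ae])
  show "a \<odot>\<^bsub>jet1 E\<^esub> x \<in> carrier (jet1 E)" using c by (simp add: J1_simps)
  have "proj1 E (a \<odot>\<^bsub>AE \<Omega> E\<^esub> x) = lift E (\<lambda>b e. proj1 E (ae \<Omega> E [(a \<otimes> b, e)])) x"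
    unfolding sm by (rule additive_of_lift[OF T G proj1_additive_AE[OF E] ae])
  also have "\<dots> = lift E (\<lambda>b e. a \<odot>\<^bsub>E\<^esub> (b \<odot>\<^bsub>E\<^esub> e)) x"
    by (rule lift_cong) (use AE_terms[OF E x] a in \<open>auto simp: proj1_ae_single[OF E] grade_intros lmod_smult_assoc[OF E]\<close>)
  also have "\<dots> = a \<odot>\<^bsub>E\<^esub> proj1 E x"
    unfolding proj1_def
    by (rule additive_of_lift[OF G G additive_smult[OF E], symmetric])
      (use AE_terms[OF E x] a in \<open>auto simp: lmod_smult[OF E]\<close>)
  finally show "proj1 E (a \<odot>\<^bsub>jet1 E\<^esub> x) = a \<odot>\<^bsub>E\<^esub> proj1 E x"
    unfolding J1_simps(4) by (simp add: jet1_rep[OF E c])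
  have "jet1_form E (a \<odot>\<^bsub>AE \<Omega> E\<^esub> x) = lift (Om1 E) (\<lambda>b e. jet1_form E (ae \<Omega> E [(a \<otimes> b, e)])) x"
    unfolding sm by (rule additive_of_lift[OF T O jet1_form_additive_AE[OF E] ae])
  also have "\<dots> = lift (Om1 E) (\<lambda>b e. om1 E (der (a \<otimes> b)) e) x"
    by (rule lift_cong) (use AE_terms[OF E x] a in \<open>auto simp: jet1_form_ae_single[OF E] grade_intros\<close>)
  also have "\<dots> = om1 E (der a) (proj1 E x) \<oplus>\<^bsub>Om1 E\<^esub> a \<odot>\<^bsub>Om1 E\<^esub> jet1_form E x"
    by (rule lift_diff_mult[OF E a x])
  finally show "jet1_form E (a \<odot>\<^bsub>jet1 E\<^esub> x) =
      om1 E (der a) (proj1 E x) \<oplus>\<^bsub>Om1 E\<^esub> a \<odot>\<^bsub>Om1 E\<^esub> jet1_form E x"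
    unfolding J1_simps(4) by (simp add: jet1_rep[OF E c])
qed

lemma J1_group:
  assumes E: "lmod E"
  shows "abelian_group (jet1 E)"
proof -
  interpret G: abelian_group E by (rule left_module_group[OF E])
  interpret O: abelian_group "Om1 E" by (rule Om_group[OF E])
  interpret T: abelian_group "AE \<Omega> E" by (rule AE_group[OF E])
  note s = J1_add[OF E] J1_zero[OF E] proj1_closed[OF E] jet1_form_closed[OF E]
  show ?thesis
  proof (rule abelian_groupI)
    fix x assume x: "x \<in> carrier (jet1 E)"
    then have xA: "x \<in> carrier (AE \<Omega> E)" by (rule J1_carrier_AE[OF E])
    let ?y = "jet1_rep E (\<ominus>\<^bsub>AE \<Omega> E\<^esub> x)"
    have "?y \<in> carrier (jet1 E)" using xA by (simp add: J1_simps)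
    moreover have "proj1 E ?y = \<ominus>\<^bsub>E\<^esub> proj1 E x" "jet1_form E ?y = \<ominus>\<^bsub>Om1 E\<^esub> jet1_form E x"
      using xA additive_inv[OF T.abelian_group_axioms G.abelian_group_axioms proj1_additive_AE[OF E] xA]
        additive_inv[OF T.abelian_group_axioms O.abelian_group_axioms jet1_form_additive_AE[OF E] xA]
      by (simp_all add: jet1_rep[OF E])
    ultimately have "?y \<oplus>\<^bsub>jet1 E\<^esub> x = \<zero>\<^bsub>jet1 E\<^esub>"
      using x by (simp add: J1_eq_iff[OF E] s G.l_neg O.l_neg)
    then show "\<exists>y\<in>carrier (jet1 E). y \<oplus>\<^bsub>jet1 E\<^esub> x = \<zero>\<^bsub>jet1 E\<^esub>"
      using \<open>?y \<in> carrier (jet1 E)\<close> by blast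
  qed (simp_all add: J1_eq_iff[OF E] s G.a_ac O.a_ac)
qed

text \<open>In the second component, associativity of the action is the Leibniz rule for
  \<open>der (a \<otimes> b)\<close>, and the unit law rests on
  \<open>der \<one> = \<zero>\<close>.\<close>

lemma J1_module:
  assumes E: "lmod E"
  shows "lmod (jet1 E)"
proof -
  interpret G: abelian_group E by (rule left_module_group[OF E])
  interpret O: abelian_group "Om1 E" by (rule Om_group[OF E])
  note OE = Om_module[OF E, of 1]
  note s = J1_add[OF E] J1_smult[OF E] proj1_closed[OF E] jet1_form_closed[OF E] grade_intros
    lmod_smult[OF E] lmod_smult[OF OE] om_closed[OF E]
  note distr = lmod_smult_l_distr[OF E] lmod_smult_l_distr[OF OE] lmod_smult_r_distr[OF E] lmod_smult_r_distr[OF OE]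
    lmod_smult_assoc[OF E] lmod_smult_assoc[OF OE] lmod_smult_one[OF E] lmod_smult_one[OF OE]
    diff_add[OF grade_carrier grade_carrier] om_add_l[OF E] om_add_r[OF E] diff_one om_zero_l[OF E]
    leibniz_0[OF _ grade_carrier] smult_om[OF E]
  show ?thesis
    by (rule left_moduleI[OF ring_coeffs J1_group[OF E]]; (unfold forms_simps)?)
      (simp_all add: J1_eq_iff[OF E] s distr G.a_ac O.a_ac om_balanced[OF E])
qed

lemma proj1_linear: "lmod E \<Longrightarrow> lin (jet1 E) E (proj1 E)"
  by (simp add: linear_map_def additive_def proj1_closed J1_add J1_smult)

lemma jet1_form_additive: "lmod E \<Longrightarrow> additive (jet1 E) (Om1 E) (jet1_form E)"
  by (simp add: additive_def jet1_form_closed J1_add)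

lemma jet1_class:
  assumes "lmod E" "a \<in> gr 0" "e \<in> carrier E"
  shows "jet1_class \<Omega> E a e \<in> carrier (jet1 E)" "proj1 E (jet1_class \<Omega> E a e) = a \<odot>\<^bsub>E\<^esub> e"
    "jet1_form E (jet1_class \<Omega> E a e) = om1 E (der a) e"
  using ae_closed[OF assms] jet1_rep[OF assms(1) ae_closed[OF assms]]
  by (auto simp: jet1_class_def J1_simps proj1_ae_single[OF assms] jet1_form_ae_single[OF assms])

lemma prol1:
  assumes "lmod E" "e \<in> carrier E"
  shows "prol1 \<Omega> E e \<in> carrier (jet1 E)" "proj1 E (prol1 \<Omega> E e) = e"
    "jet1_form E (prol1 \<Omega> E e) = \<zero>\<^bsub>Om1 E\<^esub>"
  using jet1_class[OF assms(1) one_grade assms(2)] assms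
  by (simp_all add: prol1_def lmod_smult_one diff_one om_zero_l)

text \<open>Over first component zero the form \<open>a db \<otimes> m\<close> is reached by
  \<open>[ab \<otimes> m] - [a \<otimes> bm]\<close>, because \<open>d(ab) - da b = a db\<close>. A
  prolongation, whose form vanishes, then adjusts the first component.\<close>

lemma ex_jet1:
  assumes E: "lmod E" and e: "e \<in> carrier E" and w: "w \<in> carrier (Om1 E)"
  shows "\<exists>x \<in> carrier (jet1 E). proj1 E x = e \<and> jet1_form E x = w"
proof -
  interpret G: abelian_group E by (rule left_module_group[OF E])
  interpret O: abelian_group "Om1 E" by (rule Om_group[OF E])
  interpret J: abelian_group "jet1 E" by (rule J1_group[OF E])
  note p = additive_minus[OF J.abelian_group_axioms G.abelian_group_axioms linear_map_additive[OF proj1_linear[OF E]]]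
  note s = additive_minus[OF J.abelian_group_axioms O.abelian_group_axioms jet1_form_additive[OF E]]
  from E w have "\<exists>x \<in> carrier (jet1 E). proj1 E x = \<zero>\<^bsub>E\<^esub> \<and> jet1_form E x = w"
  proof (induction rule: Om1_induct)
    case zero
    show ?case using J1_zero[OF E] by blast
  next
    case (gen a b m)
    let ?x = "jet1_class \<Omega> E (a \<otimes> b) m" and ?y = "jet1_class \<Omega> E a (b \<odot>\<^bsub>E\<^esub> m)"
    have c: "?x \<in> carrier (jet1 E)" "?y \<in> carrier (jet1 E)"
      using gen by (auto intro!: jet1_class[OF E] simp: grade_intros lmod_smult[OF E])
    have "proj1 E (?x \<ominus>\<^bsub>jet1 E\<^esub> ?y) = \<zero>\<^bsub>E\<^esub>"
      unfolding p[OF c] using gen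
      by (simp add: jet1_class[OF E] grade_intros lmod_smult[OF E] lmod_smult_assoc[OF E] a_minus_def G.r_neg)
    moreover have "jet1_form E (?x \<ominus>\<^bsub>jet1 E\<^esub> ?y) = om1 E (a \<otimes> der b) m"
    proof -
      have "jet1_form E (?x \<ominus>\<^bsub>jet1 E\<^esub> ?y) =
        om1 E (der a \<otimes> b) m \<oplus>\<^bsub>Om1 E\<^esub> om1 E (a \<otimes> der b) m \<ominus>\<^bsub>Om1 E\<^esub> om1 E (der a \<otimes> b) m"
        using gen c by (simp add: s jet1_class[OF E] grade_intros lmod_smult[OF E] leibniz_0 grade_carrier[of b 0]
            om_add_l[OF E] om_balanced[OF E])
      also have "\<dots> = om1 E (a \<otimes> der b) m"
        using gen by (simp add: a_minus_def O.a_ac O.r_neg om_closed[OF E] grade_intros O.r_neg1)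
      finally show ?thesis .
    qed
    ultimately show ?case using c by (meson J.minus_closed)
  next
    case (add u v)
    then obtain x y where "x \<in> carrier (jet1 E)" "proj1 E x = \<zero>\<^bsub>E\<^esub>" "jet1_form E x = u"
      "y \<in> carrier (jet1 E)" "proj1 E y = \<zero>\<^bsub>E\<^esub>" "jet1_form E y = v" by blast
    then show ?case by (intro bexI[of _ "x \<oplus>\<^bsub>jet1 E\<^esub> y"]) (simp_all add: J1_add[OF E])
  qed
  then obtain x where "x \<in> carrier (jet1 E)" "proj1 E x = \<zero>\<^bsub>E\<^esub>" "jet1_form E x = w" by blast
  then show ?thesis
    using w e by (intro bexI[of _ "prol1 \<Omega> E e \<oplus>\<^bsub>jet1 E\<^esub> x"]) (simp_all add: J1_add[OF E] prol1[OF E])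
qed

text \<open>The inverse of the map to pairs: \<open>ex_jet1\<close> makes the choice possible, and
  by \<open>J1_eqI\<close> it is forced.\<close>

definition jet1_pair :: "('w, 'e) emodule \<Rightarrow> ('w, 'e) elt \<Rightarrow> ('w, 'e) elt \<Rightarrow> ('w, 'e) elt" where
  "jet1_pair E e w = (SOME x. x \<in> carrier (jet1 E) \<and> proj1 E x = e \<and> jet1_form E x = w)"

lemma jet1_pair:
  assumes "lmod E" "e \<in> carrier E" "w \<in> carrier (Om1 E)"
  shows "jet1_pair E e w \<in> carrier (jet1 E)" "proj1 E (jet1_pair E e w) = e"
    "jet1_form E (jet1_pair E e w) = w"
proof -
  have "jet1_pair E e w \<in> carrier (jet1 E) \<and> proj1 E (jet1_pair E e w) = e \<and> jet1_form E (jet1_pair E e w) = w"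
    unfolding jet1_pair_def by (rule someI_ex) (use ex_jet1[OF assms] in blast)
  then show "jet1_pair E e w \<in> carrier (jet1 E)" "proj1 E (jet1_pair E e w) = e"
    "jet1_form E (jet1_pair E e w) = w" by auto
qed

text \<open>Resolves the definite description. The minus sign arises from
  \<open>da b - d(ab) = - a db\<close>; uniqueness holds since additive maps on \<open>Om1 E\<close>
  are determined by the elements \<open>a db \<otimes> e\<close>. The restriction is there because
  \<open>linear_maps\<close> are extensional.\<close>

lemma iota1_eq:
  assumes E: "lmod E"
  shows "iota1 \<Omega> E = restrict (\<lambda>w. jet1_pair E \<zero>\<^bsub>E\<^esub> (\<ominus>\<^bsub>Om1 E\<^esub> w)) (carrier (Om1 E))" (is "_ = ?f")
proof -
  interpret G: abelian_group E by (rule left_module_group[OF E])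
  interpret O: abelian_group "Om1 E" by (rule Om_group[OF E])
  interpret J: abelian_group "jet1 E" by (rule J1_group[OF E])
  note p = additive_minus[OF J.abelian_group_axioms G.abelian_group_axioms linear_map_additive[OF proj1_linear[OF E]]]
  note s = additive_minus[OF J.abelian_group_axioms O.abelian_group_axioms jet1_form_additive[OF E]]
  note OE = Om_module[OF E, of 1]
  note ii = lmod_smult[OF E] lmod_smult[OF OE] jet1_pair[OF E] grade_intros
    additive_inv[OF O.abelian_group_axioms O.abelian_group_axioms additive_smult_Om[OF E]]
    om_zero_r[OF E] additive_zero[OF G.abelian_group_axioms G.abelian_group_axioms additive_smult[OF E]]
  have lin: "?f \<in> linear_maps (coeffs \<Omega>) (Om1 E) (jet1 E)"
    by (auto simp: linear_maps_iff linear_map_restrict[OF OE] linear_map_def additive_def ii O.minus_add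
        J1_add[OF E] J1_smult[OF E] J1_eq_iff[OF E])
  have gen: "?f (om1 E (a \<otimes> der b) e) =
        jet1_class \<Omega> E a (b \<odot>\<^bsub>E\<^esub> e) \<ominus>\<^bsub>jet1 E\<^esub> jet1_class \<Omega> E (a \<otimes> b) e"
    if "a \<in> gr 0" "b \<in> gr 0" "e \<in> carrier E" for a b e
  proof -
    have "jet1_form E (jet1_class \<Omega> E a (b \<odot>\<^bsub>E\<^esub> e) \<ominus>\<^bsub>jet1 E\<^esub> jet1_class \<Omega> E (a \<otimes> b) e) =
      om1 E (der a \<otimes> b) e \<ominus>\<^bsub>Om1 E\<^esub> (om1 E (der a \<otimes> b) e \<oplus>\<^bsub>Om1 E\<^esub> om1 E (a \<otimes> der b) e)"
      using that by (simp add: s jet1_class[OF E] grade_intros lmod_smult[OF E] leibniz_0 grade_carrier[of b 0]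
            om_add_l[OF E] om_balanced[OF E])
    also have "\<dots> = \<ominus>\<^bsub>Om1 E\<^esub> om1 E (a \<otimes> der b) e"
      using that by (simp add: a_minus_def O.minus_add om_closed[OF E] grade_intros O.r_neg2)
    finally have "jet1_form E (jet1_class \<Omega> E a (b \<odot>\<^bsub>E\<^esub> e) \<ominus>\<^bsub>jet1 E\<^esub> jet1_class \<Omega> E (a \<otimes> b) e) =
      \<ominus>\<^bsub>Om1 E\<^esub> om1 E (a \<otimes> der b) e" .
    moreover have "proj1 E (jet1_class \<Omega> E a (b \<odot>\<^bsub>E\<^esub> e) \<ominus>\<^bsub>jet1 E\<^esub> jet1_class \<Omega> E (a \<otimes> b) e) = \<zero>\<^bsub>E\<^esub>"
    proof -
      have "proj1 E (jet1_class \<Omega> E a (b \<odot>\<^bsub>E\<^esub> e) \<ominus>\<^bsub>jet1 E\<^esub> jet1_class \<Omega> E (a \<otimes> b) e) =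
        a \<odot>\<^bsub>E\<^esub> (b \<odot>\<^bsub>E\<^esub> e) \<ominus>\<^bsub>E\<^esub> (a \<otimes> b) \<odot>\<^bsub>E\<^esub> e"
        using that by (simp add: p jet1_class[OF E] grade_intros lmod_smult[OF E])
      then show ?thesis
        using that by (simp add: lmod_smult_assoc[OF E] lmod_smult[OF E] a_minus_def G.r_neg)
    qed
    ultimately show ?thesis
      using that by (simp add: J1_eq_iff[OF E] ii om_closed[OF E] jet1_class[OF E])
  qed
  show ?thesis
    unfolding iota1_def
  proof (rule the_equality)
    show "?f \<in> linear_maps (coeffs \<Omega>) (Om1 E) (jet1 E) \<and>
     (\<forall>a \<in> carrier (coeffs \<Omega>). \<forall>b \<in> carrier (coeffs \<Omega>). \<forall>e \<in> carrier E.
        ?f (om1 E (a \<otimes>\<^bsub>\<Omega>\<^esub> der b) e) =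
        jet1_class \<Omega> E a (b \<odot>\<^bsub>E\<^esub> e) \<ominus>\<^bsub>jet1 E\<^esub> jet1_class \<Omega> E (a \<otimes>\<^bsub>\<Omega>\<^esub> b) e)"
      using lin gen by simp
    fix g assume g: "g \<in> linear_maps (coeffs \<Omega>) (Om1 E) (jet1 E) \<and>
     (\<forall>a \<in> carrier (coeffs \<Omega>). \<forall>b \<in> carrier (coeffs \<Omega>). \<forall>e \<in> carrier E.
        g (om1 E (a \<otimes>\<^bsub>\<Omega>\<^esub> der b) e) =
        jet1_class \<Omega> E a (b \<odot>\<^bsub>E\<^esub> e) \<ominus>\<^bsub>jet1 E\<^esub> jet1_class \<Omega> E (a \<otimes>\<^bsub>\<Omega>\<^esub> b) e)"
    show "g = ?f"
    proof (rule extensionalityI)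
      show "g \<in> extensional (carrier (Om1 E))" using g by (simp add: linear_maps_iff)
      have g_add: "additive (Om1 E) (jet1 E) g" and f_add: "additive (Om1 E) (jet1 E) ?f"
        using g lin linear_map_additive unfolding linear_maps_iff by blast+
      fix w assume w: "w \<in> carrier (Om1 E)"
      show "g w = ?f w"
        by (rule Om1_ext[OF E J.abelian_group_axioms g_add f_add _ w]) (subst gen; use g in simp)
    qed simp
  qed
qed

lemma iota1:
  assumes E: "lmod E" and w: "w \<in> carrier (Om1 E)"
  shows "iota1 \<Omega> E w \<in> carrier (jet1 E)" "proj1 E (iota1 \<Omega> E w) = \<zero>\<^bsub>E\<^esub>"
    "jet1_form E (iota1 \<Omega> E w) = \<ominus>\<^bsub>Om1 E\<^esub> w"
proof -
  interpret O: abelian_group "Om1 E" by (rule Om_group[OF E])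
  show "iota1 \<Omega> E w \<in> carrier (jet1 E)" "proj1 E (iota1 \<Omega> E w) = \<zero>\<^bsub>E\<^esub>"
    "jet1_form E (iota1 \<Omega> E w) = \<ominus>\<^bsub>Om1 E\<^esub> w"
    using w by (simp_all add: iota1_eq[OF E] jet1_pair[OF E] lmod_zero_closed[OF E])
qed

lemma iota1_linear:
  assumes E: "lmod E"
  shows "lin (Om1 E) (jet1 E) (iota1 \<Omega> E)"
proof -
  interpret G: abelian_group E by (rule left_module_group[OF E])
  interpret O: abelian_group "Om1 E" by (rule Om_group[OF E])
  note OE = Om_module[OF E, of 1]
  show ?thesis
    by (auto simp: linear_map_def additive_def iota1[OF E] O.minus_add lmod_smult[OF OE]
        additive_inv[OF O.abelian_group_axioms O.abelian_group_axioms additive_smult_Om[OF E]]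
        om_zero_r[OF E] additive_zero[OF G.abelian_group_axioms G.abelian_group_axioms additive_smult[OF E]]
        J1_add[OF E] J1_smult[OF E] diff_grade_0 J1_eq_iff[OF E])
qed

lemma J1_terms:
  "lmod E \<Longrightarrow> x \<in> carrier (jet1 E) \<Longrightarrow> (a, e) \<in> set (terms x) \<Longrightarrow> a \<in> gr 0 \<and> e \<in> carrier E"
  using AE_terms J1_carrier_AE by blast

text \<open>On pairs the functor acts by \<open>f\<close> on the first and by
  \<open>Om1_map N f\<close> on the second component, obtained by pushing each component map into
  the sum over representatives.\<close>

lemma J1_map:
  assumes M: "lmod M" and N: "lmod N" and f: "lin M N f" and x: "x \<in> carrier (jet1 M)"
  shows "J1_map \<Omega> N f x \<in> carrier (jet1 N)" "proj1 N (J1_map \<Omega> N f x) = f (proj1 M x)"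
    "jet1_form N (J1_map \<Omega> N f x) = Om1_map N f (jet1_form M x)"
proof -
  note JN = J1_group[OF N] and GN = left_module_group[OF N] and GM = left_module_group[OF M]
  note tm = J1_terms[OF M x]
  have c: "jet1_class \<Omega> N a (f e) \<in> carrier (jet1 N)" if "(a, e) \<in> set (terms x)" for a e
    using tm[OF that] by (intro jet1_class[OF N]) (auto simp: linear_map_closed[OF f])
  show "J1_map \<Omega> N f x \<in> carrier (jet1 N)"
    unfolding J1_map_def by (rule lift_closed[OF JN c])
  have "proj1 N (J1_map \<Omega> N f x) = lift N (\<lambda>a e. proj1 N (jet1_class \<Omega> N a (f e))) x"
    unfolding J1_map_def by (rule additive_of_lift[OF JN GN linear_map_additive[OF proj1_linear[OF N]] c])
  also have "\<dots> = lift N (\<lambda>a e. f (a \<odot>\<^bsub>M\<^esub> e)) x"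
    by (rule lift_cong) (use tm in \<open>auto simp: jet1_class[OF N] linear_map_closed[OF f] linear_map_smult[OF f]\<close>)
  also have "\<dots> = f (proj1 M x)"
    unfolding proj1_def by (rule additive_of_lift[OF GM GN linear_map_additive[OF f], symmetric])
      (use tm in \<open>auto simp: lmod_smult[OF M]\<close>)
  finally show "proj1 N (J1_map \<Omega> N f x) = f (proj1 M x)" .
  have "jet1_form N (J1_map \<Omega> N f x) = lift (Om1 N) (\<lambda>a e. jet1_form N (jet1_class \<Omega> N a (f e))) x"
    unfolding J1_map_def by (rule additive_of_lift[OF JN Om_group[OF N] jet1_form_additive[OF N] c])
  also have "\<dots> = lift (Om1 N) (\<lambda>a e. Om1_map N f (om1 M (der a) e)) x"
    by (rule lift_cong) (use tm in \<open>auto simp: jet1_class[OF N] linear_map_closed[OF f] Om_map_om[OF M N f] grade_intros\<close>)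
  also have "\<dots> = Om1_map N f (jet1_form M x)"
    unfolding jet1_form_def
    by (rule additive_of_lift[OF Om_group[OF M] Om_group[OF N] Om_map_additive[OF M N f], symmetric])
      (use tm in \<open>auto simp: om_closed[OF M] grade_intros\<close>)
  finally show "jet1_form N (J1_map \<Omega> N f x) = Om1_map N f (jet1_form M x)" .
qed


section \<open>Derivations along a linear map\<close>

text \<open>Pairs \<open>(\<pi>, \<sigma>)\<close> such that \<open>m \<mapsto> (\<pi> m, \<sigma> m)\<close> is a linear map \<open>M \<rightarrow> J\<^sup>1 N\<close>. Both \<open>(\<pi>\<^sup>1\<^sup>,\<^sup>0, jet1_form)\<close> and
  \<open>(id, \<nabla>)\<close> for a connection \<open>\<nabla>\<close> are of this form.\<close>

definition derivation ::
  "('w, 'e) emodule \<Rightarrow> ('w, 'e) emodule \<Rightarrow> (('w, 'e) elt \<Rightarrow> ('w, 'e) elt) \<Rightarrow> (('w, 'e) elt \<Rightarrow> ('w, 'e) elt) \<Rightarrow> bool" where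
  "derivation M N \<pi> \<sigma> \<longleftrightarrow> lin M N \<pi> \<and> additive M (Om1 N) \<sigma> \<and>
     (\<forall>a \<in> gr 0. \<forall>m \<in> carrier M.
       \<sigma> (a \<odot>\<^bsub>M\<^esub> m) = om1 N (der a) (\<pi> m) \<oplus>\<^bsub>Om1 N\<^esub> a \<odot>\<^bsub>Om1 N\<^esub> \<sigma> m)"

text \<open>For a connection this is minus the exterior covariant derivative on 1-forms, and for
  \<open>(\<pi>\<^sup>1\<^sup>,\<^sup>0, jet1_form)\<close> it is minus the Spencer operator \<open>\<S>\<^sup>1\<^sup>,\<^sup>1\<close>.\<close>

definition cov ::
  "('w, 'e) emodule \<Rightarrow> (('w, 'e) elt \<Rightarrow> ('w, 'e) elt) \<Rightarrow> (('w, 'e) elt \<Rightarrow> ('w, 'e) elt) \<Rightarrow> ('w, 'e) elt \<Rightarrow> ('w, 'e) elt" where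
  "cov N \<pi> \<sigma> = lift (Om2 N) (\<lambda>w m. wedge1 N w (\<sigma> m) \<ominus>\<^bsub>Om2 N\<^esub> om2 N (der w) (\<pi> m))"

lemma derivation_J1: "lmod N \<Longrightarrow> derivation (jet1 N) N (proj1 N) (jet1_form N)"
  by (simp add: derivation_def proj1_linear jet1_form_additive J1_smult)

text \<open>The general wedge lands in degree \<open>1 + 1\<close>; here this is normalised to
  \<open>2\<close> so that it matches \<open>Om2\<close>.\<close>

lemmas wedge11_om = wedge_om[where k = 1 and l = 1, simplified]
lemmas wedge11_closed = wedge_closed[where k = 1 and l = 1, simplified]
lemmas wedge11_add_l = wedge_add_l[where k = 1 and l = 1, simplified]
lemmas wedge11_add_r = wedge_add_r[where k = 1 and l = 1, simplified]
lemmas wedge11_smult_l = wedge_smult_l[where k = 1 and l = 1, simplified]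
lemmas wedge11_smult_r = wedge_smult_r[where k = 1 and l = 1, simplified]
lemmas wedge11_additive = wedge_additive[where k = 1 and l = 1, simplified]
lemmas Om_map_wedge11 = Om_map_wedge[where k = 1 and l = 1, simplified]

lemma derivationD:
  assumes "derivation M N \<pi> \<sigma>"
  shows "lin M N \<pi>" "additive M (Om1 N) \<sigma>"
    "m \<in> carrier M \<Longrightarrow> \<pi> m \<in> carrier N" "m \<in> carrier M \<Longrightarrow> \<sigma> m \<in> carrier (Om1 N)"
    "m \<in> carrier M \<Longrightarrow> m' \<in> carrier M \<Longrightarrow> \<pi> (m \<oplus>\<^bsub>M\<^esub> m') = \<pi> m \<oplus>\<^bsub>N\<^esub> \<pi> m'"
    "m \<in> carrier M \<Longrightarrow> m' \<in> carrier M \<Longrightarrow> \<sigma> (m \<oplus>\<^bsub>M\<^esub> m') = \<sigma> m \<oplus>\<^bsub>Om1 N\<^esub> \<sigma> m'"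
    "a \<in> gr 0 \<Longrightarrow> m \<in> carrier M \<Longrightarrow> \<pi> (a \<odot>\<^bsub>M\<^esub> m) = a \<odot>\<^bsub>N\<^esub> \<pi> m"
    "a \<in> gr 0 \<Longrightarrow> m \<in> carrier M \<Longrightarrow>
      \<sigma> (a \<odot>\<^bsub>M\<^esub> m) = om1 N (der a) (\<pi> m) \<oplus>\<^bsub>Om1 N\<^esub> a \<odot>\<^bsub>Om1 N\<^esub> \<sigma> m"
  using assms by (auto simp: derivation_def linear_map_def additive_def)

text \<open>Moving \<open>r\<close> across the tensor sign makes \<open>\<sigma> (r m)\<close>
  contribute \<open>x dr \<otimes> \<pi> m\<close>. The same term comes out of
  \<open>d(xr) = dx r - x dr\<close> on the other side.\<close>

lemma cov_balanced:
  assumes N: "lmod N" and d: "derivation M N \<pi> \<sigma>" and M: "lmod M"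
  shows "Om_balanced_map 1 M (Om2 N) (\<lambda>w m. wedge1 N w (\<sigma> m) \<ominus>\<^bsub>Om2 N\<^esub> om2 N (der w) (\<pi> m))"
proof -
  interpret G: abelian_group "Om2 N" by (rule Om_group[OF N])
  note dd = derivationD[OF d]
  note s = dd(3-) wedge11_closed[OF N] om_closed[OF N] grade_intros lmod_smult[OF N]
    lmod_smult[OF Om_module[OF N]] lmod_smult[OF M]
  show ?thesis
  proof (rule Om_balanced_mapI)
    fix x r m assume x: "x \<in> gr 1" and r: "r \<in> gr 0" and m: "m \<in> carrier M"
    let ?X = "wedge1 N (x \<otimes> r) (\<sigma> m)" and ?Y = "om2 N (der x \<otimes> r) (\<pi> m)"
      and ?Z = "om2 N (x \<otimes> der r) (\<pi> m)"
    have c: "?X \<in> carrier (Om2 N)" "?Y \<in> carrier (Om2 N)" "?Z \<in> carrier (Om2 N)"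
      using x r m by (simp_all add: s)
    have "om2 N (der (x \<otimes> r)) (\<pi> m) = ?Y \<ominus>\<^bsub>Om2 N\<^esub> ?Z"
      using x r m by (simp add: leibniz_1 grade_carrier[of r 0] om_minus_l[OF N] s)
    moreover have "wedge1 N x (\<sigma> (r \<odot>\<^bsub>M\<^esub> m)) = ?Z \<oplus>\<^bsub>Om2 N\<^esub> ?X"
      using x r m by (simp add: s wedge11_add_r[OF N] wedge11_om[OF N] wedge11_smult_r[OF N])
    moreover have "om2 N (der x) (\<pi> (r \<odot>\<^bsub>M\<^esub> m)) = ?Y"
      using x r m by (simp add: s om_balanced[OF N])
    moreover have "?X \<ominus>\<^bsub>Om2 N\<^esub> (?Y \<ominus>\<^bsub>Om2 N\<^esub> ?Z) = (?Z \<oplus>\<^bsub>Om2 N\<^esub> ?X) \<ominus>\<^bsub>Om2 N\<^esub> ?Y"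
      using c by (simp add: a_minus_def G.minus_add G.a_ac)
    ultimately show "?X \<ominus>\<^bsub>Om2 N\<^esub> om2 N (der (x \<otimes> r)) (\<pi> m) =
      wedge1 N x (\<sigma> (r \<odot>\<^bsub>M\<^esub> m)) \<ominus>\<^bsub>Om2 N\<^esub> om2 N (der x) (\<pi> (r \<odot>\<^bsub>M\<^esub> m))" by simp
  qed (simp_all add: s wedge11_add_l[OF N] wedge11_add_r[OF N] om_add_l[OF N] om_add_r[OF N]
      diff_add[OF grade_carrier grade_carrier] a_minus_def G.minus_add G.a_ac)
qed

lemma cov_additive:
  assumes "lmod M" "lmod N" "derivation M N \<pi> \<sigma>"
  shows "additive (Om1 M) (Om2 N) (cov N \<pi> \<sigma>)"
  unfolding cov_def by (rule Om_lift_additive[OF assms(1) Om_group[OF assms(2)] cov_balanced[OF assms(2,3,1)]])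

lemma cov_om:
  assumes "lmod M" "lmod N" "derivation M N \<pi> \<sigma>" "w \<in> gr 1" "m \<in> carrier M"
  shows "cov N \<pi> \<sigma> (om1 M w m) = wedge1 N w (\<sigma> m) \<ominus>\<^bsub>Om2 N\<^esub> om2 N (der w) (\<pi> m)"
  unfolding cov_def
  by (rule Om_lift_om[OF assms(1) Om_group[OF assms(2)] cov_balanced[OF assms(2,3,1)] assms(4,5)])

text \<open>The second summand contains \<open>dda = 0\<close>. As forms of 1-jets are sums of such
  \<open>da \<otimes> m\<close>, this is the shape in which \<open>D_II\<close> meets
  \<open>cov\<close>.\<close>

lemma cov_om_diff:
  assumes M: "lmod M" and N: "lmod N" and d: "derivation M N \<pi> \<sigma>" and a: "a \<in> gr 0" and m: "m \<in> carrier M"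
  shows "cov N \<pi> \<sigma> (om1 M (der a) m) = wedge1 N (der a) (\<sigma> m)"
proof -
  interpret G: abelian_group "Om2 N" by (rule Om_group[OF N])
  have "\<ominus>\<^bsub>Om2 N\<^esub> \<zero>\<^bsub>Om2 N\<^esub> = \<zero>\<^bsub>Om2 N\<^esub>" by (rule G.minus_equality) simp_all
  then show ?thesis using a m
    by (simp add: cov_om[OF M N d] grade_intros diff_diff[OF grade_carrier] derivationD[OF d] om_zero_l[OF N]
        a_minus_def wedge11_closed[OF N])
qed

text \<open>Measures the failure of linearity, which stems from \<open>d(aw) = da w + a dw\<close>
  in the second summand of \<open>cov\<close>.\<close>

lemma cov_smult:
  assumes M: "lmod M" and N: "lmod N" and d: "derivation M N \<pi> \<sigma>" and a: "a \<in> gr 0"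
    and t: "t \<in> carrier (Om1 M)"
  shows "cov N \<pi> \<sigma> (a \<odot>\<^bsub>Om1 M\<^esub> t) =
    a \<odot>\<^bsub>Om2 N\<^esub> cov N \<pi> \<sigma> t \<ominus>\<^bsub>Om2 N\<^esub> wedge1 N (der a) (Om1_map N \<pi> t)"
proof -
  interpret G: abelian_group "Om2 N" by (rule Om_group[OF N])
  note dd = derivationD[OF d] and K = cov_additive[OF M N d]
  note s = dd(3-) wedge11_closed[OF N] om_closed[OF N] grade_intros lmod_smult[OF N]
    lmod_smult[OF Om_module[OF N]] lmod_smult[OF M]
  show ?thesis
  proof (rule Om_ext[OF M G.abelian_group_axioms additive_comp[OF additive_smult_Om[OF M a] K]
        additive_diff[OF G.abelian_group_axioms additive_comp[OF K additive_smult_Om[OF N a]]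
        additive_comp[OF Om_map_additive[OF M N dd(1)] wedge11_additive[OF N diff_grade_0[OF a]]]] _ t])
    fix w m assume w: "w \<in> gr 1" and m: "m \<in> carrier M"
    let ?X = "a \<odot>\<^bsub>Om2 N\<^esub> wedge1 N w (\<sigma> m)" and ?Y = "om2 N (der a \<otimes> w) (\<pi> m)"
      and ?Z = "om2 N (a \<otimes> der w) (\<pi> m)"
    have c: "?X \<in> carrier (Om2 N)" "?Y \<in> carrier (Om2 N)" "?Z \<in> carrier (Om2 N)"
      using w a m by (simp_all add: s)
    have "cov N \<pi> \<sigma> (a \<odot>\<^bsub>Om1 M\<^esub> om1 M w m) = ?X \<ominus>\<^bsub>Om2 N\<^esub> (?Y \<oplus>\<^bsub>Om2 N\<^esub> ?Z)"
      using a w m by (simp add: smult_om[OF M] cov_om[OF M N d] s leibniz_0 grade_carrier[of w 1] om_add_l[OF N]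
          wedge11_smult_l[OF N])
    moreover have "a \<odot>\<^bsub>Om2 N\<^esub> cov N \<pi> \<sigma> (om1 M w m) = ?X \<ominus>\<^bsub>Om2 N\<^esub> ?Z"
      using a w m by (simp add: cov_om[OF M N d] s smult_om[OF N]
          additive_minus[OF G.abelian_group_axioms G.abelian_group_axioms additive_smult_Om[OF N a]])
    moreover have "wedge1 N (der a) (Om1_map N \<pi> (om1 M w m)) = ?Y"
      using a w m by (simp add: Om_map_om[OF M N dd(1)] wedge11_om[OF N] s)
    moreover have "?X \<ominus>\<^bsub>Om2 N\<^esub> (?Y \<oplus>\<^bsub>Om2 N\<^esub> ?Z) = ?X \<ominus>\<^bsub>Om2 N\<^esub> ?Z \<ominus>\<^bsub>Om2 N\<^esub> ?Y"
      using c by (simp add: a_minus_def G.minus_add G.a_ac)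
    ultimately show "cov N \<pi> \<sigma> (a \<odot>\<^bsub>Om1 M\<^esub> om1 M w m) =
      a \<odot>\<^bsub>Om2 N\<^esub> cov N \<pi> \<sigma> (om1 M w m) \<ominus>\<^bsub>Om2 N\<^esub>
        wedge1 N (der a) (Om1_map N \<pi> (om1 M w m))" by simp
  qed
qed

lemma cov_cong:
  assumes "lmod M" "t \<in> carrier (Om1 M)"
    "\<And>m. m \<in> carrier M \<Longrightarrow> \<pi> m = \<pi>' m" "\<And>m. m \<in> carrier M \<Longrightarrow> \<sigma> m = \<sigma>' m"
  shows "cov N \<pi> \<sigma> t = cov N \<pi>' \<sigma>' t"
  unfolding cov_def by (rule lift_cong) (use Om_terms[OF assms(1,2)] assms(3,4) in auto)

lemma derivation_comp:
  assumes "lin M M' f" "derivation M' N \<pi> \<sigma>"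
  shows "derivation M N (\<lambda>m. \<pi> (f m)) (\<lambda>m. \<sigma> (f m))"
  unfolding derivation_def
  using linear_map_comp[OF assms(1) derivationD(1)[OF assms(2)]]
    additive_comp[OF linear_map_additive[OF assms(1)] derivationD(2)[OF assms(2)]]
  by (simp add: linear_map_smult[OF assms(1)] linear_map_closed[OF assms(1)] derivationD(8)[OF assms(2)])

lemma cov_Om_map:
  assumes M: "lmod M" and M': "lmod M'" and N: "lmod N" and f: "lin M M' f"
    and d: "derivation M' N \<pi> \<sigma>" and t: "t \<in> carrier (Om1 M)"
  shows "cov N \<pi> \<sigma> (Om1_map M' f t) = cov N (\<lambda>m. \<pi> (f m)) (\<lambda>m. \<sigma> (f m)) t"
  by (rule Om_ext[OF M Om_group[OF N] additive_comp[OF Om_map_additive[OF M M' f] cov_additive[OF M' N d]]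
        cov_additive[OF M N derivation_comp[OF f d]] _ t])
    (simp add: Om_map_om[OF M M' f] cov_om[OF M' N d] cov_om[OF M N derivation_comp[OF f d]] linear_map_closed[OF f])

lemma derivation_Om_map:
  assumes N: "lmod N" and N': "lmod N'" and g: "lin N N' g" and d: "derivation M N \<pi> \<sigma>"
  shows "derivation M N' (\<lambda>m. g (\<pi> m)) (\<lambda>m. Om1_map N' g (\<sigma> m))"
proof -
  note G = Om_map_linear[OF N N' g, of 1] and dd = derivationD[OF d]
  show ?thesis
    unfolding derivation_def
    using linear_map_comp[OF dd(1) g] additive_comp[OF dd(2) linear_map_additive[OF G]]
    by (simp add: dd additive_add[OF linear_map_additive[OF G]] om_closed[OF N] grade_intros
        linear_map_smult[OF G] lmod_smult[OF Om_module[OF N]] Om_map_om[OF N N' g])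
qed

text \<open>Naturality in the target. With \<open>g\<close> a jet projection and
  \<open>\<sigma>\<close> a connection, it relates the projected curvature to the second holonomy
  condition.\<close>

lemma Om_map_cov:
  assumes M: "lmod M" and N: "lmod N" and N': "lmod N'" and g: "lin N N' g"
    and d: "derivation M N \<pi> \<sigma>" and t: "t \<in> carrier (Om1 M)"
  shows "Om2_map N' g (cov N \<pi> \<sigma> t) = cov N' (\<lambda>m. g (\<pi> m)) (\<lambda>m. Om1_map N' g (\<sigma> m)) t"
proof -
  note d' = derivation_Om_map[OF N N' g d] and dd = derivationD[OF d]
  note G = Om_map_additive[OF N N' g, of 2]
  show ?thesis
    by (rule Om_ext[OF M Om_group[OF N'] additive_comp[OF cov_additive[OF M N d] G] cov_additive[OF M N' d'] _ t])
      (simp add: cov_om[OF M N d] cov_om[OF M N' d'] additive_minus[OF Om_group[OF N] Om_group[OF N'] G]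
        wedge11_closed[OF N] om_closed[OF N] dd grade_intros Om_map_wedge11[OF N N' g] Om_map_om[OF N N' g])
qed


section \<open>Holonomic jets\<close>

text \<open>For \<open>x\<close> represented by terms \<open>a_i \<otimes> y_i\<close>, applying
  \<open>\<sigma>\<close> to the sum of the \<open>a_i y_i\<close> gives the terms
  \<open>a_i \<sigma> y_i\<close>, which make up \<open>D_I\<close>, and the terms
  \<open>da_i \<otimes> \<pi> y_i\<close>, which make up \<open>\<Omega>\<^sup>1(\<pi>)\<close> of
  the form of \<open>x\<close>. So \<open>D_I\<close> is the difference of the two sides.\<close>

lemma D_I_eq:
  assumes E: "lmod E" and x: "x \<in> carrier (jet1 (jet1 E))"
  shows "D_I \<Omega> E x = \<zero>\<^bsub>Om1 E\<^esub> \<longleftrightarrow>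
    Om1_map E (proj1 E) (jet1_form (jet1 E) x) = jet1_form E (proj1 (jet1 E) x)"
proof -
  interpret O: abelian_group "Om1 E" by (rule Om_group[OF E])
  note J = J1_module[OF E] and p = proj1_linear[OF E]
  note tm = J1_terms[OF J x]
  let ?s = "\<lambda>a y. a \<odot>\<^bsub>Om1 E\<^esub> jet1_form E y"
  let ?t = "\<lambda>a y. om1 E (der a) (proj1 E y)"
  have sc: "?s a y \<in> carrier (Om1 E)" "?t a y \<in> carrier (Om1 E)" if "(a, y) \<in> set (terms x)" for a y
    using tm[OF that]
    by (simp_all add: lmod_smult[OF Om_module[OF E]] jet1_form_closed[OF E] om_closed[OF E] proj1_closed[OF E] grade_intros)
  have inner: "lift (Om1 E) (\<lambda>c e. om1 E (a \<otimes> der c) e) y = ?s a y"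
    if "(a, y) \<in> set (terms x)" for a y
  proof -
    have a: "a \<in> gr 0" and y: "y \<in> carrier (jet1 E)" using tm[OF that] by auto
    have "?s a y = lift (Om1 E) (\<lambda>c e. a \<odot>\<^bsub>Om1 E\<^esub> om1 E (der c) e) y"
      unfolding jet1_form_def
      by (rule additive_of_lift[OF O.abelian_group_axioms O.abelian_group_axioms additive_smult_Om[OF E a]])
        (use J1_terms[OF E y] in \<open>auto simp: om_closed[OF E] grade_intros\<close>)
    also have "\<dots> = lift (Om1 E) (\<lambda>c e. om1 E (a \<otimes> der c) e) y"
      by (rule lift_cong) (use J1_terms[OF E y] a in \<open>auto simp: smult_om[OF E] grade_intros\<close>)
    finally show ?thesis by simp
  qed
  have D: "D_I \<Omega> E x = lift (Om1 E) ?s x"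
    unfolding D_I_def by (rule lift_cong) (rule inner)
  have Dc: "D_I \<Omega> E x \<in> carrier (Om1 E)"
    unfolding D by (rule lift_closed[OF O.abelian_group_axioms]) (rule sc)
  have "jet1_form E (proj1 (jet1 E) x) = lift (Om1 E) (\<lambda>a y. jet1_form E (a \<odot>\<^bsub>jet1 E\<^esub> y)) x"
    unfolding proj1_def[of "jet1 E"]
    by (rule additive_of_lift[OF J1_group[OF E] O.abelian_group_axioms jet1_form_additive[OF E]])
      (use tm in \<open>auto simp: J1_smult[OF E]\<close>)
  also have "\<dots> = lift (Om1 E) (\<lambda>a y. ?s a y \<oplus>\<^bsub>Om1 E\<^esub> ?t a y) x"
    by (rule lift_cong) (use tm sc in \<open>auto simp: J1_smult[OF E] O.a_comm\<close>)
  also have "\<dots> = D_I \<Omega> E x \<oplus>\<^bsub>Om1 E\<^esub> lift (Om1 E) ?t x"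
    unfolding D by (rule lift_add[OF O.abelian_group_axioms]) (use sc in auto)
  also have "lift (Om1 E) ?t x = Om1_map E (proj1 E) (jet1_form (jet1 E) x)"
  proof -
    have "Om1_map E (proj1 E) (jet1_form (jet1 E) x) =
      lift (Om1 E) (\<lambda>a y. Om1_map E (proj1 E) (om1 (jet1 E) (der a) y)) x"
      unfolding jet1_form_def[of "jet1 E"]
      by (rule additive_of_lift[OF Om_group[OF J] O.abelian_group_axioms Om_map_additive[OF J E p]])
        (use tm in \<open>auto simp: om_closed[OF J] grade_intros\<close>)
    also have "\<dots> = lift (Om1 E) ?t x"
      by (rule lift_cong) (use tm in \<open>auto simp: Om_map_om[OF J E p] grade_intros\<close>)
    finally show ?thesis by simp
  qed
  finally have *: "jet1_form E (proj1 (jet1 E) x) =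
    D_I \<Omega> E x \<oplus>\<^bsub>Om1 E\<^esub> Om1_map E (proj1 E) (jet1_form (jet1 E) x)" .
  have "Om1_map E (proj1 E) (jet1_form (jet1 E) x) \<in> carrier (Om1 E)"
    by (rule additive_closed[OF Om_map_additive[OF J E p] jet1_form_closed[OF J x]])
  then show ?thesis unfolding * using Dc by (metis O.add.r_cancel_one O.a_comm)
qed

text \<open>Termwise \<open>cov_om_diff\<close>: each term \<open>da \<otimes> y\<close> of the form
  of \<open>x\<close> contributes \<open>da \<and> \<sigma> y\<close>.\<close>

lemma D_II_eq:
  assumes E: "lmod E" and x: "x \<in> carrier (jet1 (jet1 E))"
  shows "D_II \<Omega> E x = cov E (proj1 E) (jet1_form E) (jet1_form (jet1 E) x)"
proof -
  note O1 = Om_group[OF E, of 1] and O2 = Om_group[OF E, of 2]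
  note J = J1_module[OF E] and d = derivation_J1[OF E]
  note tm = J1_terms[OF J x]
  have inner: "lift (Om2 E) (\<lambda>c e. om2 E (der a \<otimes> der c) e) y = wedge1 E (der a) (jet1_form E y)"
    if "(a, y) \<in> set (terms x)" for a y
  proof -
    have a: "a \<in> gr 0" and y: "y \<in> carrier (jet1 E)" using tm[OF that] by auto
    have "wedge1 E (der a) (jet1_form E y) =
      lift (Om2 E) (\<lambda>c e. wedge1 E (der a) (om1 E (der c) e)) y"
      unfolding jet1_form_def
      by (rule additive_of_lift[OF O1 O2 wedge11_additive[OF E diff_grade_0[OF a]]])
        (use J1_terms[OF E y] in \<open>auto simp: om_closed[OF E] grade_intros\<close>)
    also have "\<dots> = lift (Om2 E) (\<lambda>c e. om2 E (der a \<otimes> der c) e) y"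
      by (rule lift_cong) (use J1_terms[OF E y] a in \<open>auto simp: wedge11_om[OF E] grade_intros\<close>)
    finally show ?thesis by simp
  qed
  have "cov E (proj1 E) (jet1_form E) (jet1_form (jet1 E) x) =
    lift (Om2 E) (\<lambda>a y. cov E (proj1 E) (jet1_form E) (om1 (jet1 E) (der a) y)) x"
    unfolding jet1_form_def[of "jet1 E"]
    by (rule additive_of_lift[OF Om_group[OF J] O2 cov_additive[OF J E d]])
      (use tm in \<open>auto simp: om_closed[OF J] grade_intros\<close>)
  also have "\<dots> = D_II \<Omega> E x"
    unfolding D_II_def by (rule lift_cong) (use tm in \<open>auto simp: cov_om_diff[OF J E d] inner\<close>)
  finally show ?thesis by simp
qed

text \<open>Uniform over the special equation for order one and the recursive one: in either case
  the operations are those of \<open>jet1 (jets n E)\<close>, and only the carrier may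
  shrink.\<close>

lemma Jet_Suc:
  "jets (Suc n) E = (jet1 (jets n E))\<lparr>carrier := carrier (jets (Suc n) E)\<rparr>"
  "carrier (jets (Suc n) E) \<subseteq> carrier (jet1 (jets n E))"
  by (cases n; auto)+

lemma Jet_Suc_simps:
  "\<zero>\<^bsub>jets (Suc n) E\<^esub> = \<zero>\<^bsub>jet1 (jets n E)\<^esub>"
  "x \<oplus>\<^bsub>jets (Suc n) E\<^esub> y = x \<oplus>\<^bsub>jet1 (jets n E)\<^esub> y"
  "a \<odot>\<^bsub>jets (Suc n) E\<^esub> x = a \<odot>\<^bsub>jet1 (jets n E)\<^esub> x"
  by (subst Jet_Suc; simp)+

lemma linear_jet_incl: "lin (jets (Suc n) E) (jet1 (jets n E)) (jet_incl (Suc n) E)"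
  using Jet_Suc(2)[of n E] by (auto simp: linear_map_def additive_def jet_incl_def Jet_Suc_simps)

lemma derivation_Jet:
  assumes "lmod (jets n E)"
  shows "derivation (jets (Suc n) E) (jets n E) (proj1 (jets n E)) (jet1_form (jets n E))"
  using derivation_comp[OF linear_jet_incl derivation_J1[OF assms]] by (simp add: jet_incl_def)

text \<open>Although \<open>jet_incl\<close> fixes elements, \<open>J1_map\<close> along it forms
  classes anew over the larger module and need not be the identity. Naturality of both components
  and of \<open>cov\<close> removes it from the two conditions.\<close>

lemma Jet_Suc_Suc_iff:
  assumes N: "lmod (jets n E)" and M: "lmod (jets (Suc n) E)"
  shows "x \<in> carrier (jets (Suc (Suc n)) E) \<longleftrightarrow> x \<in> carrier (jet1 (jets (Suc n) E)) \<and>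
    Om1_map (jets n E) (proj1 (jets n E)) (jet1_form (jets (Suc n) E) x) =
      jet1_form (jets n E) (proj1 (jets (Suc n) E) x) \<and>
    cov (jets n E) (proj1 (jets n E)) (jet1_form (jets n E)) (jet1_form (jets (Suc n) E) x) =
      \<zero>\<^bsub>Om2 (jets n E)\<^esub>"
proof (cases "x \<in> carrier (jet1 (jets (Suc n) E))")
  case True
  let ?N = "jets n E" and ?M = "jets (Suc n) E"
  let ?y = "J1_map \<Omega> (jet1 ?N) (jet_incl (Suc n) E) x"
  note J = J1_module[OF N]
  note y = J1_map[OF M J linear_jet_incl True]
  note t = jet1_form_closed[OF M True]
  have 1: "proj1 (jet1 ?N) ?y = proj1 ?M x" using y(2) by (simp add: jet_incl_def)
  have 2: "Om1_map ?N (proj1 ?N) (jet1_form (jet1 ?N) ?y) = Om1_map ?N (proj1 ?N) (jet1_form ?M x)"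
    unfolding y(3) Om_map_comp[OF M J N linear_jet_incl proj1_linear[OF N] t]
    by (simp add: jet_incl_def)
  have 3: "cov ?N (proj1 ?N) (jet1_form ?N) (jet1_form (jet1 ?N) ?y) =
    cov ?N (proj1 ?N) (jet1_form ?N) (jet1_form ?M x)"
    unfolding y(3) cov_Om_map[OF M J N linear_jet_incl derivation_J1[OF N] t]
    by (simp add: jet_incl_def)
  show ?thesis
    using True D_I_eq[OF N y(1)] D_II_eq[OF N y(1)] by (simp add: 1 2 3)
qed simp

text \<open>The only delicate point is closure under scalars. The form of \<open>a x\<close> is
  \<open>da \<otimes> \<pi> x + a t\<close>, with \<open>t\<close> the form of \<open>x\<close>.
  Under \<open>cov\<close> the first summand gives \<open>da \<and> \<sigma> (\<pi> x)\<close> and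
  the second \<open>- da \<and> \<Omega>\<^sup>1(\<pi>) t\<close>; by the first condition on
  \<open>x\<close> they cancel.\<close>

lemma Jet_Suc_Suc_module:
  assumes N: "lmod (jets n E)" and M: "lmod (jets (Suc n) E)"
  shows "lmod (jets (Suc (Suc n)) E)"
proof -
  let ?N = "jets n E" and ?M = "jets (Suc n) E"
  interpret O1: abelian_group "Om1 ?N" by (rule Om_group[OF N])
  interpret O2: abelian_group "Om2 ?N" by (rule Om_group[OF N])
  note d = derivation_Jet[OF N] and iff = Jet_Suc_Suc_iff[OF N M]
  note dd = derivationD[OF d]
  note F = Om_map_additive[OF M N dd(1), of 1] and K = cov_additive[OF M N d]
  note c = jet1_form_closed[OF M] proj1_closed[OF M]
  have Jet_eq: "jets (Suc (Suc n)) E = (jet1 ?M)\<lparr>carrier := carrier (jets (Suc (Suc n)) E)\<rparr>" (is "_ = _\<lparr>carrier := ?S\<rparr>")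
    by (rule Jet_Suc)
  have "lmod ((jet1 ?M)\<lparr>carrier := ?S\<rparr>)"
  proof (rule left_module_submodule[OF J1_module[OF M]])
    show "?S \<subseteq> carrier (jet1 ?M)" using iff by auto
    have z: "jet1_form ?N \<zero>\<^bsub>?M\<^esub> = \<zero>\<^bsub>Om1 ?N\<^esub>"
      by (rule additive_zero[OF left_module_group[OF M] O1.abelian_group_axioms dd(2)])
    show "\<zero>\<^bsub>jet1 ?M\<^esub> \<in> ?S"
      unfolding iff
      by (simp only: J1_zero[OF M] additive_zero[OF Om_group[OF M] O1.abelian_group_axioms F]
          additive_zero[OF Om_group[OF M] O2.abelian_group_axioms K] z simp_thms)
  next
    fix x y assume "x \<in> ?S" "y \<in> ?S"
    then show "x \<oplus>\<^bsub>jet1 ?M\<^esub> y \<in> ?S"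
      unfolding iff
      by (auto simp: J1_add[OF M] additive_add[OF F] additive_add[OF K] c dd(6) simp del: Jet.simps)
  next
    fix a x assume "a \<in> carrier (coeffs \<Omega>)" and x: "x \<in> ?S"
    then have a: "a \<in> gr 0" by simp
    let ?t = "jet1_form ?M x" and ?p = "proj1 ?M x"
    have xJ: "x \<in> carrier (jet1 ?M)" and x1: "Om1_map ?N (proj1 ?N) ?t = jet1_form ?N ?p"
      and x2: "cov ?N (proj1 ?N) (jet1_form ?N) ?t = \<zero>\<^bsub>Om2 ?N\<^esub>" using x unfolding iff by auto
    have t: "?t \<in> carrier (Om1 ?M)" and p: "?p \<in> carrier ?M" using xJ c by auto
    have at: "a \<odot>\<^bsub>Om1 ?M\<^esub> ?t \<in> carrier (Om1 ?M)" "om1 ?M (der a) ?p \<in> carrier (Om1 ?M)"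
      using a t p by (simp_all add: lmod_smult[OF Om_module[OF M]] om_closed[OF M] grade_intros del: Jet.simps)
    have *: "Om1_map ?N (proj1 ?N) (om1 ?M (der a) ?p \<oplus>\<^bsub>Om1 ?M\<^esub> a \<odot>\<^bsub>Om1 ?M\<^esub> ?t) =
       jet1_form ?N (a \<odot>\<^bsub>?M\<^esub> ?p)"
      using a p t by (simp add: additive_add[OF F] at Om_map_om[OF M N dd(1)] dd(8) grade_intros
          linear_map_smult[OF Om_map_linear[OF M N dd(1)]] x1 del: Jet.simps)
    have w: "wedge1 ?N (der a) (jet1_form ?N ?p) \<in> carrier (Om2 ?N)"
      using a p by (simp add: wedge11_closed[OF N] dd(4) grade_intros del: Jet.simps)
    have "cov ?N (proj1 ?N) (jet1_form ?N) (om1 ?M (der a) ?p \<oplus>\<^bsub>Om1 ?M\<^esub> a \<odot>\<^bsub>Om1 ?M\<^esub> ?t) =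
       wedge1 ?N (der a) (jet1_form ?N ?p) \<oplus>\<^bsub>Om2 ?N\<^esub>
         (a \<odot>\<^bsub>Om2 ?N\<^esub> \<zero>\<^bsub>Om2 ?N\<^esub> \<ominus>\<^bsub>Om2 ?N\<^esub> wedge1 ?N (der a) (jet1_form ?N ?p))"
      using a p t by (simp add: additive_add[OF K] at cov_om_diff[OF M N d] cov_smult[OF M N d] x1 x2 del: Jet.simps)
    also have "\<dots> = \<zero>\<^bsub>Om2 ?N\<^esub>"
      using w additive_zero[OF O2.abelian_group_axioms O2.abelian_group_axioms additive_smult_Om[OF N a]]
      by (simp add: a_minus_def O2.r_neg del: Jet.simps)
    finally show "a \<odot>\<^bsub>jet1 ?M\<^esub> x \<in> ?S"
      unfolding iff using a xJ * by (simp add: J1_smult[OF M] del: Jet.simps)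
  qed
  then show ?thesis by (subst Jet_eq)
qed

lemma Jet_module:
  assumes E: "lmod E"
  shows "lmod (jets n E)"
proof -
  \<comment> \<open>Two consecutive orders are carried along, because the holonomy conditions refer
    two levels back.\<close>
  have "lmod (jets n E) \<and> lmod (jets (Suc n) E)"
  proof (induction n)
    case 0
    show ?case using E J1_module[OF E] by simp
  next
    case (Suc n)
    then show ?case using Jet_Suc_Suc_module by blast
  qed
  then show ?thesis by simp
qed


section \<open>Symmetric forms\<close>

lemma wedge2_balanced:
  assumes "lmod M"
  shows "Om_balanced_map 1 (Om1 M) (Om2 M) (wedge1 M)"
  by (rule Om_balanced_mapI)
    (simp_all add: wedge11_closed[OF assms] wedge11_add_l[OF assms] wedge11_add_r[OF assms] wedge11_smult_r[OF assms])

lemma wedge2_linear: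
  assumes M: "lmod M"
  shows "lin (Om1 (Om1 M)) (Om2 M) (lift (Om2 M) (wedge1 M))"
    (is "linear_map _ _ _ ?V")
proof -
  note OM = Om_module[OF M, of 1] and O2 = Om_group[OF M, of 2]
  note V = Om_lift_additive[OF OM O2 wedge2_balanced[OF M]] and V_om = Om_lift_om[OF OM O2 wedge2_balanced[OF M]]
  have "?V (a \<odot>\<^bsub>Om1 (Om1 M)\<^esub> t) = a \<odot>\<^bsub>Om2 M\<^esub> ?V t"
    if a: "a \<in> gr 0" and t: "t \<in> carrier (Om1 (Om1 M))" for a t
    by (rule Om_ext[OF OM O2 additive_comp[OF additive_smult_Om[OF OM a] V] additive_comp[OF V additive_smult_Om[OF M a]] _ t])
      (use a in \<open>simp add: V_om smult_om[OF OM] wedge11_smult_l[OF M] grade_intros\<close>)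
  then show ?thesis using V by (simp add: linear_map_def)
qed

lemma wedge2_om:
  assumes "lmod M" "w \<in> gr 1" "t \<in> carrier (Om1 M)"
  shows "lift (Om2 M) (wedge1 M) (om1 (Om1 M) w t) = wedge1 M w t"
  by (rule Om_lift_om[OF Om_module[OF assms(1)] Om_group[OF assms(1)] wedge2_balanced[OF assms(1)] assms(2,3)])

lemma Sym_Suc:
  "syms (Suc n) E = (Om1 (syms n E))\<lparr>carrier := carrier (syms (Suc n) E)\<rparr>"
  "carrier (syms (Suc n) E) \<subseteq> carrier (Om1 (syms n E))"
  by (cases n; auto)+

lemma Sym_Suc_simps:
  "\<zero>\<^bsub>syms (Suc n) E\<^esub> = \<zero>\<^bsub>Om1 (syms n E)\<^esub>"
  "x \<oplus>\<^bsub>syms (Suc n) E\<^esub> y = x \<oplus>\<^bsub>Om1 (syms n E)\<^esub> y"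
  "a \<odot>\<^bsub>syms (Suc n) E\<^esub> x = a \<odot>\<^bsub>Om1 (syms n E)\<^esub> x"
  by (subst Sym_Suc; simp)+

lemma linear_sym_incl: "lin (syms (Suc n) E) (Om1 (syms n E)) (sym_incl (Suc n) E)"
  using Sym_Suc(2)[of n E] by (auto simp: linear_map_def additive_def sym_incl_def Sym_Suc_simps)

lemma Sym_Suc_Suc_iff:
  "x \<in> carrier (syms (Suc (Suc n)) E) \<longleftrightarrow> x \<in> carrier (Om1 (syms (Suc n) E)) \<and>
    lift (Om2 (syms n E)) (wedge1 (syms n E))
      (Om1_map (Om1 (syms n E)) (sym_incl (Suc n) E) x) = \<zero>\<^bsub>Om2 (syms n E)\<^esub>"
  by simp

lemma Sym_Suc_Suc_module:
  assumes N: "lmod (syms n E)" and M: "lmod (syms (Suc n) E)"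
  shows "lmod (syms (Suc (Suc n)) E)"
proof -
  let ?N = "syms n E" and ?M = "syms (Suc n) E"
  note ON = Om_module[OF N, of 1]
  define F where "F = (\<lambda>x. lift (Om2 ?N) (wedge1 ?N) (Om1_map (Om1 ?N) (sym_incl (Suc n) E) x))"
  have F: "lin (Om1 ?M) (Om2 ?N) F"
    unfolding F_def by (rule linear_map_comp[OF Om_map_linear[OF M ON linear_sym_incl] wedge2_linear[OF N]])
  have iff: "x \<in> carrier (syms (Suc (Suc n)) E) \<longleftrightarrow> x \<in> carrier (Om1 ?M) \<and> F x = \<zero>\<^bsub>Om2 ?N\<^esub>" for x
    unfolding F_def by (rule Sym_Suc_Suc_iff)
  interpret O2: abelian_group "Om2 ?N" by (rule Om_group[OF N])
  have "lmod ((Om1 ?M)\<lparr>carrier := carrier (syms (Suc (Suc n)) E)\<rparr>)"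
    by (rule left_module_submodule[OF Om_module[OF M]])
      (auto simp: iff additive_zero[OF Om_group[OF M] O2.abelian_group_axioms linear_map_additive[OF F]]
        lmod_intros[OF Om_module[OF M]] additive_add[OF linear_map_additive[OF F]] linear_map_smult[OF F]
        additive_zero[OF O2.abelian_group_axioms O2.abelian_group_axioms additive_smult_Om[OF N]]
        simp del: Sym.simps)
  then show ?thesis by (subst Sym_Suc)
qed

lemma Sym_module:
  assumes E: "lmod E"
  shows "lmod (syms n E)"
proof -
  have "lmod (syms n E) \<and> lmod (syms (Suc n) E)"
  proof (induction n)
    case 0
    show ?case using E Om_module[OF E] by simp
  next
    case (Suc n)
    then show ?case using Sym_Suc_Suc_module by blast
  qed
  then show ?thesis by simp
qed

text \<open>The case of order one is given separately in the definition; it fits the recursion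
  because \<open>\<Omega>\<^sup>1\<close> of the identity is the identity.\<close>

lemma iota_Suc_eq:
  assumes E: "lmod E" and t: "t \<in> carrier (syms (Suc n) E)"
  shows "iota \<Omega> (Suc n) E t = iota1 \<Omega> (jets n E) (Om1_map (jets n E) (iota \<Omega> n E) t)"
proof (cases n)
  case 0
  then show ?thesis using t Om_map_id[OF E, of t 1 "iota \<Omega> 0 E"] by simp
qed (simp add: sym_incl_def)

lemma iota_Suc_linear_J1:
  assumes E: "lmod E" and i: "lin (syms n E) (jets n E) (iota \<Omega> n E)"
  shows "lin (syms (Suc n) E) (jet1 (jets n E)) (iota \<Omega> (Suc n) E)"
proof -
  note S = Sym_module[OF E, of n] and J = Jet_module[OF E, of n]
  have "lin (syms (Suc n) E) (jet1 (jets n E))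
    (\<lambda>t. iota1 \<Omega> (jets n E) (Om1_map (jets n E) (iota \<Omega> n E) (sym_incl (Suc n) E t)))"
    by (rule linear_map_comp[OF linear_sym_incl linear_map_comp[OF Om_map_linear[OF S J i] iota1_linear[OF J]]])
  then show ?thesis
    using lmod_intros[OF Sym_module[OF E, of "Suc n"]]
    by (simp add: linear_map_def additive_def iota_Suc_eq[OF E] sym_incl_def del: jet_rec_simps)
qed

lemma iota_Suc:
  assumes E: "lmod E" and i: "lin (syms n E) (jets n E) (iota \<Omega> n E)"
    and t: "t \<in> carrier (syms (Suc n) E)"
  shows "proj1 (jets n E) (iota \<Omega> (Suc n) E t) = \<zero>\<^bsub>jets n E\<^esub>"
    "jet1_form (jets n E) (iota \<Omega> (Suc n) E t) =
      \<ominus>\<^bsub>Om1 (jets n E)\<^esub> Om1_map (jets n E) (iota \<Omega> n E) t"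
proof -
  note S = Sym_module[OF E, of n] and J = Jet_module[OF E, of n]
  have "Om1_map (jets n E) (iota \<Omega> n E) t \<in> carrier (Om1 (jets n E))"
    using t Sym_Suc(2) additive_closed[OF Om_map_additive[OF S J i]] by blast
  then show "proj1 (jets n E) (iota \<Omega> (Suc n) E t) = \<zero>\<^bsub>jets n E\<^esub>"
    "jet1_form (jets n E) (iota \<Omega> (Suc n) E t) =
      \<ominus>\<^bsub>Om1 (jets n E)\<^esub> Om1_map (jets n E) (iota \<Omega> n E) t"
    unfolding iota_Suc_eq[OF E t] by (rule iota1[OF J])+
qed

text \<open>The issue is that values are holonomic. The first condition reads zero equals zero,
  since the projection kills \<open>iota\<close>. For the second, \<open>cov\<close> of a form with
  values in the image of \<open>iota\<close> is, up to sign, the image of its wedge, and symmetric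
  forms are the kernel of that wedge.\<close>

lemma iota_linear_step:
  assumes E: "lmod E" and i0: "lin (syms n E) (jets n E) (iota \<Omega> n E)"
    and i1: "lin (syms (Suc n) E) (jets (Suc n) E) (iota \<Omega> (Suc n) E)"
  shows "lin (syms (Suc (Suc n)) E) (jets (Suc (Suc n)) E) (iota \<Omega> (Suc (Suc n)) E)"
proof -
  let ?N = "jets n E" and ?M = "jets (Suc n) E" and ?S = "syms n E" and ?T = "syms (Suc n) E"
  let ?V = "lift (Om2 ?S) (wedge1 ?S)" and ?i = "sym_incl (Suc n) E"
  note N = Jet_module[OF E, of n] and M = Jet_module[OF E, of "Suc n"]
  note S = Sym_module[OF E, of n] and T = Sym_module[OF E, of "Suc n"]
  note OS = Om_module[OF S, of 1]
  note d = derivation_Jet[OF N] note dd = derivationD[OF d]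
  interpret O1: abelian_group "Om1 ?N" by (rule Om_group[OF N])
  interpret O2: abelian_group "Om2 ?N" by (rule Om_group[OF N])
  interpret OM: abelian_group "Om1 ?M" by (rule Om_group[OF M])
  have zeros: "\<ominus>\<^bsub>Om1 ?N\<^esub> \<zero>\<^bsub>Om1 ?N\<^esub> = \<zero>\<^bsub>Om1 ?N\<^esub>" "\<ominus>\<^bsub>Om2 ?N\<^esub> \<zero>\<^bsub>Om2 ?N\<^esub> = \<zero>\<^bsub>Om2 ?N\<^esub>"
    by (rule O1.minus_equality O2.minus_equality; simp)+
  \<comment> \<open>On a pure tensor with \<open>w\<close> and \<open>m\<close>, the summand with
    \<open>dw\<close> drops out because \<open>iota\<close> projects to zero, and the form of
    \<open>iota\<close> at \<open>m\<close> is \<open>- \<Omega>\<^sup>1(\<iota>) m\<close>.\<close>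
  have cov_iota: "cov ?N (proj1 ?N) (jet1_form ?N) (Om1_map ?M (iota \<Omega> (Suc n) E) t) =
    \<ominus>\<^bsub>Om2 ?N\<^esub> Om2_map ?N (iota \<Omega> n E) (?V (Om1_map (Om1 ?S) ?i t))"
    if t: "t \<in> carrier (Om1 ?T)" for t
  proof (rule Om_ext[OF T O2.abelian_group_axioms additive_comp[OF Om_map_additive[OF T M i1] cov_additive[OF M N d]]
        additive_uminus[OF O2.abelian_group_axioms additive_comp[OF additive_comp[OF
          Om_map_additive[OF T OS linear_sym_incl] linear_map_additive[OF wedge2_linear[OF S]]] Om_map_additive[OF S N i0]]] _ t])
    fix w m assume w: "w \<in> gr 1" and m: "m \<in> carrier ?T"
    have mS: "m \<in> carrier (Om1 ?S)" using m Sym_Suc(2) by blast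
    note W = wedge11_additive[OF N w]
    have c: "Om1_map ?N (iota \<Omega> n E) m \<in> carrier (Om1 ?N)"
      by (rule additive_closed[OF Om_map_additive[OF S N i0] mS])
    have "cov ?N (proj1 ?N) (jet1_form ?N) (Om1_map ?M (iota \<Omega> (Suc n) E) (om1 ?T w m)) =
      \<ominus>\<^bsub>Om2 ?N\<^esub> wedge1 ?N w (Om1_map ?N (iota \<Omega> n E) m)"
      using w m c
      by (simp add: Om_map_om[OF T M i1] cov_om[OF M N d] linear_map_closed[OF i1] iota_Suc[OF E i0] om_zero_r[OF N]
          grade_intros additive_inv[OF O1.abelian_group_axioms O2.abelian_group_axioms W] a_minus_def zeros
          wedge11_closed[OF N] del: jet_rec_simps)
    also have "\<dots> = \<ominus>\<^bsub>Om2 ?N\<^esub> Om2_map ?N (iota \<Omega> n E) (?V (Om1_map (Om1 ?S) ?i (om1 ?T w m)))"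
      using w m mS
      by (simp add: Om_map_om[OF T OS linear_sym_incl] sym_incl_def wedge2_om[OF S] Om_map_wedge11[OF S N i0] del: jet_rec_simps)
    finally show "cov ?N (proj1 ?N) (jet1_form ?N) (Om1_map ?M (iota \<Omega> (Suc n) E) (om1 ?T w m)) =
      \<ominus>\<^bsub>Om2 ?N\<^esub> Om2_map ?N (iota \<Omega> n E) (?V (Om1_map (Om1 ?S) ?i (om1 ?T w m)))" .
  qed
  have "iota \<Omega> (Suc (Suc n)) E t \<in> carrier (jets (Suc (Suc n)) E)" if t: "t \<in> carrier (syms (Suc (Suc n)) E)" for t
  proof -
    have tO: "t \<in> carrier (Om1 ?T)" and tV: "?V (Om1_map (Om1 ?S) ?i t) = \<zero>\<^bsub>Om2 ?S\<^esub>"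
      using t unfolding Sym_Suc_Suc_iff by auto
    let ?x = "iota \<Omega> (Suc (Suc n)) E t" and ?u = "Om1_map ?M (iota \<Omega> (Suc n) E) t"
    have u: "?u \<in> carrier (Om1 ?M)" by (rule additive_closed[OF Om_map_additive[OF T M i1] tO])
    note x = iota_Suc[OF E i1 t]
    have "Om1_map ?N (proj1 ?N) ?u = Om1_map ?N (\<lambda>m. proj1 ?N (iota \<Omega> (Suc n) E m)) t"
      by (rule Om_map_comp[OF T M N i1 dd(1) tO])
    also have "\<dots> = \<zero>\<^bsub>Om1 ?N\<^esub>"
      by (rule Om_map_zero[OF T N tO]) (rule iota_Suc(1)[OF E i0])
    finally have 1: "Om1_map ?N (proj1 ?N) (jet1_form ?M ?x) = \<zero>\<^bsub>Om1 ?N\<^esub>"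
      unfolding x additive_inv[OF OM.abelian_group_axioms O1.abelian_group_axioms Om_map_additive[OF M N dd(1)] u]
      by (simp add: zeros)
    have 2: "jet1_form ?N (proj1 ?M ?x) = \<zero>\<^bsub>Om1 ?N\<^esub>"
      unfolding x by (rule additive_zero[OF left_module_group[OF M] O1.abelian_group_axioms dd(2)])
    have "cov ?N (proj1 ?N) (jet1_form ?N) (jet1_form ?M ?x) = \<zero>\<^bsub>Om2 ?N\<^esub>"
      unfolding x additive_inv[OF OM.abelian_group_axioms O2.abelian_group_axioms cov_additive[OF M N d] u]
        cov_iota[OF tO] tV
        additive_zero[OF Om_group[OF S] O2.abelian_group_axioms Om_map_additive[OF S N i0]] zeros ..
    moreover have "?x \<in> carrier (jet1 ?M)"
      by (rule linear_map_closed[OF iota_Suc_linear_J1[OF E i1] t])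
    ultimately show ?thesis unfolding Jet_Suc_Suc_iff[OF N M] using 1 2 by simp
  qed
  then show ?thesis
    using iota_Suc_linear_J1[OF E i1]
    by (simp add: linear_map_def additive_def Jet_Suc_simps(2,3)[of "Suc n"] del: jet_rec_simps)
qed

lemma iota_linear:
  assumes E: "lmod E"
  shows "lin (syms n E) (jets n E) (iota \<Omega> n E)"
proof -
  have "lin (syms n E) (jets n E) (iota \<Omega> n E) \<and>
    lin (syms (Suc n) E) (jets (Suc n) E) (iota \<Omega> (Suc n) E)"
  proof (induction n)
    case 0
    have "lin (syms 0 E) (jets 0 E) (iota \<Omega> 0 E)"
      by (simp add: linear_map_def additive_def)
    then show ?case using iota_Suc_linear_J1[OF E, of 0] by (simp del: iota.simps)
  next
    case (Suc n)
    then show ?case using iota_linear_step[OF E] by blast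
  qed
  then show ?thesis by simp
qed


section \<open>Connections\<close>

text \<open>By \<open>lift_diff_mult\<close> the inner sum is \<open>jet1_form\<close> of the
  product of \<open>w\<close> and \<open>y\<close>. In this shape balancedness over \<open>A\<close>
  is plain, and \<open>w = \<one>\<close> returns the form itself.\<close>

lemma spencer0_eq:
  assumes E: "lmod E" and x: "x \<in> carrier (jets (Suc n) E)"
  shows "spencer0 \<Omega> (Suc n) E x = jet1_form (jets n E) x"
proof -
  let ?N = "jets n E"
  note N = Jet_module[OF E, of n] and M = Jet_module[OF E, of "Suc n"]
  note J = J1_module[OF N]
  let ?f = "\<lambda>w. lift (Om1 ?N) (\<lambda>a e. om1 ?N (der (w \<otimes> a)) e)"
  have f: "?f w y = jet1_form ?N (w \<odot>\<^bsub>jet1 ?N\<^esub> y)" if "w \<in> gr 0" "y \<in> carrier (jet1 ?N)" for w y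
    using lift_diff_mult[OF N that(1) J1_carrier_AE[OF N that(2)]] J1_smult(3)[OF N that] by simp
  have bal: "Om_balanced_map 0 (jet1 ?N) (Om1 ?N) ?f"
    by (rule Om_balanced_mapI)
      (simp_all add: f grade_intros lmod_intros[OF J] lmod_smult_l_distr[OF J] lmod_smult_r_distr[OF J] lmod_smult_assoc[OF J]
        additive_add[OF jet1_form_additive[OF N]] jet1_form_closed[OF N])
  have xJ: "x \<in> carrier (jet1 ?N)" using x Jet_Suc(2) by blast
  have "spencer0 \<Omega> (Suc n) E x = spencer1 \<Omega> 0 ?N (om \<Omega> 0 (jet1 ?N) \<one> x)"
    using x by (simp add: spencer0_def spencer_def Om_map_om[OF M J linear_jet_incl] one_grade jet_incl_def del: Jet.simps)
  also have "\<dots> = ?f \<one> x"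
    unfolding spencer1_def One_nat_def[symmetric]
    by (rule Om_lift_om[OF J Om_group[OF N] bal one_grade xJ])
  also have "\<dots> = jet1_form ?N x" using xJ by (simp add: f one_grade lmod_smult_one[OF J])
  finally show ?thesis .
qed

lemma lmod_minus_one:
  assumes M: "lmod M" and x: "x \<in> carrier M"
  shows "(\<ominus> \<one>) \<odot>\<^bsub>M\<^esub> x = \<ominus>\<^bsub>M\<^esub> x"
proof -
  interpret G: abelian_group M by (rule left_module_group[OF M])
  have "additive (coeffs \<Omega>) M (\<lambda>a. a \<odot>\<^bsub>M\<^esub> x)"
    using x by (simp add: additive_def lmod_smult[OF M] lmod_smult_l_distr[OF M])
  from additive_zero[OF forms_group G.abelian_group_axioms this]
  have "\<zero> \<odot>\<^bsub>M\<^esub> x = \<zero>\<^bsub>M\<^esub>" by simp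
  then have "(\<ominus> \<one>) \<odot>\<^bsub>M\<^esub> x \<oplus>\<^bsub>M\<^esub> x = \<zero>\<^bsub>M\<^esub>"
    using x lmod_smult_l_distr[OF M, of "\<ominus> \<one>" \<one> x] by (simp add: grade_intros lmod_smult_one[OF M] dga.l_neg)
  then show ?thesis using x by (intro G.minus_equality[symmetric]) (simp_all add: lmod_smult[OF M] grade_intros)
qed

text \<open>In degree one the sign in the exterior covariant derivative is the action of
  \<open>-1\<close>, so each of its summands is the negative of the corresponding summand of
  \<open>cov\<close>.\<close>

lemma ext_cov_deriv_eq:
  assumes M: "lmod M" and nab: "derivation M M (\<lambda>x. x) nab" and t: "t \<in> carrier (Om1 M)"
  shows "ext_cov_deriv \<Omega> 1 M nab t = \<ominus>\<^bsub>Om2 M\<^esub> cov M (\<lambda>x. x) nab t"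
proof -
  interpret O2: abelian_group "Om2 M" by (rule Om_group[OF M])
  note tm = Om_terms[OF M t] and dd = derivationD[OF nab]
  have id: "additive (Om2 M) (Om2 M) (\<lambda>x. x)" by (simp add: additive_def)
  have pow: "(\<ominus> \<one>) [^] (1::nat) = \<ominus> \<one>" by (simp add: One_nat_def)
  let ?w = "\<lambda>w m. wedge1 M w (nab m)" and ?o = "\<lambda>w m. om2 M (der w) m"
  have "ext_cov_deriv \<Omega> 1 M nab t = lift (Om2 M) (\<lambda>w m. ?o w m \<oplus>\<^bsub>Om2 M\<^esub> (\<ominus> \<one>) \<odot>\<^bsub>Om2 M\<^esub> ?w w m) t"
    unfolding ext_cov_deriv_def by (simp add: pow)
  also have "\<dots> = lift (Om2 M) (\<lambda>w m. \<ominus>\<^bsub>Om2 M\<^esub> (?w w m \<ominus>\<^bsub>Om2 M\<^esub> ?o w m)) t"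
  proof (rule lift_cong)
    fix w m assume "(w, m) \<in> set (terms t)"
    then have wm: "w \<in> gr 1" "m \<in> carrier M" using tm by auto
    have c: "?w w m \<in> carrier (Om2 M)" "?o w m \<in> carrier (Om2 M)"
      using wm by (simp_all add: wedge11_closed[OF M] dd om_closed[OF M] grade_intros)
    show "?o w m \<oplus>\<^bsub>Om2 M\<^esub> (\<ominus> \<one>) \<odot>\<^bsub>Om2 M\<^esub> ?w w m = \<ominus>\<^bsub>Om2 M\<^esub> (?w w m \<ominus>\<^bsub>Om2 M\<^esub> ?o w m)"
      using c by (simp add: lmod_minus_one[OF Om_module[OF M]] a_minus_def O2.minus_add O2.a_comm)
  qed
  also have "\<dots> = \<ominus>\<^bsub>Om2 M\<^esub> cov M (\<lambda>x. x) nab t"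
    unfolding cov_def
    by (rule additive_of_lift[OF O2.abelian_group_axioms O2.abelian_group_axioms
          additive_uminus[OF O2.abelian_group_axioms id], symmetric])
      (use tm in \<open>auto simp: wedge11_closed[OF M] dd om_closed[OF M] grade_intros\<close>)
  finally show ?thesis .
qed

text \<open>Linearity over the ground ring is absorbed by the Leibniz rule, because
  \<open>der (c \<odot> \<one>) = \<zero>\<close>.\<close>

lemma connections_iff:
  assumes M: "lmod M"
  shows "nab \<in> connections \<Omega> M \<longleftrightarrow> derivation M M (\<lambda>x. x) nab \<and> nab \<in> extensional (carrier M)"
proof -
  interpret O: abelian_group "Om1 M" by (rule Om_group[OF M])
  have id: "lin M M (\<lambda>x. x)" by (simp add: linear_map_def additive_def)
  have "nab (scal \<Omega> M c x) = scal \<Omega> (Om1 M) c (nab x)"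
    if d: "derivation M M (\<lambda>x. x) nab" and c: "c \<in> carrier (scalars \<Omega>)" and x: "x \<in> carrier M" for c x
    using derivationD(8)[OF d smult_one_grade[OF c] x] derivationD(4)[OF d x] x
    by (simp add: scal_def diff_smult_one[OF c] om_zero_l[OF M] lmod_smult[OF Om_module[OF M]] smult_one_grade[OF c])
  then show ?thesis
    using id by (auto simp: connections_def scalar_linear_maps_def derivation_def additive_def PiE_iff)
qed

lemma linear_map_J1I:
  assumes M: "lmod M" and N: "lmod N" and "\<And>m. m \<in> carrier M \<Longrightarrow> C m \<in> carrier (jet1 N)"
    and d: "derivation M N (\<lambda>m. proj1 N (C m)) (\<lambda>m. jet1_form N (C m))"
  shows "lin M (jet1 N) C"
  using derivationD[OF d]
  by (auto simp: linear_map_def additive_def assms(3) J1_eq_iff[OF N] J1_add[OF N] J1_smult[OF N] lmod_intros[OF M])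

text \<open>Flatness enters through the inclusion of the image of \<open>\<pi>\<close>, as \<open>\<pi>\<close> need not be surjective.\<close>

lemma Om_kernel:
  fixes S M N :: "('w, 'e) emodule"
  assumes flat: "flat_forms \<Omega> k TYPE('e)" and S: "lmod S" and M: "lmod M" and N: "lmod N"
    and i: "lin S M \<iota>" and p: "lin M N \<pi>"
    and ex: "\<iota> ` carrier S = {m \<in> carrier M. \<pi> m = \<zero>\<^bsub>N\<^esub>}" and t: "t \<in> carrier (Om \<Omega> k M)"
  shows "t \<in> Om_map \<Omega> k M \<iota> ` carrier (Om \<Omega> k S) \<longleftrightarrow> Om_map \<Omega> k N \<pi> t = \<zero>\<^bsub>Om \<Omega> k N\<^esub>"
proof
  assume "t \<in> Om_map \<Omega> k M \<iota> ` carrier (Om \<Omega> k S)"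
  then obtain s where s: "s \<in> carrier (Om \<Omega> k S)" "t = Om_map \<Omega> k M \<iota> s" by auto
  show "Om_map \<Omega> k N \<pi> t = \<zero>\<^bsub>Om \<Omega> k N\<^esub>"
    unfolding s(2) Om_map_comp[OF S M N i p s(1)]
    by (rule Om_map_zero[OF S N s(1)]) (use ex in auto)
next
  assume t0: "Om_map \<Omega> k N \<pi> t = \<zero>\<^bsub>Om \<Omega> k N\<^esub>"
  interpret SG: abelian_group "Om \<Omega> k S" by (rule Om_group[OF S])
  interpret MG: abelian_group "Om \<Omega> k M" by (rule Om_group[OF M])
  \<comment> \<open>The map \<open>\<pi>\<close> factors as a surjection onto its image
    \<open>I\<close>, for which right exactness describes the kernel, followed by an inclusion that
    stays injective after tensoring by flatness.\<close>
  define I where "I = N\<lparr>carrier := \<pi> ` carrier M\<rparr>"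
  have zero: "\<pi> \<zero>\<^bsub>M\<^esub> = \<zero>\<^bsub>N\<^esub>"
    by (rule additive_zero[OF left_module_group[OF M] left_module_group[OF N] linear_map_additive[OF p]])
  have I: "lmod I"
    unfolding I_def
  proof (rule left_module_submodule[OF N])
    show "\<pi> ` carrier M \<subseteq> carrier N" using linear_map_closed[OF p] by auto
    show "\<zero>\<^bsub>N\<^esub> \<in> \<pi> ` carrier M" using zero lmod_zero_closed[OF M] by (metis image_eqI)
    show "x \<oplus>\<^bsub>N\<^esub> y \<in> \<pi> ` carrier M" if "x \<in> \<pi> ` carrier M" "y \<in> \<pi> ` carrier M" for x y
      using that by (auto simp: lmod_add_closed[OF M] simp flip: additive_add[OF linear_map_additive[OF p]])
    show "a \<odot>\<^bsub>N\<^esub> x \<in> \<pi> ` carrier M" if "a \<in> carrier (coeffs \<Omega>)" "x \<in> \<pi> ` carrier M" for a x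
      using that lmod_smult[OF M] by (auto simp flip: linear_map_smult[OF p])
  qed
  have pI: "lin M I \<pi>"
    using p by (auto simp: I_def linear_map_def additive_def)
  define j where "j = restrict (\<lambda>x. x) (carrier I)"
  have jl: "lin I N j"
    unfolding j_def linear_map_restrict[OF I]
    using linear_map_closed[OF p] by (auto simp: I_def linear_map_def additive_def)
  have jm: "j \<in> linear_maps (coeffs \<Omega>) I N"
    using jl by (simp add: linear_maps_iff j_def)
  have ji: "inj_on j (carrier I)" by (auto simp: inj_on_def j_def)
  have inj: "inj_on (Om_map \<Omega> k N j) (carrier (Om \<Omega> k I))"
    using flat I N jm ji unfolding flat_forms_def by blast
  have ptI: "Om_map \<Omega> k I \<pi> t \<in> carrier (Om \<Omega> k I)"
    by (rule additive_closed[OF Om_map_additive[OF M I pI] t])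
  have "Om_map \<Omega> k N j (Om_map \<Omega> k I \<pi> t) = Om_map \<Omega> k N (\<lambda>m. j (\<pi> m)) t"
    by (rule Om_map_comp[OF M I N pI jl t])
  also have "\<dots> = Om_map \<Omega> k N \<pi> t"
    by (rule Om_map_cong[OF M t]) (simp add: j_def I_def)
  also have "\<dots> = Om_map \<Omega> k N j \<zero>\<^bsub>Om \<Omega> k I\<^esub>"
    unfolding t0 by (rule additive_zero[OF Om_group[OF I] Om_group[OF N] Om_map_additive[OF I N jl], symmetric])
  finally have z: "Om_map \<Omega> k I \<pi> t = \<zero>\<^bsub>Om \<Omega> k I\<^esub>"
    using inj_onD[OF inj _ ptI lmod_zero_closed[OF Om_module[OF I]]] by blast
  interpret TM: tensor_product "forms \<Omega> k" M "carrier (coeffs \<Omega>)" "mult \<Omega>" "smult M" by (rule Om_tensor[OF M])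
  interpret TI: tensor_product "forms \<Omega> k" I "carrier (coeffs \<Omega>)" "mult \<Omega>" "smult I" by (rule Om_tensor[OF I])
  have tm: "TM.wfl (terms t)" using TM.terms_wf t by (simp add: Om_def)
  have wm: "TI.wfl (map (\<lambda>(x, m). (x, \<pi> m)) (terms t))"
    using tm linear_map_closed[OF pI] by auto
  have "TI.cl (map (\<lambda>(x, m). (x, \<pi> m)) (terms t)) = Om_map \<Omega> k I \<pi> t"
    unfolding TI.cl_list_sum[OF wm]
    by (simp add: Om_map_def lift_def list_sum_map case_prod_unfold Om_def om_def)
  also have "\<dots> = TI.cl []" unfolding z Om_def TI.zero_T ..
  finally have cl_eq: "TI.cl (map (\<lambda>(x, m). (x, \<pi> m)) (terms t)) = TI.cl []" .
  \<comment> \<open>Vanishing in the tensor product over \<open>I\<close> is turned back into a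
    derivation from the relations, the form that \<open>tensor_kernel\<close> consumes.\<close>
  have teq: "TI.teq (map (\<lambda>(x, m). (x, \<pi> m)) (terms t)) []"
    by (rule TI.cl_eq_iff[OF wm, THEN iffD1, OF _ cl_eq]) simp
  note F = Om_map_additive[OF S M i, of k]
  \<comment> \<open>Here \<open>H\<close> is the image of \<open>Om_map\<close>; it contains each
    \<open>x \<otimes> m\<close> with \<open>m\<close> in the kernel, since the kernel is the image
    of \<open>\<iota>\<close>.\<close>
  have "TM.cl (terms t) \<in> Om_map \<Omega> k M \<iota> ` carrier (Om \<Omega> k S)"
  proof (rule tensor_kernel[OF TM.tensor_product_axioms TI.tensor_product_axioms linear_map_additive[OF pI] _ _ _ _ _ _ tm teq];
      (fold Om_def om_def)?)
    show "\<pi> ` carrier M = carrier I" by (simp add: I_def)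
    show "\<pi> (r \<odot>\<^bsub>M\<^esub> m) = r \<odot>\<^bsub>I\<^esub> \<pi> m" if "r \<in> carrier (coeffs \<Omega>)" "m \<in> carrier M" for r m
      by (rule linear_map_smult[OF pI that])
    show "\<zero>\<^bsub>Om \<Omega> k M\<^esub> \<in> Om_map \<Omega> k M \<iota> ` carrier (Om \<Omega> k S)"
      using additive_zero[OF SG.abelian_group_axioms MG.abelian_group_axioms F] SG.zero_closed by (metis image_eqI)
    show "s \<ominus>\<^bsub>Om \<Omega> k M\<^esub> u \<in> Om_map \<Omega> k M \<iota> ` carrier (Om \<Omega> k S)"
      if "s \<in> Om_map \<Omega> k M \<iota> ` carrier (Om \<Omega> k S)" "u \<in> Om_map \<Omega> k M \<iota> ` carrier (Om \<Omega> k S)" for s u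
      using that
      by (auto simp flip: additive_minus[OF SG.abelian_group_axioms MG.abelian_group_axioms F])
    show "Om_map \<Omega> k M \<iota> ` carrier (Om \<Omega> k S) \<subseteq> carrier (Om \<Omega> k M)"
      using additive_closed[OF F] by auto
    fix x m assume x: "x \<in> carrier (forms \<Omega> k)" and m: "m \<in> carrier M" "\<pi> m = \<zero>\<^bsub>I\<^esub>"
    then have "m \<in> \<iota> ` carrier S" unfolding ex by (simp add: I_def)
    then obtain s where "s \<in> carrier S" "m = \<iota> s" by auto
    then show "om \<Omega> k M x m \<in> Om_map \<Omega> k M \<iota> ` carrier (Om \<Omega> k S)"
      using x by (intro image_eqI[of _ _ "om \<Omega> k S x s"]) (simp_all add: Om_map_om[OF S M i] om_closed[OF S])
  qed
  then show "t \<in> Om_map \<Omega> k M \<iota> ` carrier (Om \<Omega> k S)"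
    using TM.cl_terms[of t] t by (simp add: Om_def)
qed


section \<open>The correspondence\<close>

text \<open>In terms of pairs \<open>iota1\<close> is \<open>w\<close> to \<open>(0, - w)\<close>,
  which makes exactness visible. This covers \<open>n = 1\<close>, and for \<open>n = 2\<close> it
  provides the left exactness in order \<open>n - 1\<close>.\<close>

lemma jet_seq_exact_1:
  assumes E: "lmod E"
  shows "jet_seq_exact \<Omega> 1 E"
proof -
  interpret O: abelian_group "Om1 E" by (rule Om_group[OF E])
  have Suc0: "(1::nat) = Suc 0" by (simp add: One_nat_def)
  have "x \<in> iota1 \<Omega> E ` carrier (Om1 E)" if "x \<in> carrier (jet1 E)" "proj1 E x = \<zero>\<^bsub>E\<^esub>" for x
    using that jet1_form_closed[OF E that(1)]
    by (intro image_eqI[of _ _ "\<ominus>\<^bsub>Om1 E\<^esub> jet1_form E x"]) (simp_all add: J1_eq_iff[OF E] iota1[OF E])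
  moreover have "inj_on (iota1 \<Omega> E) (carrier (Om1 E))"
    by (rule inj_onI) (metis iota1(3)[OF E] O.minus_minus)
  moreover have "e \<in> proj1 E ` carrier (jet1 E)" if "e \<in> carrier E" for e
    using prol1[OF E that] by force
  ultimately show ?thesis
    using iota1[OF E] proj1_closed[OF E]
    by (auto simp: jet_seq_exact_def jet_seq_left_exact_def jet_proj_def jet_incl_def Suc0 inj_on_def)
qed

text \<open>A representative of \<open>x\<close> serves as its expansion: the action of
  \<open>a\<close> on \<open>(e, 0)\<close> gives \<open>(a e, da \<otimes> e)\<close>, which is the
  contribution of the entry \<open>(a, e)\<close> to both components.\<close>

lemma jets_generated_1:
  assumes E: "lmod E"
  shows "jets_generated \<Omega> 1 E"
proof -
  interpret O: abelian_group "Om1 E" by (rule Om_group[OF E])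
  note J = J1_module[OF E] and JG = J1_group[OF E] and G = left_module_group[OF E]
  have Suc0: "(1::nat) = Suc 0" by (simp add: One_nat_def)
  let ?f = "\<lambda>(a, e). a \<odot>\<^bsub>jet1 E\<^esub> prol1 \<Omega> E e"
  have f: "?f p \<in> carrier (jet1 E)" if "p \<in> gr 0 \<times> carrier E" for p
    using that by (auto simp: lmod_smult[OF J] prol1[OF E])
  have "x = list_sum (jet1 E) ?f (terms x)" if x: "x \<in> carrier (jet1 E)" for x
  proof -
    have tm: "p \<in> gr 0 \<times> carrier E" if "p \<in> set (terms x)" for p
      using J1_terms[OF E x, of "fst p" "snd p"] that by (cases p) auto
    have c: "list_sum (jet1 E) ?f (terms x) \<in> carrier (jet1 E)"
      by (rule list_sum_closed[OF JG]) (rule f[OF tm])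
    have "proj1 E (list_sum (jet1 E) ?f (terms x)) = list_sum E (\<lambda>p. proj1 E (?f p)) (terms x)"
      by (rule additive_list_sum[OF JG G linear_map_additive[OF proj1_linear[OF E]]]) (rule f[OF tm])
    also have "\<dots> = list_sum E (\<lambda>(a, e). a \<odot>\<^bsub>E\<^esub> e) (terms x)"
      by (rule list_sum_cong, drule tm) (auto simp: J1_smult[OF E] prol1[OF E])
    also have "\<dots> = proj1 E x"
      by (simp add: proj1_def lift_def)
    finally have 1: "proj1 E (list_sum (jet1 E) ?f (terms x)) = proj1 E x" .
    have "jet1_form E (list_sum (jet1 E) ?f (terms x)) = list_sum (Om1 E) (\<lambda>p. jet1_form E (?f p)) (terms x)"
      by (rule additive_list_sum[OF JG O.abelian_group_axioms jet1_form_additive[OF E]]) (rule f[OF tm])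
    also have "\<dots> = list_sum (Om1 E) (\<lambda>(a, e). om1 E (der a) e) (terms x)"
      by (rule list_sum_cong, drule tm)
        (auto simp: J1_smult[OF E] prol1[OF E] om_closed[OF E] grade_intros
          additive_zero[OF O.abelian_group_axioms O.abelian_group_axioms additive_smult_Om[OF E]])
    also have "\<dots> = jet1_form E x"
      by (simp add: jet1_form_def lift_def)
    finally show ?thesis using 1 by (intro J1_eqI[OF E x c]) simp_all
  qed
  then have "x \<in> list_sum (jet1 E) ?f ` {xs. set xs \<subseteq> gr 0 \<times> carrier E}" if "x \<in> carrier (jet1 E)" for x
    using that J1_terms[OF E that] by (intro image_eqI[of _ _ "terms x"]) auto
  moreover have "list_sum (jet1 E) ?f xs \<in> carrier (jet1 E)" if "set xs \<subseteq> gr 0 \<times> carrier E" for xs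
    using that by (intro list_sum_closed[OF JG] f) auto
  ultimately show ?thesis by (auto simp: jets_generated_def Suc0)
qed

text \<open>Both holonomy conditions hold trivially, as prolongations have zero form at each level.
  The second order in the induction supplies this one level below.\<close>

lemma prol_closed:
  assumes E: "lmod E" and e: "e \<in> carrier E"
  shows "prol \<Omega> n E e \<in> carrier (jets n E)"
proof -
  have "prol \<Omega> n E e \<in> carrier (jets n E) \<and> prol \<Omega> (Suc n) E e \<in> carrier (jets (Suc n) E)"
  proof (induction n)
    case 0
    show ?case using e prol1[OF E e] by simp
  next
    case (Suc n)
    note K = Jet_module[OF E, of n] and N = Jet_module[OF E, of "Suc n"]
    note d = derivation_Jet[OF K]
    have k: "prol \<Omega> n E e \<in> carrier (jets n E)" and n: "prol \<Omega> (Suc n) E e \<in> carrier (jets (Suc n) E)"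
      using Suc by auto
    have "prol \<Omega> (Suc (Suc n)) E e \<in> carrier (jets (Suc (Suc n)) E)"
      unfolding Jet_Suc_Suc_iff[OF K N] prol.simps(2)[of \<Omega> "Suc n"] prol1(2,3)[OF N n]
        additive_zero[OF Om_group[OF N] Om_group[OF K] Om_map_additive[OF N K derivationD(1)[OF d]]]
        additive_zero[OF Om_group[OF N] Om_group[OF K] cov_additive[OF N K d]]
      using prol1(1)[OF N n] prol1(3)[OF K k] by simp
    then show ?case using n by blast
  qed
  then show ?thesis by blast
qed

lemma prol_add:
  assumes E: "lmod E" and e: "e \<in> carrier E" "e' \<in> carrier E"
  shows "prol \<Omega> n E (e \<oplus>\<^bsub>E\<^esub> e') = prol \<Omega> n E e \<oplus>\<^bsub>jets n E\<^esub> prol \<Omega> n E e'"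
proof (induction n)
  case (Suc n)
  note N = Jet_module[OF E, of n]
  interpret O: abelian_group "Om1 (jets n E)" by (rule Om_group[OF N])
  show ?case
    using prol_closed[OF E, of _ n] e lmod_add_closed[OF E e] lmod_add_closed[OF N]
    by (simp add: Jet_Suc_simps Suc J1_eq_iff[OF N] J1_add[OF N] prol1[OF N] del: Jet.simps)
qed simp

text \<open>The second component stays zero because the scalar is a constant,
  \<open>der (c \<odot> \<one>) = \<zero>\<close>; over \<open>A\<close> a term
  \<open>da \<otimes> j e\<close> would appear.\<close>

lemma prol_scal:
  assumes E: "lmod E" and e: "e \<in> carrier E" and c: "c \<in> carrier (scalars \<Omega>)"
  shows "prol \<Omega> n E (scal \<Omega> E c e) = scal \<Omega> (jets n E) c (prol \<Omega> n E e)"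
proof (induction n)
  case (Suc n)
  note N = Jet_module[OF E, of n] and c1 = smult_one_grade[OF c]
  interpret O: abelian_group "Om1 (jets n E)" by (rule Om_group[OF N])
  show ?case
    using prol_closed[OF E e, of n] lmod_smult[OF N c1] Suc
    by (simp add: scal_def Jet_Suc_simps J1_eq_iff[OF N] J1_smult[OF N c1] prol1[OF N] diff_smult_one[OF c] om_zero_l[OF N]
        additive_zero[OF O.abelian_group_axioms O.abelian_group_axioms additive_smult_Om[OF N c1]] del: Jet.simps)
qed simp

section \<open>Sections of the jet projection and their connections\<close>

lemma jet_proj_Suc: "jet_proj \<Omega> (Suc n) E = proj1 (jets n E)"
  by (simp add: fun_eq_iff jet_proj_def jet_incl_def)

lemma linear_jet_proj:
  assumes "lmod E"
  shows "lin (jets (Suc n) E) (jets n E) (proj1 (jets n E))"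
  by (rule derivationD(1)[OF derivation_Jet[OF Jet_module[OF assms]]])

lemma n_connections_iff:
  "C \<in> n_connections \<Omega> (Suc n) E \<longleftrightarrow> C \<in> linear_maps (coeffs \<Omega>) (jets n E) (jets (Suc n) E) \<and>
     (\<forall>x \<in> carrier (jets n E). proj1 (jets n E) (C x) = x)"
  by (simp add: n_connections_def jet_proj_Suc)

lemma assoc_connection_eq:
  assumes "lmod E" "C \<in> n_connections \<Omega> (Suc n) E" "x \<in> carrier (jets n E)"
  shows "assoc_connection \<Omega> (Suc n) E C x = jet1_form (jets n E) (C x)"
  using assms spencer0_eq[OF assms(1), of "C x" n]
  by (auto simp: assoc_connection_def n_connections_iff linear_maps_def simp del: Jet.simps)

lemma n_connection_eq_pair:
  assumes E: "lmod E" and C: "C \<in> n_connections \<Omega> (Suc n) E" and x: "x \<in> carrier (jets n E)"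
  shows "C x = jet1_pair (jets n E) x (assoc_connection \<Omega> (Suc n) E C x)"
proof -
  note N = Jet_module[OF E, of n]
  have "C x \<in> carrier (jet1 (jets n E))" "proj1 (jets n E) (C x) = x"
    using C x Jet_Suc(2) by (auto simp: n_connections_iff linear_maps_def simp del: Jet.simps)
  then show ?thesis
    using x by (simp add: J1_eq_iff[OF N] assoc_connection_eq[OF E C x] jet1_pair[OF N] jet1_form_closed[OF N])
qed

text \<open>Recasts (1) and (2) as holonomy of the pairs formed from \<open>x\<close> and
  \<open>nab x\<close>. Left exactness in order \<open>n\<close>, one below that of the connection,
  identifies the kernel of the projection with the image of \<open>iota\<close>, as
  \<open>Om_kernel\<close> requires.\<close>

lemma jet_connections_iff:
  fixes E :: "('w, 'e) emodule"
  assumes E: "lmod E" and hyp: "n = 0 \<or> flat_forms \<Omega> 2 TYPE('e) \<and> jet_seq_left_exact \<Omega> n E"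
  shows "nab \<in> jet_connections \<Omega> (Suc n) E \<longleftrightarrow> nab \<in> connections \<Omega> (jets n E) \<and>
    (\<forall>x \<in> carrier (jets n E). jet1_pair (jets n E) x (nab x) \<in> carrier (jets (Suc n) E))"
proof (cases "nab \<in> connections \<Omega> (jets n E)")
  case True
  note M = Jet_module[OF E, of n]
  have d: "derivation (jets n E) (jets n E) (\<lambda>x. x) nab"
    using True connections_iff[OF M] by blast
  note dd = derivationD[OF d]
  interpret O2: abelian_group "Om2 (jets n E)" by (rule Om_group[OF M])
  have curv: "curvature \<Omega> (jets n E) nab x = \<ominus>\<^bsub>Om2 (jets n E)\<^esub> cov (jets n E) (\<lambda>x. x) nab (nab x)"
    if "x \<in> carrier (jets n E)" for x
    unfolding curvature_def by (rule ext_cov_deriv_eq[OF M d dd(4)[OF that]])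
  have cov_c: "cov (jets n E) (\<lambda>x. x) nab (nab x) \<in> carrier (Om2 (jets n E))"
    if "x \<in> carrier (jets n E)" for x
    by (rule additive_closed[OF cov_additive[OF M M d] dd(4)[OF that]])
  show ?thesis
  proof (cases n)
    case 0
    \<comment> \<open>In the lowest case \<open>iota\<close> is the identity, so its image under
      \<open>Om2_map\<close> is everything and (2) is automatic.\<close>
    have "curvature \<Omega> E nab x \<in> Om2_map E (iota \<Omega> 0 E) ` carrier (Om2 E)" if x: "x \<in> carrier E" for x
    proof (rule image_eqI)
      show c: "curvature \<Omega> E nab x \<in> carrier (Om2 E)"
        using curv[of x] cov_c[of x] x O2.a_inv_closed by (simp add: 0)
      show "curvature \<Omega> E nab x = Om2_map E (iota \<Omega> 0 E) (curvature \<Omega> E nab x)"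
        using Om_map_id[OF E c, of "iota \<Omega> 0 E"] by simp
    qed
    then show ?thesis
      using True jet1_pair[OF M] dd(4) by (simp add: jet_connections_def 0 del: iota.simps)
  next
    case (Suc k)
    let ?M = "jets (Suc k) E" and ?N = "jets k E"
    note M = M[unfolded Suc] and d = d[unfolded Suc] and dd = dd[unfolded Suc] and curv = curv[unfolded Suc]
      and cov_c = cov_c[unfolded Suc]
    note N = Jet_module[OF E, of k] and S = Sym_module[OF E, of "Suc k"]
    note p = linear_jet_proj[OF E, of k]
    interpret N2: abelian_group "Om2 ?N" by (rule Om_group[OF N])
    interpret M2: abelian_group "Om2 ?M" by (rule Om_group[OF M])
    have ex: "iota \<Omega> (Suc k) E ` carrier (syms (Suc k) E) = {m \<in> carrier ?M. proj1 ?N m = \<zero>\<^bsub>?N\<^esub>}"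
      and flat: "flat_forms \<Omega> 2 TYPE('e)"
      using hyp by (simp_all add: Suc jet_seq_left_exact_def jet_proj_Suc del: jet_rec_simps)
    let ?one = "\<lambda>x. Om1_map ?N (proj1 ?N) (nab x) = jet1_form ?N x"
    \<comment> \<open>Condition (1) is assumed on all of \<open>?M\<close> and not only at
      \<open>x\<close>, because \<open>cov\<close> uses it at the module entries of a representative
      of \<open>nab x\<close>. So (2) is translated only after (1) is known everywhere.\<close>
    have main: "curvature \<Omega> ?M nab x \<in> Om2_map ?M (iota \<Omega> (Suc k) E) ` carrier (Om2 (syms (Suc k) E)) \<longleftrightarrow>
      cov ?N (proj1 ?N) (jet1_form ?N) (nab x) = \<zero>\<^bsub>Om2 ?N\<^esub>"
      if one: "\<forall>x \<in> carrier ?M. ?one x" and x: "x \<in> carrier ?M" for x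
    proof -
      have c: "curvature \<Omega> ?M nab x \<in> carrier (Om2 ?M)"
        unfolding curv[OF x] using cov_c[OF x] by (rule M2.a_inv_closed)
      have "Om2_map ?N (proj1 ?N) (curvature \<Omega> ?M nab x) =
        \<ominus>\<^bsub>Om2 ?N\<^esub> Om2_map ?N (proj1 ?N) (cov ?M (\<lambda>x. x) nab (nab x))"
        unfolding curv[OF x]
        by (rule additive_inv[OF M2.abelian_group_axioms N2.abelian_group_axioms Om_map_additive[OF M N p] cov_c[OF x]])
      also have "Om2_map ?N (proj1 ?N) (cov ?M (\<lambda>x. x) nab (nab x)) =
        cov ?N (\<lambda>m. proj1 ?N m) (\<lambda>m. Om1_map ?N (proj1 ?N) (nab m)) (nab x)"
        by (rule Om_map_cov[OF M M N p d dd(4)[OF x]])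
      also have "\<dots> = cov ?N (proj1 ?N) (jet1_form ?N) (nab x)"
        by (rule cov_cong[OF M dd(4)[OF x]]) (use one in auto)
      finally have eq: "Om2_map ?N (proj1 ?N) (curvature \<Omega> ?M nab x) =
        \<ominus>\<^bsub>Om2 ?N\<^esub> cov ?N (proj1 ?N) (jet1_form ?N) (nab x)" .
      have k: "cov ?N (proj1 ?N) (jet1_form ?N) (nab x) \<in> carrier (Om2 ?N)"
        by (rule additive_closed[OF cov_additive[OF M N derivation_Jet[OF N]] dd(4)[OF x]])
      have "\<ominus>\<^bsub>Om2 ?N\<^esub> \<zero>\<^bsub>Om2 ?N\<^esub> = \<zero>\<^bsub>Om2 ?N\<^esub>" by (rule N2.minus_equality) simp_all
      then show ?thesis
        unfolding Om_kernel[OF flat S M N iota_linear[OF E] p ex c] eq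
        using k by (metis N2.minus_minus)
    qed
    have jc: "nab \<in> jet_connections \<Omega> (Suc n) E \<longleftrightarrow>
      (\<forall>x \<in> carrier ?M. ?one x) \<and> (\<forall>x \<in> carrier ?M. curvature \<Omega> ?M nab x \<in>
        Om2_map ?M (iota \<Omega> (Suc k) E) ` carrier (Om2 (syms (Suc k) E)))"
      using True spencer0_eq[OF E, of _ k]
      by (simp add: jet_connections_def Suc jet_proj_Suc del: jet_rec_simps)
    have pair: "jet1_pair ?M x (nab x) \<in> carrier (jets (Suc (Suc k)) E) \<longleftrightarrow>
      ?one x \<and> cov ?N (proj1 ?N) (jet1_form ?N) (nab x) = \<zero>\<^bsub>Om2 ?N\<^esub>" if "x \<in> carrier ?M" for x
      unfolding Jet_Suc_Suc_iff[OF N M] using jet1_pair[OF M that dd(4)[OF that]] by simp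
    show ?thesis
      unfolding jc using True pair main by (simp only: Suc) blast
  qed
qed (simp add: jet_connections_def)

text \<open>For the inverse, linearity into \<open>jet1\<close> is the Leibniz rule of the
  connection read on pairs, while \<open>jet_connections_iff\<close> decides whether the values are
  holonomic.\<close>

lemma bij_betw_assoc_connection:
  fixes E :: "('w, 'e) emodule"
  assumes E: "lmod E" and hyp: "n = 0 \<or> flat_forms \<Omega> 2 TYPE('e) \<and> jet_seq_left_exact \<Omega> n E"
  shows "bij_betw (assoc_connection \<Omega> (Suc n) E) (n_connections \<Omega> (Suc n) E) (jet_connections \<Omega> (Suc n) E)"
proof -
  let ?N = "jets n E" and ?M = "jets (Suc n) E"
  note N = Jet_module[OF E, of n]
  note iff = jet_connections_iff[OF E hyp]
  define g where "g = (\<lambda>nab. restrict (\<lambda>x. jet1_pair ?N x (nab x)) (carrier ?N))"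
  have ext: "assoc_connection \<Omega> (Suc n) E C \<in> extensional (carrier ?N)" for C
    by (simp add: assoc_connection_def)
  show ?thesis
  proof (rule bij_betw_byWitness[where f' = g])
    show "\<forall>C \<in> n_connections \<Omega> (Suc n) E. g (assoc_connection \<Omega> (Suc n) E C) = C"
    proof
      fix C assume C: "C \<in> n_connections \<Omega> (Suc n) E"
      have "C \<in> extensional (carrier ?N)" using C by (simp add: n_connections_iff linear_maps_iff)
      then show "g (assoc_connection \<Omega> (Suc n) E C) = C"
        by (intro extensionalityI[of _ "carrier ?N"]) (simp_all add: g_def flip: n_connection_eq_pair[OF E C])
    qed
    show "assoc_connection \<Omega> (Suc n) E ` n_connections \<Omega> (Suc n) E \<subseteq> jet_connections \<Omega> (Suc n) E"
    proof (rule image_subsetI)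
      fix C assume C: "C \<in> n_connections \<Omega> (Suc n) E"
      let ?a = "assoc_connection \<Omega> (Suc n) E C"
      have lin: "lin ?N ?M C" and pC: "\<And>x. x \<in> carrier ?N \<Longrightarrow> proj1 ?N (C x) = x"
        using C by (auto simp: n_connections_iff linear_maps_iff)
      have "derivation ?N ?N (\<lambda>x. proj1 ?N (C x)) (\<lambda>x. jet1_form ?N (C x))"
        by (rule derivation_comp[OF lin derivation_Jet[OF N]])
      then have "derivation ?N ?N (\<lambda>x. x) ?a"
        by (simp add: derivation_def linear_map_def additive_def assoc_connection_eq[OF E C] pC
            lmod_intros[OF N])
      then show "?a \<in> jet_connections \<Omega> (Suc n) E"
        unfolding iff connections_iff[OF N]
        by (simp add: ext linear_map_closed[OF lin] del: Jet.simps flip: n_connection_eq_pair[OF E C])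
    qed
    have gC: "g nab \<in> n_connections \<Omega> (Suc n) E \<and> assoc_connection \<Omega> (Suc n) E (g nab) = nab"
      if nab: "nab \<in> jet_connections \<Omega> (Suc n) E" for nab
    proof -
      have d: "derivation ?N ?N (\<lambda>x. x) nab" and e: "nab \<in> extensional (carrier ?N)"
        and M: "\<And>x. x \<in> carrier ?N \<Longrightarrow> jet1_pair ?N x (nab x) \<in> carrier ?M"
        using nab unfolding iff connections_iff[OF N] by auto
      note dd = derivationD[OF d]
      note jp = jet1_pair[OF N _ dd(4)]
      have gp: "proj1 ?N (g nab x) = x" "jet1_form ?N (g nab x) = nab x" if "x \<in> carrier ?N" for x
        using that by (simp_all add: g_def jp)
      have d': "derivation ?N ?N (\<lambda>x. proj1 ?N (g nab x)) (\<lambda>x. jet1_form ?N (g nab x))"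
        using d by (simp add: derivation_def linear_map_def additive_def gp lmod_intros[OF N])
      have "lin ?N (jet1 ?N) (g nab)"
        by (rule linear_map_J1I[OF N N _ d']) (simp add: g_def jp)
      then have "lin ?N ?M (g nab)"
        \<comment> \<open>Linearity is known with target \<open>jet1 ?N\<close>; the operations on
          \<open>?M\<close> are the same, so only membership in the smaller carrier is
          added.\<close>
        using M by (simp add: linear_map_def additive_def g_def Jet_Suc_simps del: Jet.simps)
      then have C: "g nab \<in> n_connections \<Omega> (Suc n) E"
        by (simp add: n_connections_iff linear_maps_iff g_def jp del: Jet.simps)
      have "assoc_connection \<Omega> (Suc n) E (g nab) = nab"
        by (rule extensionalityI[OF ext e]) (simp add: assoc_connection_eq[OF E C], simp add: g_def jp)
      then show ?thesis using C by blast
    qed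
    show "\<forall>nab \<in> jet_connections \<Omega> (Suc n) E. assoc_connection \<Omega> (Suc n) E (g nab) = nab"
      "g ` jet_connections \<Omega> (Suc n) E \<subseteq> n_connections \<Omega> (Suc n) E" using gC by auto
  qed
qed

text \<open>Starting from \<open>C\<close>, injectivity of \<open>iota\<close> and its image being
  the kernel yield the splitting \<open>T\<close>, generation by prolongations makes
  \<open>T\<close> unique, and surjectivity of the projection makes \<open>C\<close> unique.\<close>

lemma n_connection_from_splitting:
  assumes E: "lmod E" and gen: "jets_generated \<Omega> (Suc n) E" and exact: "jet_seq_exact \<Omega> (Suc n) E"
    and C: "C \<in> n_connections \<Omega> (Suc n) E" and nab: "assoc_connection \<Omega> (Suc n) E C = nab"
  shows "\<exists>D T. D \<in> diff_ops \<Omega> (Suc n) E (syms (Suc n) E) \<and>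
      (\<forall>D' \<in> carrier E \<rightarrow>\<^sub>E carrier (syms (Suc n) E).
         (\<forall>e \<in> carrier E. Om1_map (jets n E) (iota \<Omega> n E) (D' e) = nab (prol \<Omega> n E e)) \<longleftrightarrow> D' = D) \<and>
      (\<forall>T' \<in> linear_maps (coeffs \<Omega>) (jets (Suc n) E) (syms (Suc n) E).
         (\<forall>e \<in> carrier E. T' (prol \<Omega> (Suc n) E e) = D e) \<longleftrightarrow> T' = T) \<and>
      T \<in> linear_maps (coeffs \<Omega>) (jets (Suc n) E) (syms (Suc n) E) \<and>
      (\<forall>s \<in> carrier (syms (Suc n) E). T (iota \<Omega> (Suc n) E s) = s) \<and>
      (\<forall>C' \<in> carrier (jets n E) \<rightarrow>\<^sub>E carrier (jets (Suc n) E).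
         (\<forall>x \<in> carrier (jets (Suc n) E).
            C' (jet_proj \<Omega> (Suc n) E x) = x \<ominus>\<^bsub>jets (Suc n) E\<^esub> iota \<Omega> (Suc n) E (T x)) \<longleftrightarrow> C' = C)"
proof -
  let ?N = "jets n E" and ?M = "jets (Suc n) E" and ?S = "syms (Suc n) E" and ?i = "iota \<Omega> (Suc n) E"
  let ?p = "proj1 ?N" and ?s = "jet1_form ?N"
  note N = Jet_module[OF E, of n] and M = Jet_module[OF E, of "Suc n"] and S = Sym_module[OF E, of "Suc n"]
  note S0 = Sym_module[OF E, of n]
  note i0 = iota_linear[OF E, of n] and i = iota_linear[OF E, of "Suc n"]
  interpret NG: abelian_group ?N by (rule left_module_group[OF N])
  interpret MG: abelian_group ?M by (rule left_module_group[OF M])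
  interpret SG: abelian_group ?S by (rule left_module_group[OF S])
  interpret O: abelian_group "Om1 ?N" by (rule Om_group[OF N])
  note d = derivation_Jet[OF N] note dd = derivationD[OF d]
  note p = dd(1)
  have Cl: "lin ?N ?M C" and Ce: "C \<in> extensional (carrier ?N)"
    and pC: "\<And>x. x \<in> carrier ?N \<Longrightarrow> ?p (C x) = x"
    using C by (auto simp: n_connections_iff linear_maps_iff)
  have inj: "inj_on ?i (carrier ?S)" and ker: "?i ` carrier ?S = {x \<in> carrier ?M. ?p x = \<zero>\<^bsub>?N\<^esub>}"
    and surj: "?p ` carrier ?M = carrier ?N"
    using exact by (simp_all add: jet_seq_exact_def jet_seq_left_exact_def jet_proj_Suc del: jet_rec_simps)
  \<comment> \<open>The projector onto the kernel of the projection that belongs to the section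
    \<open>C\<close>; \<open>T\<close> is \<open>h\<close> followed by the inverse of
    \<open>iota\<close> on its image.\<close>
  define h where "h = (\<lambda>x. x \<ominus>\<^bsub>?M\<^esub> C (?p x))"
  have h_lin: "lin ?M ?M h"
  proof -
    note CP = linear_map_comp[OF p Cl]
    have "additive ?M ?M h"
      unfolding h_def by (rule additive_diff[OF MG.abelian_group_axioms _ linear_map_additive[OF CP]])
        (simp add: additive_def)
    moreover have "h (a \<odot>\<^bsub>?M\<^esub> x) = a \<odot>\<^bsub>?M\<^esub> h x" if a: "a \<in> carrier (coeffs \<Omega>)" and x: "x \<in> carrier ?M" for a x
      unfolding h_def linear_map_smult[OF CP a x]
      by (rule additive_minus[OF MG.abelian_group_axioms MG.abelian_group_axioms additive_smult[OF M a] x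
            linear_map_closed[OF CP x], symmetric])
    ultimately show ?thesis by (simp add: linear_map_def)
  qed
  have h_img: "h x \<in> ?i ` carrier ?S" if x: "x \<in> carrier ?M" for x
  proof -
    have "?p (h x) = ?p x \<ominus>\<^bsub>?N\<^esub> ?p (C (?p x))"
      unfolding h_def by (rule additive_minus[OF MG.abelian_group_axioms NG.abelian_group_axioms
            linear_map_additive[OF p] x linear_map_closed[OF Cl dd(3)[OF x]]])
    also have "\<dots> = \<zero>\<^bsub>?N\<^esub>" using dd(3)[OF x] by (simp add: pC a_minus_def NG.r_neg)
    finally show ?thesis unfolding ker using linear_map_closed[OF h_lin x] by simp
  qed
  define T where "T = restrict (\<lambda>x. inv_into (carrier ?S) ?i (h x)) (carrier ?M)"
  have T: "T x \<in> carrier ?S" "?i (T x) = h x" if "x \<in> carrier ?M" for x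
    using inv_into_into[OF h_img[OF that]] f_inv_into_f[OF h_img[OF that]] that by (simp_all add: T_def)
  have T_lin: "lin ?M ?S T"
    unfolding linear_map_def additive_def
  proof (intro conjI ballI)
    fix x assume x: "x \<in> carrier ?M"
    show "T x \<in> carrier ?S" by (rule T(1)[OF x])
    fix y assume y: "y \<in> carrier ?M"
    show "T (x \<oplus>\<^bsub>?M\<^esub> y) = T x \<oplus>\<^bsub>?S\<^esub> T y"
      by (rule inj_onD[OF inj]) (use x y in \<open>simp_all add: T additive_add[OF linear_map_additive[OF i]]
        additive_add[OF linear_map_additive[OF h_lin]] del: jet_rec_simps\<close>)
  next
    fix a x assume a: "a \<in> carrier (coeffs \<Omega>)" and x: "x \<in> carrier ?M"
    then have a0: "a \<in> gr 0" by simp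
    show "T (a \<odot>\<^bsub>?M\<^esub> x) = a \<odot>\<^bsub>?S\<^esub> T x"
      by (rule inj_onD[OF inj]) (use x a0 in \<open>simp_all add: T linear_map_smult[OF i a] linear_map_smult[OF h_lin a]
        lmod_smult[OF M] lmod_smult[OF S] del: jet_rec_simps\<close>)
  qed
  have T_mem: "T \<in> linear_maps (coeffs \<Omega>) ?M ?S"
    using T_lin by (simp add: linear_maps_iff T_def)
  have T_split: "T (?i s) = s" if s: "s \<in> carrier ?S" for s
  proof -
    have iM: "?i s \<in> carrier ?M" by (rule linear_map_closed[OF i s])
    have "C \<zero>\<^bsub>?N\<^esub> = \<zero>\<^bsub>?M\<^esub>"
      by (rule additive_zero[OF NG.abelian_group_axioms MG.abelian_group_axioms linear_map_additive[OF Cl]])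
    moreover have "?p (?i s) = \<zero>\<^bsub>?N\<^esub>" by (rule iota_Suc(1)[OF E i0 s])
    moreover have "\<ominus>\<^bsub>?M\<^esub> \<zero>\<^bsub>?M\<^esub> = \<zero>\<^bsub>?M\<^esub>" by (rule MG.minus_equality) simp_all
    ultimately have "h (?i s) = ?i s" using iM by (simp add: h_def a_minus_def del: jet_rec_simps)
    then show ?thesis using inj_onD[OF inj _ T(1)[OF iM] s] T(2)[OF iM] by simp
  qed
  \<comment> \<open>The operator is defined as \<open>T\<close> after prolongation, which makes it
    of order at most \<open>Suc n\<close> at once; only the equation with \<open>nab\<close> remains
    to be shown.\<close>
  define D where "D = restrict (\<lambda>e. T (prol \<Omega> (Suc n) E e)) (carrier E)"
  note pm = prol_closed[OF E, of _ "Suc n"] and pn = prol_closed[OF E, of _ n]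
  have D_mem: "D \<in> diff_ops \<Omega> (Suc n) E ?S"
  proof -
    have "D (scal \<Omega> E c e) = scal \<Omega> ?S c (D e)" if c: "c \<in> carrier (scalars \<Omega>)" and e: "e \<in> carrier E" for c e
      using e smult_one_grade[OF c] linear_map_smult[OF T_lin, of "c \<odot> \<one>"] pm[OF e]
      by (simp add: D_def prol_scal[OF E e c] scal_def lmod_smult[OF E] prol_scal[OF E e c, unfolded scal_def] del: jet_rec_simps)
    moreover have "D (e \<oplus>\<^bsub>E\<^esub> e') = D e \<oplus>\<^bsub>?S\<^esub> D e'" if "e \<in> carrier E" "e' \<in> carrier E" for e e'
      using that pm additive_add[OF linear_map_additive[OF T_lin]]
      by (simp add: D_def prol_add[OF E] lmod_add_closed[OF E] del: jet_rec_simps)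
    moreover have "D \<in> carrier E \<rightarrow>\<^sub>E carrier ?S"
      using T(1) pm by (auto simp: D_def simp del: jet_rec_simps)
    ultimately have "D \<in> scalar_linear_maps \<Omega> E ?S" by (simp add: scalar_linear_maps_def)
    moreover have "\<forall>e \<in> carrier E. T (prol \<Omega> (Suc n) E e) = D e" by (simp add: D_def)
    ultimately show ?thesis using T_mem unfolding diff_ops_def by blast
  qed
  have D_eq: "Om1_map ?N (iota \<Omega> n E) (D e) = nab (prol \<Omega> n E e)" if e: "e \<in> carrier E" for e
  proof -
    let ?x = "prol \<Omega> (Suc n) E e" and ?y = "prol \<Omega> n E e"
    have De: "D e \<in> carrier ?S" using T(1)[OF pm[OF e]] e by (simp add: D_def)
    have Cy: "C ?y \<in> carrier ?M" by (rule linear_map_closed[OF Cl pn[OF e]])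
    have OD: "Om1_map ?N (iota \<Omega> n E) (D e) \<in> carrier (Om1 ?N)"
      using De Sym_Suc(2) additive_closed[OF Om_map_additive[OF S0 N i0]] by blast
    \<comment> \<open>The prolongation is the pair of \<open>?y\<close> and zero, so
      \<open>?x - C ?y\<close> has form \<open>- nab ?y\<close>. The sign built into
      \<open>iota1\<close> matches it.\<close>
    have px: "?p ?x = ?y" "?s ?x = \<zero>\<^bsub>Om1 ?N\<^esub>" using prol1[OF N pn[OF e]] by simp_all
    have "\<ominus>\<^bsub>Om1 ?N\<^esub> Om1_map ?N (iota \<Omega> n E) (D e) = ?s (?i (D e))"
      by (rule iota_Suc(2)[OF E i0 De, symmetric])
    also have "\<dots> = ?s (?x \<ominus>\<^bsub>?M\<^esub> C ?y)"
      using e T(2)[OF pm[OF e]] by (simp only: D_def restrict_apply' h_def px)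
    also have "\<dots> = ?s ?x \<ominus>\<^bsub>Om1 ?N\<^esub> ?s (C ?y)"
      by (rule additive_minus[OF MG.abelian_group_axioms O.abelian_group_axioms dd(2) pm[OF e] Cy])
    also have "\<dots> = \<ominus>\<^bsub>Om1 ?N\<^esub> nab ?y"
      unfolding px(2) using dd(4)[OF Cy] by (simp add: a_minus_def assoc_connection_eq[OF E C pn[OF e]] flip: nab)
    finally have "\<ominus>\<^bsub>Om1 ?N\<^esub> Om1_map ?N (iota \<Omega> n E) (D e) = \<ominus>\<^bsub>Om1 ?N\<^esub> nab ?y" .
    moreover have "nab ?y \<in> carrier (Om1 ?N)"
      using dd(4)[OF Cy] by (simp add: assoc_connection_eq[OF E C pn[OF e]] flip: nab)
    ultimately show ?thesis using OD by (metis O.minus_minus)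
  qed
  have D_uniq: "D' = D" if D': "D' \<in> carrier E \<rightarrow>\<^sub>E carrier ?S"
    and eq: "\<forall>e \<in> carrier E. Om1_map ?N (iota \<Omega> n E) (D' e) = nab (prol \<Omega> n E e)" for D'
  proof (rule extensionalityI)
    show "D' \<in> extensional (carrier E)" using D' by (simp add: PiE_iff)
    show "D \<in> extensional (carrier E)" by (simp add: D_def)
    fix e assume e: "e \<in> carrier E"
    have c: "D' e \<in> carrier ?S" "D e \<in> carrier ?S" using D' e T(1)[OF pm[OF e]] by (auto simp: D_def simp del: Sym.simps)
    \<comment> \<open>Since \<open>iota\<close> of order \<open>Suc n\<close> factors through
      \<open>\<Omega>\<^sup>1\<close> of the previous one, equal values under the latter give equal
      values under the former, and that one is injective by exactness.\<close>
    have "?i (D' e) = ?i (D e)"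
      unfolding iota_Suc_eq[OF E c(1)] iota_Suc_eq[OF E c(2)] using eq D_eq e by simp
    then show "D' e = D e" using inj_onD[OF inj _ c] by blast
  qed
  have T_uniq: "T' = T" if T': "T' \<in> linear_maps (coeffs \<Omega>) ?M ?S"
    and eq: "\<forall>e \<in> carrier E. T' (prol \<Omega> (Suc n) E e) = D e" for T'
  proof (rule extensionalityI)
    show "T' \<in> extensional (carrier ?M)" using T' by (simp add: linear_maps_iff)
    show "T \<in> extensional (carrier ?M)" by (simp add: T_def)
    have T'_lin: "lin ?M ?S T'" using T' by (simp add: linear_maps_iff)
    fix x assume "x \<in> carrier ?M"
    \<comment> \<open>Two linear maps that agree on prolongations agree everywhere, as every jet is
      a combination of prolongations.\<close>
    then obtain xs where xs: "set xs \<subseteq> carrier (coeffs \<Omega>) \<times> carrier E"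
      and x: "x = list_sum ?M (\<lambda>(a, e). a \<odot>\<^bsub>?M\<^esub> prol \<Omega> (Suc n) E e) xs"
      using gen unfolding jets_generated_def by auto
    let ?f = "\<lambda>(a, e). a \<odot>\<^bsub>?M\<^esub> prol \<Omega> (Suc n) E e"
    have f: "?f q \<in> carrier ?M" if "q \<in> set xs" for q
      using xs that lmod_smult[OF M] pm by (auto simp del: jet_rec_simps)
    have "T' x = list_sum ?S (\<lambda>q. T' (?f q)) xs"
      unfolding x by (rule additive_list_sum[OF MG.abelian_group_axioms SG.abelian_group_axioms
            linear_map_additive[OF T'_lin] f])
    also have "\<dots> = list_sum ?S (\<lambda>q. T (?f q)) xs"
    proof (rule list_sum_cong)
      fix q assume q: "q \<in> set xs"
      obtain a e where ae: "q = (a, e)" by force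
      then have a: "a \<in> carrier (coeffs \<Omega>)" and e: "e \<in> carrier E" using xs q by auto
      show "T' (?f q) = T (?f q)"
        using eq e by (simp only: ae prod.case linear_map_smult[OF T'_lin a pm[OF e]] linear_map_smult[OF T_lin a pm[OF e]]
            D_def restrict_apply')
    qed
    also have "\<dots> = T x"
      unfolding x by (rule additive_list_sum[OF MG.abelian_group_axioms SG.abelian_group_axioms
            linear_map_additive[OF T_lin] f, symmetric])
    finally show "T' x = T x" .
  qed
  have C_eq: "C (?p x) = x \<ominus>\<^bsub>?M\<^esub> ?i (T x)" if x: "x \<in> carrier ?M" for x
  proof -
    have c: "C (?p x) \<in> carrier ?M" by (rule linear_map_closed[OF Cl dd(3)[OF x]])
    show ?thesis
      unfolding T(2)[OF x] h_def using x c
      by (simp add: a_minus_def MG.minus_add MG.r_neg1 MG.r_neg2 del: Jet.simps)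
  qed
  have C_uniq: "C' = C" if C': "C' \<in> carrier ?N \<rightarrow>\<^sub>E carrier ?M"
    and eq: "\<forall>x \<in> carrier ?M. C' (?p x) = x \<ominus>\<^bsub>?M\<^esub> ?i (T x)" for C'
  proof (rule extensionalityI[OF _ Ce])
    show "C' \<in> extensional (carrier ?N)" using C' by (simp add: PiE_iff)
    fix y assume "y \<in> carrier ?N"
    \<comment> \<open>The equation only prescribes \<open>C'\<close> on the range of the projection,
      which is everything by exactness.\<close>
    then obtain x where "x \<in> carrier ?M" "y = ?p x" using surj by blast
    then show "C' y = C y" using eq C_eq by simp
  qed
  have TD: "\<forall>e \<in> carrier E. T (prol \<Omega> (Suc n) E e) = D e" by (simp add: D_def)
  have "\<forall>D' \<in> carrier E \<rightarrow>\<^sub>E carrier ?S.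
      (\<forall>e \<in> carrier E. Om1_map ?N (iota \<Omega> n E) (D' e) = nab (prol \<Omega> n E e)) \<longleftrightarrow> D' = D"
    using D_eq D_uniq by blast
  moreover have "\<forall>T' \<in> linear_maps (coeffs \<Omega>) ?M ?S.
      (\<forall>e \<in> carrier E. T' (prol \<Omega> (Suc n) E e) = D e) \<longleftrightarrow> T' = T"
    using TD T_uniq by blast
  moreover have "\<forall>s \<in> carrier ?S. T (?i s) = s" using T_split by blast
  moreover have "\<forall>C' \<in> carrier ?N \<rightarrow>\<^sub>E carrier ?M.
      (\<forall>x \<in> carrier ?M. C' (jet_proj \<Omega> (Suc n) E x) = x \<ominus>\<^bsub>?M\<^esub> ?i (T x)) \<longleftrightarrow> C' = C"
    unfolding jet_proj_Suc using C_eq C_uniq by blast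
  ultimately show ?thesis
    using D_mem T_mem by (intro exI conjI)
qed

end

theorem theorem4p18:
  fixes \<Omega> :: "('k, 'w) dg_algebra" and E :: "('w, 'e) emodule" and n :: nat
  assumes "exterior_algebra \<Omega>" and "left_module (coeffs \<Omega>) E" and "n \<ge> 1"
    and "n = 1 \<or> (n > 1 \<and> flat_forms \<Omega> 1 TYPE('e) \<and> flat_forms \<Omega> 2 TYPE('e) \<and>
           jets_generated \<Omega> n E \<and> jet_seq_exact \<Omega> n E)"
    and "n \<ge> 3 \<Longrightarrow> jet_seq_left_exact \<Omega> (n - 1) E"
    and "n \<ge> 4 \<Longrightarrow> inj_on (iota \<Omega> (n - 2) E) (carrier (Sym \<Omega> (n - 2) E))"
  shows "bij_betw (assoc_connection \<Omega> n E) (n_connections \<Omega> n E) (jet_connections \<Omega> n E) \<and>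
    (\<forall>nab \<in> jet_connections \<Omega> n E. \<exists>D T C.
      \<comment> \<open>the differential operator of order at most \<open>n\<close> defined by \<open>nab\<close>, and its uniqueness\<close>
      D \<in> diff_ops \<Omega> n E (Sym \<Omega> n E) \<and>
      (\<forall>D' \<in> carrier E \<rightarrow>\<^sub>E carrier (Sym \<Omega> n E).
         (\<forall>e \<in> carrier E. Om_map \<Omega> 1 (Jet \<Omega> (n - 1) E) (iota \<Omega> (n - 1) E) (sym_incl n E (D' e)) =
            nab (prol \<Omega> (n - 1) E e)) \<longleftrightarrow> D' = D) \<and>
      \<comment> \<open>its unique linear lift, a left splitting\<close>
      (\<forall>T' \<in> linear_maps (coeffs \<Omega>) (Jet \<Omega> n E) (Sym \<Omega> n E).
         (\<forall>e \<in> carrier E. T' (prol \<Omega> n E e) = D e) \<longleftrightarrow> T' = T) \<and>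
      T \<in> linear_maps (coeffs \<Omega>) (Jet \<Omega> n E) (Sym \<Omega> n E) \<and>
      (\<forall>s \<in> carrier (Sym \<Omega> n E). T (iota \<Omega> n E s) = s) \<and>
      \<comment> \<open>the n-connection determined by it\<close>
      C \<in> n_connections \<Omega> n E \<and>
      (\<forall>C' \<in> carrier (Jet \<Omega> (n - 1) E) \<rightarrow>\<^sub>E carrier (Jet \<Omega> n E).
         (\<forall>x \<in> carrier (Jet \<Omega> n E).
            C' (jet_proj \<Omega> n E x) = x \<ominus>\<^bsub>Jet \<Omega> n E\<^esub> iota \<Omega> n E (T x)) \<longleftrightarrow> C' = C) \<and>
      assoc_connection \<Omega> n E C = nab) \<and>
    (n = 1 \<longrightarrow> jet_connections \<Omega> n E = connections \<Omega> E \<and>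
      n_connections \<Omega> n E =
        {C \<in> linear_maps (coeffs \<Omega>) E (J1 \<Omega> E). \<forall>e \<in> carrier E. proj1 E (C e) = e} \<and>
      (\<forall>nab \<in> connections \<Omega> E. \<exists>T C.
         T \<in> linear_maps (coeffs \<Omega>) (J1 \<Omega> E) (Om \<Omega> 1 E) \<and>
         (\<forall>T' \<in> linear_maps (coeffs \<Omega>) (J1 \<Omega> E) (Om \<Omega> 1 E).
            (\<forall>e \<in> carrier E. T' (prol1 \<Omega> E e) = nab e) \<longleftrightarrow> T' = T) \<and>
         C \<in> n_connections \<Omega> n E \<and> assoc_connection \<Omega> n E C = nab \<and>
         (\<forall>x \<in> carrier (J1 \<Omega> E). C (proj1 E x) = x \<ominus>\<^bsub>J1 \<Omega> E\<^esub> iota1 \<Omega> E (T x))))"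
proof -
  interpret exterior_algebra \<Omega> by fact
  note E = assms(2)
  obtain m where n: "n = Suc m" using assms(3) by (cases n) auto
  have exact: "jet_seq_exact \<Omega> (Suc m) E" and gen: "jets_generated \<Omega> (Suc m) E"
    using assms(4) jet_seq_exact_1[OF E] jets_generated_1[OF E] by (auto simp: n One_nat_def)
  \<comment> \<open>Left exactness in order \<open>m = n - 1\<close>: for \<open>m = 1\<close> it
    holds for every exterior algebra by \<open>jet_seq_exact_1\<close>, and for
    \<open>m \<ge> 2\<close> it is the assumption for \<open>n \<ge> 3\<close>.\<close>
  have hyp: "m = 0 \<or> flat_forms \<Omega> 2 TYPE('e) \<and> jet_seq_left_exact \<Omega> m E"
  proof (cases "m \<le> 1")
    case True
    then have "m = 0 \<or> m = 1" by linarith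
    then show ?thesis using assms(4) jet_seq_exact_1[OF E] by (auto simp: n jet_seq_exact_def)
  next
    case False
    then show ?thesis using assms(4,5) by (auto simp: n)
  qed
  have bij: "bij_betw (assoc_connection \<Omega> n E) (n_connections \<Omega> n E) (jet_connections \<Omega> n E)"
    unfolding n by (rule bij_betw_assoc_connection[OF E hyp])
  have ex: "\<exists>D T C.
      D \<in> diff_ops \<Omega> n E (Sym \<Omega> n E) \<and>
      (\<forall>D' \<in> carrier E \<rightarrow>\<^sub>E carrier (Sym \<Omega> n E).
         (\<forall>e \<in> carrier E. Om_map \<Omega> 1 (Jet \<Omega> (n - 1) E) (iota \<Omega> (n - 1) E) (sym_incl n E (D' e)) =
            nab (prol \<Omega> (n - 1) E e)) \<longleftrightarrow> D' = D) \<and>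
      (\<forall>T' \<in> linear_maps (coeffs \<Omega>) (Jet \<Omega> n E) (Sym \<Omega> n E).
         (\<forall>e \<in> carrier E. T' (prol \<Omega> n E e) = D e) \<longleftrightarrow> T' = T) \<and>
      T \<in> linear_maps (coeffs \<Omega>) (Jet \<Omega> n E) (Sym \<Omega> n E) \<and>
      (\<forall>s \<in> carrier (Sym \<Omega> n E). T (iota \<Omega> n E s) = s) \<and>
      C \<in> n_connections \<Omega> n E \<and>
      (\<forall>C' \<in> carrier (Jet \<Omega> (n - 1) E) \<rightarrow>\<^sub>E carrier (Jet \<Omega> n E).
         (\<forall>x \<in> carrier (Jet \<Omega> n E).
            C' (jet_proj \<Omega> n E x) = x \<ominus>\<^bsub>Jet \<Omega> n E\<^esub> iota \<Omega> n E (T x)) \<longleftrightarrow> C' = C) \<and>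
      assoc_connection \<Omega> n E C = nab" if nab: "nab \<in> jet_connections \<Omega> n E" for nab
  proof -
    \<comment> \<open>By the bijection the given connection is that of some \<open>C\<close>, and
      \<open>n_connection_from_splitting\<close> then supplies the operator and the
      splitting.\<close>
    have "nab \<in> assoc_connection \<Omega> n E ` n_connections \<Omega> n E"
      unfolding bij_betw_imp_surj_on[OF bij] by (rule nab)
    then obtain C where C: "C \<in> n_connections \<Omega> n E" "assoc_connection \<Omega> n E C = nab"
      by (rule imageE) simp
    show ?thesis
      using n_connection_from_splitting[OF E gen exact C[unfolded n]] C
      unfolding n sym_incl_def diff_Suc_1 by (elim exE conjE, intro exI conjI) assumption+
  qed
  have one: "jet_connections \<Omega> n E = connections \<Omega> E \<and>
      n_connections \<Omega> n E =
        {C \<in> linear_maps (coeffs \<Omega>) E (J1 \<Omega> E). \<forall>e \<in> carrier E. proj1 E (C e) = e} \<and>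
      (\<forall>nab \<in> connections \<Omega> E. \<exists>T C.
         T \<in> linear_maps (coeffs \<Omega>) (J1 \<Omega> E) (Om \<Omega> 1 E) \<and>
         (\<forall>T' \<in> linear_maps (coeffs \<Omega>) (J1 \<Omega> E) (Om \<Omega> 1 E).
            (\<forall>e \<in> carrier E. T' (prol1 \<Omega> E e) = nab e) \<longleftrightarrow> T' = T) \<and>
         C \<in> n_connections \<Omega> n E \<and> assoc_connection \<Omega> n E C = nab \<and>
         (\<forall>x \<in> carrier (J1 \<Omega> E). C (proj1 E x) = x \<ominus>\<^bsub>J1 \<Omega> E\<^esub> iota1 \<Omega> E (T x)))" if "n = 1"
  proof (intro conjI ballI)
    have n1: "n = Suc 0" using that by (simp add: One_nat_def)
    have "jet1_pair E x (nab x) \<in> carrier (J1 \<Omega> E)" if "derivation E E (\<lambda>x. x) nab" "x \<in> carrier E" for nab x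
      by (rule jet1_pair(1)[OF E that(2) derivationD(4)[OF that]])
    then show jc: "jet_connections \<Omega> n E = connections \<Omega> E"
      using jet_connections_iff[OF E, of 0] connections_iff[OF E] by (auto simp: n1)
    show "n_connections \<Omega> n E = {C \<in> linear_maps (coeffs \<Omega>) E (J1 \<Omega> E). \<forall>e \<in> carrier E. proj1 E (C e) = e}"
      using n_connections_iff[of _ 0 E] by (auto simp: n1)
    fix nab assume nab: "nab \<in> connections \<Omega> E"
    obtain D T C where
      D: "D \<in> diff_ops \<Omega> n E (Sym \<Omega> n E)"
      and D_uniq: "\<forall>D' \<in> carrier E \<rightarrow>\<^sub>E carrier (Sym \<Omega> n E).
         (\<forall>e \<in> carrier E. Om_map \<Omega> 1 (Jet \<Omega> (n - 1) E) (iota \<Omega> (n - 1) E) (sym_incl n E (D' e)) =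
            nab (prol \<Omega> (n - 1) E e)) \<longleftrightarrow> D' = D"
      and T_uniq: "\<forall>T' \<in> linear_maps (coeffs \<Omega>) (Jet \<Omega> n E) (Sym \<Omega> n E).
         (\<forall>e \<in> carrier E. T' (prol \<Omega> n E e) = D e) \<longleftrightarrow> T' = T"
      and T: "T \<in> linear_maps (coeffs \<Omega>) (Jet \<Omega> n E) (Sym \<Omega> n E)"
      and C: "C \<in> n_connections \<Omega> n E" "assoc_connection \<Omega> n E C = nab"
      and C_uniq: "\<forall>C' \<in> carrier (Jet \<Omega> (n - 1) E) \<rightarrow>\<^sub>E carrier (Jet \<Omega> n E).
         (\<forall>x \<in> carrier (Jet \<Omega> n E).
            C' (jet_proj \<Omega> n E x) = x \<ominus>\<^bsub>Jet \<Omega> n E\<^esub> iota \<Omega> n E (T x)) \<longleftrightarrow> C' = C"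
      using ex[of nab] nab jc by blast
    have DE: "D \<in> carrier E \<rightarrow>\<^sub>E carrier (Om \<Omega> 1 E)"
      using D by (simp add: diff_ops_def scalar_linear_maps_def n1)
    have D_nab: "D e = nab e" if e: "e \<in> carrier E" for e
    proof -
      have "D e \<in> carrier (Om \<Omega> 1 E)" using DE e by auto
      \<comment> \<open>The uniqueness clause is used at \<open>D\<close> itself; as
        \<open>iota\<close> of order zero is the identity, the resulting equation says that
        \<open>D\<close> and \<open>nab\<close> agree.\<close>
      moreover have "Om_map \<Omega> 1 E (iota \<Omega> 0 E) (D e) = nab e"
        using D_uniq DE e by (auto simp: n1 sym_incl_def simp del: iota.simps)
      ultimately show ?thesis using Om_map_id[OF E, of "D e" 1 "iota \<Omega> 0 E"] by simp
    qed
    have CE: "C \<in> carrier E \<rightarrow>\<^sub>E carrier (J1 \<Omega> E)"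
      using C(1) by (simp add: n_connections_def linear_maps_def n1)
    have C_eq: "C (proj1 E x) = x \<ominus>\<^bsub>J1 \<Omega> E\<^esub> iota1 \<Omega> E (T x)" if "x \<in> carrier (J1 \<Omega> E)" for x
      using C_uniq CE that by (auto simp: n1 jet_proj_def jet_incl_def)
    show "\<exists>T C.
         T \<in> linear_maps (coeffs \<Omega>) (J1 \<Omega> E) (Om \<Omega> 1 E) \<and>
         (\<forall>T' \<in> linear_maps (coeffs \<Omega>) (J1 \<Omega> E) (Om \<Omega> 1 E).
            (\<forall>e \<in> carrier E. T' (prol1 \<Omega> E e) = nab e) \<longleftrightarrow> T' = T) \<and>
         C \<in> n_connections \<Omega> n E \<and> assoc_connection \<Omega> n E C = nab \<and>
         (\<forall>x \<in> carrier (J1 \<Omega> E). C (proj1 E x) = x \<ominus>\<^bsub>J1 \<Omega> E\<^esub> iota1 \<Omega> E (T x))"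
      using T T_uniq C C_eq D_nab by (intro exI[of _ T] exI[of _ C]) (simp add: n1)
  qed
  show ?thesis
    by (rule conjI[OF bij conjI[OF ballI[OF ex] impI[OF one]]])
qed

end
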